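(* Let $m\geq 1$ and let $A=\{i_1<i_2<\cdots<i_n\}\subseteq[m]$ with $n\geq 4$. Let $K=\mathcal{VR}(\mathcal{F}^m_{\preceq A};3)$. Then $$K\simeq \mathcal{VR}(\mathcal{F}^m_{\prec A};3)\vee\Big(\bigvee_{\binom{n}{4}}S^7\Big)\vee\Big(\bigvee_{r_A}S^4\Big),$$ where $r_A=\sum_{k=4}^{n}(i_k-i_{k-1}-1)\binom{k-1}{3}$.
   Context: Subsets of $[m]=\{1,\dots,m\}$ carry the metric $d(A,B)=|A\Delta B|$. For a metric space $X$ and $r\ge 0$, $\mathcal{VR}(X;r)$ is the simplicial complex on $X$ whose simplices are nonempty finite subsets of diameter $\le r$. Total order $\prec$ on subsets of $[m]$: $A\prec B$ if $|A|<|B|$, or if $|A|=|B|=n$, $A=\{a_1<\dots<a_n\}$, $B=\{b_1<\dots<b_n\}$ and there is $k$ with $a_k<b_k$ and $a_\ell=b_\ell$ for all $\ell<k$ (lexicographic order within the same size). $\mathcal{F}^m_{\prec A}$ is the set of subsets $B\subseteq[m]$ with $B\prec A$, and $\mathcal{F}^m_{\preceq A}=\mathcal{F}^m_{\prec A}\cup\{A\}$, each with the symmetric-difference metric. $\bigvee_k S^d$ is a wedge of $k$ copies of $S^d$ (a point if $k=0$). *)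

theory Defs
  imports "HOL-Analysis.Analysis"
begin

section \<open>Vietoris--Rips complexes\<close>

text \<open>For a finite simplex the bound on the diameter is a bound on all pairwise distances.\<close>

definition vietoris_rips :: "'a set \<Rightarrow> ('a \<Rightarrow> 'a \<Rightarrow> real) \<Rightarrow> real \<Rightarrow> 'a set set" where
  "vietoris_rips X d r =
     {\<sigma>. \<sigma> \<subseteq> X \<and> finite \<sigma> \<and> \<sigma> \<noteq> {} \<and> (\<forall>x\<in>\<sigma>. \<forall>y\<in>\<sigma>. d x y \<le> r)}"


section \<open>Geometric realization\<close>

text \<open>Points of the realization are given by their barycentric coordinates, and the topology is
  the weak (coherent) topology with respect to the closed simplices.\<close>

definition closed_simplex :: "'a set \<Rightarrow> ('a \<Rightarrow> real) set" where
  "closed_simplex \<sigma> = {t. (\<forall>v. 0 \<le> t v) \<and> (\<forall>v. v \<notin> \<sigma> \<longrightarrow> t v = 0) \<and> (\<Sum>v\<in>\<sigma>. t v) = 1}"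

definition realization :: "'a set set \<Rightarrow> ('a \<Rightarrow> real) topology" where
  "realization K = topology (\<lambda>U. U \<subseteq> (\<Union>\<sigma>\<in>K. closed_simplex \<sigma>) \<and>
     (\<forall>\<sigma>\<in>K. openin (subtopology (powertop_real UNIV) (closed_simplex \<sigma>)) (U \<inter> closed_simplex \<sigma>)))"

lemma openin_realization:
  "openin (realization K) U \<longleftrightarrow> U \<subseteq> (\<Union>\<sigma>\<in>K. closed_simplex \<sigma>) \<and>
     (\<forall>\<sigma>\<in>K. openin (subtopology (powertop_real UNIV) (closed_simplex \<sigma>)) (U \<inter> closed_simplex \<sigma>))"
proof -
  let ?T = "\<lambda>\<sigma>. subtopology (powertop_real UNIV) (closed_simplex \<sigma>)"
  have 1: "openin (?T \<sigma>) (S \<inter> T \<inter> closed_simplex \<sigma>)"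
    if "openin (?T \<sigma>) (S \<inter> closed_simplex \<sigma>)" "openin (?T \<sigma>) (T \<inter> closed_simplex \<sigma>)" for S T \<sigma>
    using openin_Int[OF that] by (simp add: Int_ac)
  have 2: "openin (?T \<sigma>) (\<Union>\<K> \<inter> closed_simplex \<sigma>)"
    if "\<And>S. S \<in> \<K> \<Longrightarrow> openin (?T \<sigma>) (S \<inter> closed_simplex \<sigma>)" for \<K> \<sigma>
  proof -
    have "openin (?T \<sigma>) (\<Union>S\<in>\<K>. S \<inter> closed_simplex \<sigma>)"
      using that by blast
    then show ?thesis
      by (simp only: Int_Union2)
  qed
  have "istopology (\<lambda>U. U \<subseteq> (\<Union>\<sigma>\<in>K. closed_simplex \<sigma>) \<and>
     (\<forall>\<sigma>\<in>K. openin (?T \<sigma>) (U \<inter> closed_simplex \<sigma>)))"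
    unfolding istopology_def
    by (intro conjI allI impI ballI 1 2) blast+
  then show ?thesis
    by (simp add: realization_def)
qed

lemma topspace_realization [simp]:
  "topspace (realization K) = (\<Union>\<sigma>\<in>K. closed_simplex \<sigma>)"
proof
  show "topspace (realization K) \<subseteq> (\<Union>\<sigma>\<in>K. closed_simplex \<sigma>)"
    using openin_topspace[of "realization K"] unfolding openin_realization by blast
  have "(\<Union>\<sigma>\<in>K. closed_simplex \<sigma>) \<inter> closed_simplex \<tau> = closed_simplex \<tau>" if "\<tau> \<in> K" for \<tau>
    using that by blast
  then have "openin (realization K) (\<Union>\<sigma>\<in>K. closed_simplex \<sigma>)"
    by (simp add: openin_realization openin_subtopology_refl)
  then show "(\<Union>\<sigma>\<in>K. closed_simplex \<sigma>) \<subseteq> topspace (realization K)"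
    by (rule openin_subset)
qed


section \<open>Quotients, disjoint unions and wedges\<close>

definition quotient_space :: "'a topology \<Rightarrow> ('a \<Rightarrow> 'b) \<Rightarrow> 'b topology" where
  "quotient_space X q =
     topology (\<lambda>U. U \<subseteq> q ` topspace X \<and> openin X {x \<in> topspace X. q x \<in> U})"

lemma openin_quotient_space:
  "openin (quotient_space X q) U \<longleftrightarrow>
     U \<subseteq> q ` topspace X \<and> openin X {x \<in> topspace X. q x \<in> U}"
proof -
  have 1: "{x \<in> topspace X. q x \<in> S \<inter> T} = {x \<in> topspace X. q x \<in> S} \<inter> {x \<in> topspace X. q x \<in> T}"
    for S T by blast
  have 2: "{x \<in> topspace X. q x \<in> \<Union>\<K>} = (\<Union>S\<in>\<K>. {x \<in> topspace X. q x \<in> S})" for \<K>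
    by blast
  have "istopology (\<lambda>U. U \<subseteq> q ` topspace X \<and> openin X {x \<in> topspace X. q x \<in> U})"
    unfolding istopology_def 1 2 by (blast intro: openin_Int openin_Union)
  then show ?thesis
    by (simp add: quotient_space_def)
qed

lemma topspace_quotient_space [simp]: "topspace (quotient_space X q) = q ` topspace X"
proof
  show "topspace (quotient_space X q) \<subseteq> q ` topspace X"
    using openin_topspace[of "quotient_space X q"] unfolding openin_quotient_space by blast
  have "{x \<in> topspace X. q x \<in> q ` topspace X} = topspace X"
    by blast
  then have "openin (quotient_space X q) (q ` topspace X)"
    by (simp add: openin_quotient_space)
  then show "q ` topspace X \<subseteq> topspace (quotient_space X q)"
    by (rule openin_subset)
qed

lemma quotient_map_quotient_space: "quotient_map X (quotient_space X q) q"
  unfolding quotient_map_def topspace_quotient_space openin_quotient_space by blast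

definition disjoint_union :: "'a topology \<Rightarrow> 'b topology \<Rightarrow> ('a + 'b) topology" where
  "disjoint_union X Y = topology (\<lambda>U. openin X (Inl -` U) \<and> openin Y (Inr -` U))"

lemma openin_disjoint_union_sum:
  "openin (disjoint_union X Y) U \<longleftrightarrow> openin X (Inl -` U) \<and> openin Y (Inr -` U)"
proof -
  have "istopology (\<lambda>U. openin X (Inl -` U) \<and> openin Y (Inr -` U))"
    unfolding istopology_def vimage_Int vimage_Union by (blast intro: openin_Int openin_Union)
  then show ?thesis
    by (simp add: disjoint_union_def)
qed

lemma topspace_disjoint_union [simp]:
  "topspace (disjoint_union X Y) = topspace X <+> topspace Y"
proof
  have "Inl -` (topspace X <+> topspace Y) = topspace X"
    and "Inr -` (topspace X <+> topspace Y) = topspace Y"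
    by auto
  then have "openin (disjoint_union X Y) (topspace X <+> topspace Y)"
    by (simp add: openin_disjoint_union_sum)
  then show "topspace X <+> topspace Y \<subseteq> topspace (disjoint_union X Y)"
    by (rule openin_subset)
  have "openin X (Inl -` topspace (disjoint_union X Y))"
    and "openin Y (Inr -` topspace (disjoint_union X Y))"
    using openin_topspace[of "disjoint_union X Y"] unfolding openin_disjoint_union_sum by blast+
  then have X: "Inl -` topspace (disjoint_union X Y) \<subseteq> topspace X"
    and Y: "Inr -` topspace (disjoint_union X Y) \<subseteq> topspace Y"
    by (simp_all add: openin_subset)
  show "topspace (disjoint_union X Y) \<subseteq> topspace X <+> topspace Y"
  proof
    fix z assume "z \<in> topspace (disjoint_union X Y)"
    then show "z \<in> topspace X <+> topspace Y"
      using X Y by (cases z) blast+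
  qed
qed

text \<open>The two base points are identified to the point \<^term>\<open>None\<close>, which is the base point of
  the wedge; every other point \<^term>\<open>z\<close> of the disjoint union becomes \<^term>\<open>Some z\<close>.\<close>

definition wedge :: "'a topology \<Rightarrow> 'a \<Rightarrow> 'b topology \<Rightarrow> 'b \<Rightarrow> ('a + 'b) option topology" where
  "wedge X x Y y =
     quotient_space (disjoint_union X Y) (\<lambda>z. if z = Inl x \<or> z = Inr y then None else Some z)"

definition nsphere_base :: "nat \<Rightarrow> real" where
  "nsphere_base = (\<lambda>i. if i = 0 then 1 else 0)"

lemma nsphere_base_in_nsphere: "nsphere_base \<in> topspace (nsphere d)"
proof -
  have "(\<Sum>i\<le>d. nsphere_base i ^ 2) = (\<Sum>i\<le>d. if i = 0 then 1 else 0)"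
    by (rule sum.cong) (simp_all add: nsphere_base_def)
  then show ?thesis
    by (simp add: nsphere nsphere_base_def)
qed

text \<open>The wedge of \<open>k\<close> copies of the \<open>d\<close>-sphere, with base point \<^term>\<open>None\<close>.\<close>

definition sphere_wedge :: "nat \<Rightarrow> nat \<Rightarrow> (nat \<times> (nat \<Rightarrow> real)) option topology" where
  "sphere_wedge k d =
     (if k = 0 then discrete_topology {None}
      else quotient_space (sum_topology (\<lambda>_. nsphere d) {..<k})
             (\<lambda>(j, x). if x = nsphere_base then None else Some (j, x)))"

lemma None_in_sphere_wedge: "None \<in> topspace (sphere_wedge k d)"
proof (cases "k = 0")
  case False
  have "(0, nsphere_base) \<in> topspace (sum_topology (\<lambda>_. nsphere d) {..<k})"
    using False nsphere_base_in_nsphere by simp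
  then have "(\<lambda>(j, x). if x = nsphere_base then None else Some (j, x)) (0, nsphere_base)
      \<in> topspace (sphere_wedge k d)"
    unfolding sphere_wedge_def using False by (simp only: topspace_quotient_space if_False imageI)
  then show ?thesis by simp
qed (simp add: sphere_wedge_def)


section \<open>Initial segments of the subsets of \<open>{1..m}\<close>\<close>

definition sym_dist :: "nat set \<Rightarrow> nat set \<Rightarrow> real" where
  "sym_dist A B = real (card (sym_diff A B))"

text \<open>Only meant for finite sets. The list of elements in increasing order is indexed from 0.\<close>

definition set_prec :: "nat set \<Rightarrow> nat set \<Rightarrow> bool" where
  "set_prec A B \<longleftrightarrow> card A < card B \<or>
     (card A = card B \<and>
      (\<exists>k < card A. sorted_list_of_set A ! k < sorted_list_of_set B ! k \<and>
         (\<forall>l < k. sorted_list_of_set A ! l = sorted_list_of_set B ! l)))"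

definition fam_prec :: "nat \<Rightarrow> nat set \<Rightarrow> nat set set" where
  "fam_prec m A = {B. B \<subseteq> {1..m} \<and> set_prec B A}"

definition fam_preceq :: "nat \<Rightarrow> nat set \<Rightarrow> nat set set" where
  "fam_preceq m A = fam_prec m A \<union> {A}"

end

theory Submission
  imports Defs
begin

text \<open>Let \<open>K\<close> and \<open>K'\<close> be the complexes with and without the last vertex \<open>A\<close>. If the link of a face
  \<open>\<sigma>\<close> is a cone, then removing the open star of \<open>\<sigma>\<close> is a deformation retraction. From \<open>K\<close> one reaches
  \<open>K'\<close> by such collapses, applied to faces containing \<open>A\<close>, and by the removal of two families of maximal
  simplices. In terms of the symmetric differences \<open>D\<close> with \<open>A\<close>, where \<open>A\<close> itself becomes \<open>{}\<close>, these are: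
  for \<open>x, y, z < b < h = Max A\<close> with \<open>x, y, z \<in> A\<close> and \<open>b \<notin> A\<close>, the 4-simplex on
  \<open>{}, {h,b}, {x,y,b}, {x,z,b}, {y,z,b}\<close>; and for every four-element subset \<open>W\<close> of \<open>A\<close>, the 7-simplex on
  \<open>{}\<close>, the four triples in \<open>W\<close> and the three pairs in \<open>W\<close> containing \<open>Max W\<close>.

  Such a simplex \<open>P\<close> consists of subsets of a set \<open>U\<close>, equal to \<open>{h,b,x,y,z}\<close> or to \<open>W\<close>, and together with the
  complements in \<open>U\<close> of its vertices it spans the boundary of a cross-polytope of which \<open>P\<close> is one facet.
  The remaining facets form a collapsible complex, so the boundary of \<open>P\<close> is null-homotopic
  and attaching \<open>P\<close> amounts to wedging on a sphere.\<close>


section \<open>Realizations of finite complexes\<close>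

text \<open>The dimensions come from cross-polytopes. With distances up to 3 allowed, a subset of a
  four-element \<open>W\<close> is adjacent to all other subsets of \<open>W\<close> except its
  complement, so the 16 subsets span the boundary of an 8-dimensional cross-polytope, a 7-sphere;
  \<open>Max W\<close> only settles which doubleton is taken from each complementary couple. In a
  five-element set distance 4 is forbidden too, so only five suitable complementary couples are
  used, which gives a 4-sphere. The obstacle is to realize null-homotopies and changes of attaching
  point concretely. All of them are zigzags of collapses through complexes with fresh vertices, so
  the only homotopy to be written down is the one behind a collapse. An attached simplex is
  exchanged for the boundary of a simplex spanned by fresh vertices and one vertex different from
  \<open>{}\<close>; later collapses, at faces through \<open>{}\<close>, do not disturb it. Since
  the base point of the wedge is an arbitrary point, the spheres hang at a vertex of its support
  until they are moved to the point itself at the end.\<close>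

definition simplicial :: "'a set set \<Rightarrow> bool" where
  "simplicial K \<longleftrightarrow> finite K \<and> (\<forall>\<tau>\<in>K. finite \<tau> \<and> \<tau> \<noteq> {} \<and> (\<forall>\<rho>. \<rho> \<subseteq> \<tau> \<and> \<rho> \<noteq> {} \<longrightarrow> \<rho> \<in> K))"

lemma simplicialD:
  assumes "simplicial K" "\<tau> \<in> K"
  shows "finite \<tau>" "\<tau> \<noteq> {}" "\<And>\<rho>. \<rho> \<subseteq> \<tau> \<Longrightarrow> \<rho> \<noteq> {} \<Longrightarrow> \<rho> \<in> K"
  using assms unfolding simplicial_def by blast+

lemma simplicial_finite_vertices: "simplicial K \<Longrightarrow> finite (\<Union>K)"
  unfolding simplicial_def by blast

lemma simplicial_UN:
  assumes "finite I" "\<And>i. i \<in> I \<Longrightarrow> simplicial (K i)"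
  shows "simplicial (\<Union>i\<in>I. K i)"
  unfolding simplicial_def
proof (intro conjI ballI)
  show "finite (\<Union>i\<in>I. K i)" using assms by (auto simp: simplicial_def)
  fix \<tau> assume "\<tau> \<in> (\<Union>i\<in>I. K i)"
  then obtain i where i: "i \<in> I" "\<tau> \<in> K i" by blast
  show "finite \<tau>" "\<tau> \<noteq> {}" using simplicialD(1,2)[OF assms(2) i(2)] i(1) by blast+
  show "\<forall>\<rho>. \<rho> \<subseteq> \<tau> \<and> \<rho> \<noteq> {} \<longrightarrow> \<rho> \<in> (\<Union>i\<in>I. K i)"
    using simplicialD(3)[OF assms(2) i(2)] i(1) by blast
qed

lemma simplicial_Un: "simplicial K \<Longrightarrow> simplicial L \<Longrightarrow> simplicial (K \<union> L)"
  using simplicial_UN[of "UNIV :: bool set" "\<lambda>b. if b then K else L"] by (simp add: UNIV_bool Un_commute)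

lemma simplicial_subset:
  assumes "simplicial K" "L \<subseteq> K" "\<And>\<tau> \<rho>. \<tau> \<in> L \<Longrightarrow> \<rho> \<subseteq> \<tau> \<Longrightarrow> \<rho> \<noteq> {} \<Longrightarrow> \<rho> \<in> L"
  shows "simplicial L"
  using assms finite_subset[of L K] unfolding simplicial_def by blast

lemma simplicial_deletion: "simplicial K \<Longrightarrow> simplicial {\<tau>\<in>K. \<not> \<sigma> \<subseteq> \<tau>}"
  by (rule simplicial_subset) (auto simp: simplicial_def)

definition underlying :: "'a set set \<Rightarrow> ('a \<Rightarrow> real) set" where
  "underlying K = (\<Union>\<sigma>\<in>K. closed_simplex \<sigma>)"

lemma underlyingI: "\<sigma> \<in> K \<Longrightarrow> t \<in> closed_simplex \<sigma> \<Longrightarrow> t \<in> underlying K"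
  by (auto simp: underlying_def)

lemma Hausdorff_space_fun: "Hausdorff_space (euclidean :: ('a \<Rightarrow> real) topology)"
  unfolding euclidean_product_topology[symmetric] Hausdorff_space_product_topology
  by simp

text \<open>Tychonoff: coordinates off \<open>\<sigma>\<close> are confined to \<open>{0}\<close>
  and the others to \<open>{0..1}\<close>, so the simplex is a closed subset of a product of compact
  sets even when the vertex type is infinite.\<close>

lemma compactin_closed_simplex:
  assumes "finite \<sigma>"
  shows "compactin euclidean (closed_simplex \<sigma>)"
proof -
  let ?P = "Pi\<^sub>E UNIV (\<lambda>v. if v \<in> \<sigma> then {0..1::real} else {0})"
  have "compactin (powertop_real UNIV) ?P"
    unfolding compactin_PiE by (auto simp: compact_Icc)
  moreover have "closedin euclidean {t::'a \<Rightarrow> real. sum t \<sigma> = 1}"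
    unfolding closed_closedin[symmetric]
    by (intro closed_Collect_eq continuous_intros) auto
  ultimately have "compactin euclidean (?P \<inter> {t. sum t \<sigma> = 1})"
    unfolding euclidean_product_topology by (metis closed_Int_compactin Int_commute)
  moreover have "closed_simplex \<sigma> = ?P \<inter> {t. sum t \<sigma> = 1}"
  proof (intro set_eqI iffI)
    fix t assume t: "t \<in> closed_simplex \<sigma>"
    have "t v \<le> 1" if "v \<in> \<sigma>" for v
      using member_le_sum[of v \<sigma> t] t that assms by (auto simp: closed_simplex_def)
    then show "t \<in> ?P \<inter> {t. sum t \<sigma> = 1}"
      using t by (auto simp: closed_simplex_def PiE_iff)
  next
    fix t assume t: "t \<in> ?P \<inter> {t. sum t \<sigma> = 1}"
    then have *: "t v \<in> (if v \<in> \<sigma> then {0..1::real} else {0})" for v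
      by (auto simp: PiE_iff)
    have "0 \<le> t v" for v using *[of v] by (auto split: if_splits)
    moreover have "t v = 0" if "v \<notin> \<sigma>" for v using *[of v] that by auto
    ultimately show "t \<in> closed_simplex \<sigma>"
      using t by (auto simp: closed_simplex_def)
  qed
  ultimately show ?thesis by simp
qed

lemma compactin_underlying:
  assumes "simplicial K"
  shows "compactin euclidean (underlying K)"
  unfolding underlying_def
  using assms compactin_closed_simplex by (intro compactin_Union) (auto simp: simplicial_def)

text \<open>The part of the complex outside a weakly open set is a finite union of compact sets,
  hence closed in the Hausdorff space of functions. From here on realizations of finite complexes
  are handled as subsets of this space.\<close>

lemma realization_eq:
  assumes K: "simplicial K"
  shows "realization K = top_of_set (underlying K)"
proof (rule topology_eq[THEN iffD2], intro allI iffI)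
  fix U
  assume "openin (top_of_set (underlying K)) U"
  then obtain T where T: "open T" "U = underlying K \<inter> T"
    by (auto simp: openin_open)
  have "U \<inter> closed_simplex \<sigma> = closed_simplex \<sigma> \<inter> T" if "\<sigma> \<in> K" for \<sigma>
    using T(2) that by (auto simp: underlying_def)
  then show "openin (realization K) U"
    using T by (auto simp: openin_realization underlying_def euclidean_product_topology openin_open)
next
  fix U
  assume U: "openin (realization K) U"
  have cl: "closedin euclidean (closed_simplex \<sigma> - U)" if "\<sigma> \<in> K" for \<sigma>
  proof -
    have "openin (top_of_set (closed_simplex \<sigma>)) (U \<inter> closed_simplex \<sigma>)"
      using U that by (simp add: openin_realization euclidean_product_topology)
    then obtain T where T: "open T" "U \<inter> closed_simplex \<sigma> = closed_simplex \<sigma> \<inter> T"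
      by (auto simp: openin_open)
    then have eq: "closed_simplex \<sigma> - U = closed_simplex \<sigma> \<inter> - T" by blast
    have "closedin euclidean (closed_simplex \<sigma>)"
      using compactin_imp_closedin[OF Hausdorff_space_fun compactin_closed_simplex]
        simplicialD(1)[OF K that] by blast
    moreover have "closedin euclidean (- T)"
      using closed_Compl[OF T(1)] unfolding closed_closedin .
    ultimately show ?thesis unfolding eq by (rule closedin_Int)
  qed
  have "closedin euclidean (\<Union>\<sigma>\<in>K. closed_simplex \<sigma> - U)"
    using K cl by (intro closedin_Union) (auto simp: simplicial_def)
  then have "open (- (\<Union>\<sigma>\<in>K. closed_simplex \<sigma> - U))"
    unfolding closed_closedin[symmetric] by (rule open_Compl)
  moreover have "U = underlying K \<inter> - (\<Union>\<sigma>\<in>K. closed_simplex \<sigma> - U)"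
    using U by (auto simp: openin_realization underlying_def)
  ultimately show "openin (top_of_set (underlying K)) U"
    by (auto simp: openin_open)
qed

lemma continuous_on_coordinate: "continuous_on S (\<lambda>t. (t :: 'a \<Rightarrow> real) x)"
  by (rule continuous_on_subset[OF continuous_on_product_coordinates subset_UNIV])

text \<open>The weights \<open>c\<close> serve two uses: constant 1 for the smallest coordinate, and
  \<open>inverse (p x)\<close> for the largest multiple of a point \<open>p\<close> that can be
  subtracted.\<close>

lemma continuous_on_Min_coordinates:
  fixes \<sigma> :: "'a set" and c :: "'a \<Rightarrow> real"
  assumes "finite \<sigma>" "\<sigma> \<noteq> {}"
  shows "continuous_on S (\<lambda>t::'a \<Rightarrow> real. Min ((\<lambda>x. c x * t x) ` \<sigma>))"
  using assms
proof (induction \<sigma> rule: finite_ne_induct)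
  case (singleton x)
  then show ?case
    by (auto intro!: continuous_intros continuous_on_coordinate)
next
  case (insert x F)
  then have "(\<lambda>t. Min ((\<lambda>x. c x * t x) ` insert x F)) = (\<lambda>t. min (c x * t x) (Min ((\<lambda>x. c x * t x) ` F)))"
    by (auto simp: fun_eq_iff)
  then show ?case
    using insert
    by (auto intro!: continuous_on_min continuous_intros continuous_on_coordinate)
qed

section \<open>Generalized collapses\<close>

text \<open>The link of \<open>\<sigma>\<close> is a cone with apex \<open>v\<close>. The condition
  is vacuous if no simplex of \<open>K\<close> contains \<open>\<sigma>\<close>; a collapse at such
  a face removes nothing.\<close>

definition free_face :: "'a set set \<Rightarrow> 'a set \<Rightarrow> 'a \<Rightarrow> bool" where
  "free_face K \<sigma> v \<longleftrightarrow> finite \<sigma> \<and> v \<notin> \<sigma> \<and> (\<forall>\<tau>\<in>K. \<sigma> \<subseteq> \<tau> \<longrightarrow> insert v \<tau> \<in> K)"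

text \<open>The deformation subtracts from every barycentric coordinate in \<open>\<sigma>\<close> the smallest one of them
  and moves the total weight to the apex \<open>v\<close>; it is the identity off the star of \<open>\<sigma>\<close>.\<close>

lemma free_face_homotopy_equivalent:
  assumes K: "simplicial K" and ff: "free_face K \<sigma> v" and ne: "\<sigma> \<noteq> {}"
  shows "realization K homotopy_equivalent_space realization {\<tau>\<in>K. \<not> \<sigma> \<subseteq> \<tau>}"
proof -
  let ?L = "{\<tau>\<in>K. \<not> \<sigma> \<subseteq> \<tau>}"
  have fin: "finite \<sigma>" and v: "v \<notin> \<sigma>" and apex: "\<And>\<tau>. \<tau> \<in> K \<Longrightarrow> \<sigma> \<subseteq> \<tau> \<Longrightarrow> insert v \<tau> \<in> K"
    using ff by (auto simp: free_face_def)
  have L: "simplicial ?L"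
    using K by (rule simplicial_deletion)
  define \<mu> where "\<mu> t = Min (t ` \<sigma>)" for t :: "'a \<Rightarrow> real"
  \<comment> \<open>The entries of \<open>c\<close> sum to 0 over \<open>insert v \<sigma>\<close>,
    so \<open>r s\<close> preserves the total weight for every \<open>s\<close>.\<close>
  define c where "c x = (if x = v then real (card \<sigma>) else if x \<in> \<sigma> then -1 else 0)" for x
  define r where "r s t = (\<lambda>x. t x + s * \<mu> t * c x)" for s :: real and t :: "'a \<Rightarrow> real"
  have \<mu>0: "\<mu> t = 0" if "t \<in> closed_simplex \<tau>" "\<not> \<sigma> \<subseteq> \<tau>" for t \<tau>
  proof -
    obtain x where "x \<in> \<sigma>" "t x = 0" and nn: "\<forall>x. 0 \<le> t x"
      using \<open>t \<in> closed_simplex \<tau>\<close> \<open>\<not> \<sigma> \<subseteq> \<tau>\<close> unfolding closed_simplex_def by fastforce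
    then show ?thesis
      unfolding \<mu>_def using fin by (intro Min_eqI) force+
  qed
  have r_id: "r s t = t" if "t \<in> closed_simplex \<tau>" "\<not> \<sigma> \<subseteq> \<tau>" for s t \<tau>
    using \<mu>0[OF that] by (simp add: r_def)
  have r_star: "r s t \<in> closed_simplex (insert v \<tau>)"
    if t: "t \<in> closed_simplex \<tau>" and \<tau>: "\<tau> \<in> K" "\<sigma> \<subseteq> \<tau>" and s: "0 \<le> s" "s \<le> 1" for s t \<tau>
  proof -
    have nn: "0 \<le> t x" for x using t by (simp add: closed_simplex_def)
    have \<mu>le: "\<mu> t \<le> t x" if "x \<in> \<sigma>" for x
      unfolding \<mu>_def using fin that by simp
    have \<mu>nn: "0 \<le> \<mu> t"
      unfolding \<mu>_def using fin ne nn by simp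
    have "0 \<le> r s t x" for x
    proof -
      have "s * \<mu> t \<le> 1 * t x" if "x \<in> \<sigma>"
        using s \<mu>nn \<mu>le[OF that] by (intro mult_mono) auto
      then show ?thesis
        using nn[of x] \<mu>nn s by (auto simp: r_def c_def)
    qed
    moreover have "r s t x = 0" if "x \<notin> insert v \<tau>" for x
      using that t \<tau> by (auto simp: r_def c_def closed_simplex_def)
    moreover have "(\<Sum>x\<in>insert v \<tau>. r s t x) = 1"
    proof -
      have fi: "finite (insert v \<tau>)" using K \<tau> by (auto simp: simplicial_def)
      have "sum t (insert v \<tau>) = sum t \<tau>"
        using fi t by (intro sum.mono_neutral_right) (auto simp: closed_simplex_def)
      moreover have "sum c (insert v \<tau>) = 0"
      proof -
        have "sum c (insert v \<tau>) = sum c (insert v \<sigma>)"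
          using fi \<tau> by (intro sum.mono_neutral_right) (auto simp: c_def)
        also have "\<dots> = c v + sum c \<sigma>" using fin v by simp
        also have "sum c \<sigma> = (\<Sum>x\<in>\<sigma>. -1)"
          using v by (intro sum.cong) (auto simp: c_def)
        finally show ?thesis by (simp add: c_def)
      qed
      ultimately show ?thesis
        using t by (simp add: r_def sum.distrib closed_simplex_def flip: sum_distrib_left)
    qed
    ultimately show ?thesis by (simp add: closed_simplex_def)
  qed
  have in_K: "r s t \<in> underlying K" if "t \<in> underlying K" "0 \<le> s" "s \<le> 1" for s t
  proof -
    from that(1) obtain \<tau> where \<tau>: "\<tau> \<in> K" "t \<in> closed_simplex \<tau>" unfolding underlying_def by blast
    show ?thesis
    proof (cases "\<sigma> \<subseteq> \<tau>")
      case True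
      then show ?thesis using \<tau> apex r_star that by (blast intro: underlyingI)
    next
      case False
      then show ?thesis using \<tau> r_id by (metis underlyingI)
    qed
  qed
  have in_L: "r 1 t \<in> underlying ?L" if "t \<in> underlying K" for t
  proof -
    from that obtain \<tau> where \<tau>: "\<tau> \<in> K" "t \<in> closed_simplex \<tau>" unfolding underlying_def by blast
    show ?thesis
    proof (cases "\<sigma> \<subseteq> \<tau>")
      case True
      \<comment> \<open>At time 1 a vertex of \<open>\<sigma>\<close> that attains the minimum has
        lost all its weight, so the image lies in a face of \<open>insert v \<tau>\<close> that no
        longer contains \<open>\<sigma>\<close>.\<close>
      have "\<mu> t \<in> t ` \<sigma>" unfolding \<mu>_def using fin ne by (intro Min_in) auto
      then obtain x where x: "x \<in> \<sigma>" "t x = \<mu> t" by auto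
      then have "r 1 t x = 0" using v by (auto simp: r_def c_def)
      moreover have rs: "r 1 t \<in> closed_simplex (insert v \<tau>)"
        using True \<tau> r_star by simp
      moreover have "finite \<tau>" "x \<noteq> v" using K \<tau> x v by (auto simp: simplicial_def)
      ultimately have "r 1 t \<in> closed_simplex (insert v \<tau> - {x})"
        by (auto simp: closed_simplex_def sum_diff1)
      moreover have "insert v \<tau> - {x} \<in> ?L"
        using simplicialD(3)[OF K apex[OF \<tau>(1) True], of "insert v \<tau> - {x}"] \<open>x \<noteq> v\<close> x by auto
      ultimately show ?thesis by (blast intro: underlyingI)
    next
      case False
      then show ?thesis using \<tau> r_id[OF \<tau>(2) False, of 1] by (auto intro: underlyingI)
    qed
  qed
  have sub: "underlying ?L \<subseteq> underlying K" by (auto simp: underlying_def)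
  have cmu: "continuous_on S \<mu>" for S
    using continuous_on_Min_coordinates[OF fin ne, of S "\<lambda>_. 1"] by (simp add: \<mu>_def[abs_def])
  have cr: "continuous_on S (\<lambda>z. r (fst z) (snd z))" for S
    unfolding r_def
    by (intro continuous_intros continuous_on_coordinatewise_then_product
          continuous_on_compose2[OF cmu[of UNIV]]
          continuous_on_product_then_coordinatewise[of S "snd"]) auto
  have "homotopic_with_canon (\<lambda>x. True) (underlying K) (underlying K) id (r 1)"
    unfolding homotopic_with_def
  proof (intro exI conjI allI ballI)
    show "continuous_map (prod_topology (top_of_set {0..1}) (top_of_set (underlying K)))
        (top_of_set (underlying K)) (\<lambda>z. r (fst z) (snd z))"
      using cr in_K by (auto simp: continuous_map_in_subtopology)
  qed (auto simp: r_def)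
  then have "homotopic_with_canon (\<lambda>x. True) (underlying K) (underlying K) (r 1) id"
    by (rule homotopic_with_symD)
  moreover have "retraction_maps (top_of_set (underlying K)) (top_of_set (underlying ?L)) (r 1) id"
    unfolding retraction_maps_def
  proof (intro conjI ballI)
    have "continuous_on (underlying K) (r 1)"
      unfolding r_def
      by (intro continuous_on_coordinatewise_then_product continuous_intros continuous_on_coordinate cmu)
    then show "continuous_map (top_of_set (underlying K)) (top_of_set (underlying ?L)) (r 1)"
      using in_L by auto
    show "continuous_map (top_of_set (underlying ?L)) (top_of_set (underlying K)) id"
      using sub by auto
    show "r 1 (id x) = x" if "x \<in> topspace (top_of_set (underlying ?L))" for x
      using that r_id by (auto simp: underlying_def)
  qed
  ultimately show ?thesis
    unfolding realization_eq[OF K] realization_eq[OF L]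
    by (rule deformation_retract_imp_homotopy_equivalent_space)
qed

text \<open>The predicate \<open>P\<close> records which faces \<open>\<sigma>\<close> may be removed, together with their open stars.\<close>

inductive collapse :: "('a set \<Rightarrow> bool) \<Rightarrow> 'a set set \<Rightarrow> 'a set set \<Rightarrow> bool" for P where
  none: "collapse P K K"
| step: "P \<sigma> \<Longrightarrow> free_face K \<sigma> v \<Longrightarrow> collapse P {\<tau>\<in>K. \<not> \<sigma> \<subseteq> \<tau>} L \<Longrightarrow> collapse P K L"

lemma collapse_trans: "collapse P K L \<Longrightarrow> collapse P L M \<Longrightarrow> collapse P K M"
  by (induction rule: collapse.induct) (auto intro: collapse.step)

lemma collapse_homotopy_equivalent:
  assumes "collapse P K L" "simplicial K" "\<not> P {}"
  shows "realization K homotopy_equivalent_space realization L"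
  using assms
proof (induction rule: collapse.induct)
  case (step \<sigma> K v L)
  have "realization K homotopy_equivalent_space realization {\<tau>\<in>K. \<not> \<sigma> \<subseteq> \<tau>}"
    using step by (intro free_face_homotopy_equivalent) auto
  moreover have "realization {\<tau>\<in>K. \<not> \<sigma> \<subseteq> \<tau>} homotopy_equivalent_space realization L"
    using step simplicial_deletion by blast
  ultimately show ?case by (rule homotopy_eqv_trans)
qed (rule homotopy_equivalent_space_refl)

text \<open>Deleting the star of one member of \<open>F\<close> could destroy the cone structure
  around another. Since adding the apex \<open>v\<close> completes no further member of
  \<open>F\<close>, the simplex \<open>insert v \<tau>\<close> survives whenever
  \<open>\<tau>\<close> does, and the members can be deleted in any order.\<close>

lemma collapse_family:
  assumes "finite F"
    and "\<And>\<sigma>. \<sigma> \<in> F \<Longrightarrow> P \<sigma> \<and> finite \<sigma> \<and> (\<exists>v. v \<notin> \<sigma> \<and> (\<forall>\<tau>\<in>K. \<sigma> \<subseteq> \<tau> \<longrightarrow> insert v \<tau> \<in> K \<and>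
           (\<forall>\<sigma>'\<in>F. \<sigma>' \<subseteq> insert v \<tau> \<longrightarrow> \<sigma>' \<subseteq> \<tau>)))"
  shows "collapse P K {\<tau>\<in>K. \<forall>\<sigma>\<in>F. \<not> \<sigma> \<subseteq> \<tau>}"
proof -
  have "collapse P K {\<tau>\<in>K. \<forall>\<sigma>\<in>G. \<not> \<sigma> \<subseteq> \<tau>}" if "G \<subseteq> F" for G
    using finite_subset[OF that \<open>finite F\<close>] that
  proof (induction G rule: finite_induct)
    case empty
    then show ?case by (simp add: collapse.none)
  next
    case (insert \<sigma> G)
    let ?K = "{\<tau>\<in>K. \<forall>\<sigma>\<in>G. \<not> \<sigma> \<subseteq> \<tau>}"
    obtain v where "P \<sigma>" "finite \<sigma>" "v \<notin> \<sigma>" and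
      v: "\<And>\<tau>. \<tau> \<in> K \<Longrightarrow> \<sigma> \<subseteq> \<tau> \<Longrightarrow> insert v \<tau> \<in> K \<and> (\<forall>\<sigma>'\<in>F. \<sigma>' \<subseteq> insert v \<tau> \<longrightarrow> \<sigma>' \<subseteq> \<tau>)"
      using assms(2)[of \<sigma>] insert.prems by auto
    have "free_face ?K \<sigma> v"
      unfolding free_face_def
      using \<open>finite \<sigma>\<close> \<open>v \<notin> \<sigma>\<close> v insert.prems by blast
    then have "collapse P ?K {\<tau>\<in>?K. \<not> \<sigma> \<subseteq> \<tau>}"
      using collapse.step[of P \<sigma> ?K v "{\<tau>\<in>?K. \<not> \<sigma> \<subseteq> \<tau>}"] collapse.none[of P] \<open>P \<sigma>\<close> by blast
    moreover have "{\<tau>\<in>?K. \<not> \<sigma> \<subseteq> \<tau>} = {\<tau>\<in>K. \<forall>\<sigma>\<in>insert \<sigma> G. \<not> \<sigma> \<subseteq> \<tau>}"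
      by auto
    moreover have "collapse P K ?K" using insert by blast
    ultimately show ?case
      using collapse_trans[of P K ?K] by simp
  qed
  then show ?thesis by blast
qed

text \<open>No simplex of \<open>R\<close> contains a face that may be removed, so the stars of
  these faces are the same in \<open>K \<union> R\<close> as in \<open>K\<close>.\<close>

lemma collapse_Un:
  assumes "collapse P K L" and "\<And>\<sigma> \<tau>. P \<sigma> \<Longrightarrow> \<tau> \<in> R \<Longrightarrow> \<not> \<sigma> \<subseteq> \<tau>"
  shows "collapse P (K \<union> R) (L \<union> R)"
  using assms
proof (induction rule: collapse.induct)
  case (step \<sigma> K v L)
  have "free_face (K \<union> R) \<sigma> v"
    using step unfolding free_face_def by blast
  moreover have "{\<tau>\<in>K \<union> R. \<not> \<sigma> \<subseteq> \<tau>} = {\<tau>\<in>K. \<not> \<sigma> \<subseteq> \<tau>} \<union> R"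
    using step by blast
  moreover have "collapse P ({\<tau>\<in>K. \<not> \<sigma> \<subseteq> \<tau>} \<union> R) (L \<union> R)"
    using step by blast
  ultimately show ?case
    using step.hyps(1) collapse.step[of P \<sigma> "K \<union> R" v "L \<union> R"] by simp
qed (rule collapse.none)

section \<open>Collapsible complexes and cones over them\<close>

inductive collapsible :: "'a set set \<Rightarrow> bool" where
  cone: "{v} \<in> B \<Longrightarrow> (\<And>\<tau>. \<tau> \<in> B \<Longrightarrow> insert v \<tau> \<in> B) \<Longrightarrow> collapsible B"
| face: "\<sigma> \<noteq> {} \<Longrightarrow> free_face B \<sigma> v \<Longrightarrow> collapsible {\<tau>\<in>B. \<not> \<sigma> \<subseteq> \<tau>} \<Longrightarrow> collapsible B"

text \<open>Only the simplices through \<open>c\<close>; the base \<open>B\<close> is supplied by a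
  union with a complex containing it.\<close>

definition cone_over :: "'a \<Rightarrow> 'a set set \<Rightarrow> 'a set set" where
  "cone_over c B = insert {c} (insert c ` B)"

text \<open>The link of \<open>insert c \<sigma>\<close> in the union is the link of
  \<open>\<sigma>\<close> in \<open>B\<close>, so each \<open>face\<close> step of \<open>B\<close>
  is mirrored by a collapse at \<open>insert c \<sigma>\<close> with the same apex. When
  \<open>B\<close> has shrunk to a cone with apex \<open>v\<close>, this \<open>v\<close> is also an
  apex for \<open>{c}\<close>. For this reason the base case of \<open>collapsible\<close> is an
  arbitrary cone.\<close>

lemma collapse_cone:
  assumes "collapsible B" "B \<subseteq> K" "c \<notin> \<Union>K"
  shows "collapse (\<lambda>\<sigma>. c \<in> \<sigma>) (K \<union> cone_over c B) K"
  using assms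
proof (induction rule: collapsible.induct)
  case (cone v B)
  have c: "c \<notin> \<tau>" if "\<tau> \<in> K" for \<tau> using cone that by blast
  have "insert v \<tau> \<in> K \<union> cone_over c B" if "\<tau> \<in> K \<union> cone_over c B" "{c} \<subseteq> \<tau>" for \<tau>
  proof -
    have "\<tau> = {c} \<or> (\<exists>\<rho>\<in>B. \<tau> = insert c \<rho>)" using that c by (auto simp: cone_over_def)
    then show ?thesis
      using cone by (auto simp: cone_over_def insert_commute[of v c])
  qed
  then have "free_face (K \<union> cone_over c B) {c} v"
    using cone c[of "{v}"] unfolding free_face_def by auto
  moreover have "{\<tau>\<in>K \<union> cone_over c B. \<not> {c} \<subseteq> \<tau>} = K"
    using c by (auto simp: cone_over_def)
  ultimately show ?case
    using collapse.step[of "\<lambda>\<sigma>. c \<in> \<sigma>" "{c}" "K \<union> cone_over c B" v K] collapse.none[of _ K] by simp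
next
  case (face \<sigma> B v)
  have c: "c \<notin> \<tau>" if "\<tau> \<in> K" for \<tau> using face.prems that by blast
  have fin: "finite \<sigma>" "v \<notin> \<sigma>" and v: "\<And>\<tau>. \<tau> \<in> B \<Longrightarrow> \<sigma> \<subseteq> \<tau> \<Longrightarrow> insert v \<tau> \<in> B"
    using face.hyps by (auto simp: free_face_def)
  let ?B = "{\<tau>\<in>B. \<not> \<sigma> \<subseteq> \<tau>}"
  have IH: "collapse (\<lambda>\<sigma>. c \<in> \<sigma>) (K \<union> cone_over c ?B) K"
    using face by blast
  show ?case
  \<comment> \<open>Vacuous steps are separated because \<open>c \<notin> \<sigma>\<close> and
    \<open>c \<noteq> v\<close> can only be read off from a simplex of \<open>B\<close> containing
    \<open>\<sigma>\<close>.\<close>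
  proof (cases "\<exists>\<tau>\<in>B. \<sigma> \<subseteq> \<tau>")
    case False
    then have "?B = B" by blast
    then show ?thesis using IH by simp
  next
    case True
    then obtain \<tau> where \<tau>: "\<tau> \<in> B" "\<sigma> \<subseteq> \<tau>" by blast
    then have "insert v \<tau> \<in> K" using v[of \<tau>] face.prems(1) by blast
    then have "c \<notin> insert v \<tau>" by (rule c)
    then have c\<sigma>: "c \<notin> \<sigma>" and cv: "c \<noteq> v"
      using \<tau> by auto
    have star: "\<exists>\<rho>\<in>B. \<tau> = insert c \<rho> \<and> \<sigma> \<subseteq> \<rho>"
      if "\<tau> \<in> K \<union> cone_over c B" "insert c \<sigma> \<subseteq> \<tau>" for \<tau>
    proof -
      have "\<tau> \<notin> K" using c that by auto
      then have "\<tau> = {c} \<or> (\<exists>\<rho>\<in>B. \<tau> = insert c \<rho>)" using that by (auto simp: cone_over_def)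
      then show ?thesis using that c\<sigma> \<open>\<sigma> \<noteq> {}\<close> by blast
    qed
    have "insert v \<tau> \<in> cone_over c B" if "\<tau> \<in> K \<union> cone_over c B" "insert c \<sigma> \<subseteq> \<tau>" for \<tau>
      using star[OF that] v by (auto simp: cone_over_def insert_commute[of v c])
    then have "free_face (K \<union> cone_over c B) (insert c \<sigma>) v"
      using fin cv unfolding free_face_def by auto
    moreover have "{\<tau>\<in>K \<union> cone_over c B. \<not> insert c \<sigma> \<subseteq> \<tau>} = K \<union> cone_over c ?B"
    proof -
      have "\<not> insert c \<sigma> \<subseteq> \<tau>" if "\<tau> \<in> K" for \<tau> using c that by auto
      moreover have "insert c \<sigma> \<subseteq> insert c \<rho> \<longleftrightarrow> \<sigma> \<subseteq> \<rho>" for \<rho> using c\<sigma> by auto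
      moreover have "\<not> insert c \<sigma> \<subseteq> {c}" using c\<sigma> \<open>\<sigma> \<noteq> {}\<close> by auto
      ultimately show ?thesis unfolding cone_over_def by blast
    qed
    ultimately show ?thesis
      using IH collapse.step[of "\<lambda>\<sigma>. c \<in> \<sigma>" "insert c \<sigma>" "K \<union> cone_over c B" v K] by simp
  qed
qed

lemma simplicial_cone_over:
  assumes "simplicial K" "simplicial B" "B \<subseteq> K"
  shows "simplicial (K \<union> cone_over c B)"
  unfolding simplicial_def
proof (intro conjI ballI allI impI)
  show "finite (K \<union> cone_over c B)"
    using assms(1,2) by (simp add: simplicial_def cone_over_def)
  fix \<tau> assume \<tau>: "\<tau> \<in> K \<union> cone_over c B"
  then consider "\<tau> \<in> K" | "\<tau> = {c}" | \<tau>' where "\<tau>' \<in> B" "\<tau> = insert c \<tau>'"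
    by (auto simp: cone_over_def)
  then show "finite \<tau>" "\<tau> \<noteq> {}"
    using simplicialD(1,2)[OF assms(1)] simplicialD(1,2)[OF assms(2)] by (cases; simp)+
  fix \<rho> assume \<rho>: "\<rho> \<subseteq> \<tau> \<and> \<rho> \<noteq> {}"
  consider "\<tau> \<in> K" | "\<tau> = {c}" | \<tau>' where "\<tau>' \<in> B" "\<tau> = insert c \<tau>'"
    using \<tau> by (auto simp: cone_over_def)
  then show "\<rho> \<in> K \<union> cone_over c B"
  proof cases
    case 1
    then show ?thesis using simplicialD(3)[OF assms(1)] \<rho> by blast
  next
    case 2
    then have "\<rho> = {c}" using \<rho> by auto
    then show ?thesis by (simp add: cone_over_def)
  next
    case 3
    have *: "\<rho> - {c} = {} \<or> \<rho> - {c} \<in> B"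
      using simplicialD(3)[OF assms(2) 3(1), of "\<rho> - {c}"] 3 \<rho> by blast
    show ?thesis
    proof (cases "c \<in> \<rho>")
      case False
      then show ?thesis using * assms(3) \<rho> by auto
    next
      case True
      then have "\<rho> = insert c (\<rho> - {c})" by blast
      then show ?thesis using * by (metis (no_types, lifting) UnCI cone_over_def image_eqI insertCI)
    qed
  qed
qed

text \<open>This is the boundary of a cross-polytope without its facet \<open>P\<close>. By
  induction on \<open>Q\<close>, consider the simplices not containing \<open>Q\<close>. Those that
  contain \<open>Q\<close> but not \<open>insert p Q\<close> avoid \<open>p\<close>, so
  \<open>\<alpha> p\<close> is an apex for \<open>Q\<close>, and deleting the star of
  \<open>Q\<close> leaves the complex for \<open>Q\<close>. For \<open>Q = {p}\<close> everything
  avoids \<open>p\<close> and the complex is a cone with apex \<open>\<alpha> p\<close>.\<close>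

lemma collapsible_octahedron:
  fixes P :: "'a set" and \<alpha> :: "'a \<Rightarrow> 'a"
  assumes P: "finite P" "P \<noteq> {}" and \<alpha>: "\<alpha> ` P \<inter> P = {}"
    and inj: "inj_on \<alpha> P"
  shows "collapsible {\<tau>. \<tau> \<noteq> {} \<and> \<tau> \<subseteq> P \<union> \<alpha> ` P \<and> (\<forall>p\<in>P. p \<notin> \<tau> \<or> \<alpha> p \<notin> \<tau>) \<and> \<not> P \<subseteq> \<tau>}"
proof -
  let ?B = "\<lambda>Q. {\<tau>. \<tau> \<noteq> {} \<and> \<tau> \<subseteq> P \<union> \<alpha> ` P \<and> (\<forall>p\<in>P. p \<notin> \<tau> \<or> \<alpha> p \<notin> \<tau>) \<and> \<not> Q \<subseteq> \<tau>}"
  have "collapsible (?B Q)" if "Q \<noteq> {}" "Q \<subseteq> P" "finite Q" for Q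
    using that(3,1,2)
  proof (induction Q rule: finite_ne_induct)
    case (singleton p)
    show ?case
    proof (rule collapsible.cone)
      show "{\<alpha> p} \<in> ?B {p}" using singleton \<alpha> by auto
      show "insert (\<alpha> p) \<tau> \<in> ?B {p}" if "\<tau> \<in> ?B {p}" for \<tau>
        using that singleton \<alpha> inj by (auto dest: inj_onD)
    qed
  next
    case (insert p Q)
    show ?case
    proof (rule collapsible.face)
      show "Q \<noteq> {}" by fact
      have ins: "insert (\<alpha> p) \<tau> \<in> ?B (insert p Q)" if "\<tau> \<in> ?B (insert p Q)" "Q \<subseteq> \<tau>" for \<tau>
        using that insert.prems \<alpha> inj by (auto dest: inj_onD)
      have "\<alpha> p \<notin> Q" using insert.prems \<alpha> by auto
      then show "free_face (?B (insert p Q)) Q (\<alpha> p)"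
        unfolding free_face_def using insert.hyps(1) ins by (intro conjI ballI impI)
      have "{\<tau> \<in> ?B (insert p Q). \<not> Q \<subseteq> \<tau>} = ?B Q" by blast
      then show "collapsible {\<tau> \<in> ?B (insert p Q). \<not> Q \<subseteq> \<tau>}" using insert by simp
    qed
  qed
  then show ?thesis using P by blast
qed

section \<open>Attaching a simplex along a null-homotopic boundary\<close>

text \<open>For \<open>v \<notin> \<Delta>\<close> a sphere of dimension
  \<open>card \<Delta> - 1\<close>, the boundary of the simplex on \<open>insert v \<Delta>\<close>.
  A simplex with \<open>card \<Delta>\<close> vertices has that dimension too, which is why both
  have the same cardinality in the exchange.\<close>

definition sphere_at :: "'a \<Rightarrow> 'a set \<Rightarrow> 'a set set" where
  "sphere_at v \<Delta> = {\<tau>. \<tau> \<noteq> {} \<and> \<tau> \<subset> insert v \<Delta>}"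

lemma simplicial_sphere_at: "finite \<Delta> \<Longrightarrow> simplicial (sphere_at v \<Delta>)"
  unfolding simplicial_def sphere_at_def
  by (intro conjI ballI allI impI)
     (auto intro: finite_subset[of _ "Pow (insert v \<Delta>)"] finite_subset[of _ "insert v \<Delta>"])

lemma simplicial_insert:
  assumes "simplicial K" "finite \<sigma>" "\<sigma> \<noteq> {}" "\<And>\<rho>. \<rho> \<subset> \<sigma> \<Longrightarrow> \<rho> \<noteq> {} \<Longrightarrow> \<rho> \<in> K"
  shows "simplicial (insert \<sigma> K)"
  unfolding simplicial_def
proof (intro conjI ballI allI impI)
  show "finite (insert \<sigma> K)" using assms by (simp add: simplicial_def)
  fix \<tau> assume "\<tau> \<in> insert \<sigma> K"
  then show "finite \<tau>" "\<tau> \<noteq> {}" using simplicialD(1,2)[OF assms(1)] assms(2,3) by auto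
  fix \<rho> assume "\<rho> \<subseteq> \<tau> \<and> \<rho> \<noteq> {}"
  with \<open>\<tau> \<in> insert \<sigma> K\<close> show "\<rho> \<in> insert \<sigma> K"
    using simplicialD(3)[OF assms(1), of \<tau> \<rho>] assms(4)[of \<rho>] by auto
qed

lemma collapse_nonempty_homotopy_equivalent:
  assumes "collapse (\<lambda>\<sigma>. \<sigma> \<noteq> {}) K L" "simplicial K"
  shows "realization K homotopy_equivalent_space realization L"
  using collapse_homotopy_equivalent[OF assms] by simp

text \<open>Both sides are collapses of the complex in which the base point is fattened to the edge
  from \<open>u\<close> to \<open>v\<close>.\<close>

lemma sphere_move_half:
  assumes Y: "simplicial Y" and uv: "{u,v} \<in> Y" "u \<noteq> v"
    and \<Delta>: "finite \<Delta>" "\<Delta> \<noteq> {}" "\<Delta> \<inter> \<Union>Y = {}"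
  shows "realization (Y \<union> {\<tau>. \<tau> \<noteq> {} \<and> \<tau> \<subseteq> {u,v} \<union> \<Delta> \<and> (\<Delta> \<subseteq> \<tau> \<longrightarrow> \<tau> = \<Delta>)})
    homotopy_equivalent_space realization (Y \<union> sphere_at u \<Delta>)"
proof -
  \<comment> \<open>The join of the edge \<open>{u,v}\<close> with the boundary of
    \<open>\<Delta>\<close>, plus the face \<open>\<Delta>\<close>. Collapsing the edges in
    \<open>?F\<close> with apex \<open>u\<close> frees \<open>\<Delta>\<close> from
    \<open>v\<close>; the construction is symmetric in \<open>u\<close> and
    \<open>v\<close>.\<close>
  let ?S = "{\<tau>. \<tau> \<noteq> {} \<and> \<tau> \<subseteq> {u,v} \<union> \<Delta> \<and> (\<Delta> \<subseteq> \<tau> \<longrightarrow> \<tau> = \<Delta>)}"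
  let ?F = "(\<lambda>y. {v,y}) ` \<Delta>"
  have nuv: "u \<notin> \<Delta>" "v \<notin> \<Delta>" using uv \<Delta> by auto
  have nY: "\<tau> \<inter> \<Delta> = {}" if "\<tau> \<in> Y" for \<tau> using that \<Delta> by auto
  have "simplicial ?S"
    unfolding simplicial_def
  proof (intro conjI ballI allI impI)
    show "finite ?S" by (rule finite_subset[of _ "Pow ({u,v} \<union> \<Delta>)"]) (use \<Delta> in auto)
    show "finite \<tau>" if "\<tau> \<in> ?S" for \<tau> using that \<Delta>(1) finite_subset[of \<tau> "{u,v} \<union> \<Delta>"] by auto
  qed (use nuv in auto)
  then have sZ: "simplicial (Y \<union> ?S)" using Y simplicial_Un by blast
  have "collapse (\<lambda>\<sigma>. \<sigma> \<noteq> {}) (Y \<union> ?S) {\<tau>\<in>Y \<union> ?S. \<forall>\<sigma>\<in>?F. \<not> \<sigma> \<subseteq> \<tau>}"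
  proof (rule collapse_family)
    show "finite ?F" using \<Delta> by simp
    fix \<sigma> assume "\<sigma> \<in> ?F"
    then obtain y where y: "y \<in> \<Delta>" "\<sigma> = {v,y}" by auto
    have "insert u \<tau> \<in> Y \<union> ?S" if "\<tau> \<in> Y \<union> ?S" "\<sigma> \<subseteq> \<tau>" for \<tau>
    proof -
      have "\<tau> \<in> ?S" "v \<in> \<tau>" using that y nY by auto
      then have "\<not> \<Delta> \<subseteq> insert u \<tau>" using nuv by auto
      then show ?thesis using \<open>\<tau> \<in> ?S\<close> by auto
    qed
    moreover have "\<sigma>' \<subseteq> \<tau>" if "\<sigma>' \<in> ?F" "\<sigma>' \<subseteq> insert u \<tau>" for \<sigma>' \<tau>
      using that nuv uv by auto
    ultimately show "\<sigma> \<noteq> {} \<and> finite \<sigma> \<and> (\<exists>w. w \<notin> \<sigma> \<and> (\<forall>\<tau>\<in>Y \<union> ?S. \<sigma> \<subseteq> \<tau> \<longrightarrow> insert w \<tau> \<in> Y \<union> ?S \<and>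
           (\<forall>\<sigma>'\<in>?F. \<sigma>' \<subseteq> insert w \<tau> \<longrightarrow> \<sigma>' \<subseteq> \<tau>)))"
      using y nuv uv by (intro conjI exI[of _ u]) auto
  qed
  moreover have "{\<tau>\<in>Y \<union> ?S. \<forall>\<sigma>\<in>?F. \<not> \<sigma> \<subseteq> \<tau>} = Y \<union> sphere_at u \<Delta>" (is "?A = ?B")
  proof (intro set_eqI iffI)
    fix \<tau> assume \<tau>: "\<tau> \<in> ?A"
    show "\<tau> \<in> ?B"
    proof (cases "v \<in> \<tau>")
      case True
      then have "\<tau> \<inter> \<Delta> = {}" using \<tau> by auto
      then have "\<tau> \<in> Y \<or> \<tau> \<subseteq> {u,v} \<and> \<tau> \<noteq> {}" using \<tau> by auto
      then show ?thesis using simplicialD(3)[OF Y uv(1)] by auto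
    next
      case False
      then show ?thesis using \<tau> nuv by (auto simp: sphere_at_def)
    qed
  next
    fix \<tau> assume \<tau>: "\<tau> \<in> ?B"
    then show "\<tau> \<in> ?A"
    proof
      assume "\<tau> \<in> Y"
      then show ?thesis using nY[of \<tau>] by auto
    next
      assume "\<tau> \<in> sphere_at u \<Delta>"
      then show ?thesis using nuv uv by (auto simp: sphere_at_def)
    qed
  qed
  ultimately have "collapse (\<lambda>\<sigma>. \<sigma> \<noteq> {}) (Y \<union> ?S) (Y \<union> sphere_at u \<Delta>)" by (simp only:)
  then show ?thesis
    using sZ by (rule collapse_nonempty_homotopy_equivalent)
qed

lemma sphere_move:
  assumes Y: "simplicial Y" and uv: "{u,v} \<in> Y" "u \<noteq> v"
    and \<Delta>: "finite \<Delta>" "\<Delta> \<noteq> {}" "\<Delta> \<inter> \<Union>Y = {}"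
  shows "realization (Y \<union> sphere_at u \<Delta>) homotopy_equivalent_space realization (Y \<union> sphere_at v \<Delta>)"
proof -
  have "{v,u} \<in> Y" using uv by (simp add: insert_commute)
  from sphere_move_half[OF Y this _ \<Delta>] sphere_move_half[OF Y uv \<Delta>] uv(2)
  show ?thesis
    by (auto simp: insert_commute[of v u] intro: homotopy_eqv_trans homotopy_equivalent_space_sym[THEN iffD1])
qed

lemma sphere_move_path:
  assumes "(\<lambda>u v. {u,v} \<in> Y)\<^sup>*\<^sup>* u v" "simplicial Y" "finite \<Delta>" "\<Delta> \<noteq> {}" "\<Delta> \<inter> \<Union>Y = {}"
  shows "realization (Y \<union> sphere_at u \<Delta>) homotopy_equivalent_space realization (Y \<union> sphere_at v \<Delta>)"
  using assms(1)
proof (induction rule: rtranclp_induct)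
  case base
  then show ?case by (rule homotopy_equivalent_space_refl)
next
  case (step v w)
  \<comment> \<open>A step of the path may be constant, since \<open>{v,v}\<close> is just the
    vertex \<open>{v}\<close>.\<close>
  then show ?case
    using sphere_move[OF assms(2) step(2) _ assms(3-5)] homotopy_eqv_trans by (cases "v = w") blast+
qed

text \<open>The complex \<open>F\<close> below is the preimage of the boundary of the simplex on \<open>insert c \<sigma>\<close> under the
  identification of \<open>\<Delta>\<close> with \<open>\<sigma>\<close>. It collapses onto either copy of that boundary.\<close>

lemma sphere_detach:
  assumes Y: "simplicial Y" and cone: "\<And>\<rho>. \<rho> \<subset> \<sigma> \<Longrightarrow> insert c \<rho> \<in> Y"
    and \<sigma>: "\<sigma> \<notin> Y" "finite \<sigma>" "c \<notin> \<sigma>" "2 \<le> card \<sigma>"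
    and \<Delta>: "finite \<Delta>" "card \<Delta> = card \<sigma>" "\<Delta> \<inter> \<Union>Y = {}"
  shows "realization (insert \<sigma> Y) homotopy_equivalent_space realization (Y \<union> sphere_at c \<Delta>)"
proof -
  obtain g where g: "bij_betw g \<sigma> \<Delta>"
    using \<sigma> \<Delta> by (metis finite_same_card_bij)
  have ginj: "g x = g y \<longleftrightarrow> x = y" if "x \<in> \<sigma>" "y \<in> \<sigma>" for x y
    using g that by (auto simp: bij_betw_def dest: inj_onD)
  have g\<Delta>: "g x \<in> \<Delta>" if "x \<in> \<sigma>" for x using g that by (auto simp: bij_betw_def)
  have gsurj: "\<exists>x\<in>\<sigma>. y = g x" if "y \<in> \<Delta>" for y using g that by (auto simp: bij_betw_def)
  have \<sigma>ne: "\<sigma> \<noteq> {}" using \<sigma> by auto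
  have proper: "\<rho> \<in> Y" if "\<rho> \<subset> \<sigma>" "\<rho> \<noteq> {}" for \<rho>
    using simplicialD(3)[OF Y cone[OF that(1)]] that by blast
  have "{x} \<subset> \<sigma>" if "x \<in> \<sigma>" for x
    using \<sigma> that by (metis card.empty card.insert finite.emptyI empty_iff insert_subset nless_le not_numeral_le_zero
        numeral_le_one_iff One_nat_def empty_subsetI semiring_norm(69) psubsetI)
  then have "{x} \<in> Y" if "x \<in> \<sigma>" for x using proper that by blast
  then have \<sigma>Y: "\<sigma> \<subseteq> \<Union>Y" by blast
  have "{c} \<in> Y" using cone[of "{}"] \<sigma>ne by blast
  then have cY: "c \<in> \<Union>Y" by blast
  have disj: "\<sigma> \<inter> \<Delta> = {}" "c \<notin> \<Delta>" using \<sigma>Y cY \<Delta> by auto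
  have nY: "\<tau> \<inter> \<Delta> = {}" if "\<tau> \<in> Y" for \<tau> using that \<Delta> by auto
  \<comment> \<open>A simplex without \<open>c\<close> is mapped into the facet
    \<open>\<sigma>\<close>, so only simplices through \<open>c\<close> are restricted: their image
    has to miss some \<open>x \<in> \<sigma>\<close>.\<close>
  define F where "F = {\<tau>. \<tau> \<noteq> {} \<and> \<tau> \<subseteq> insert c (\<sigma> \<union> \<Delta>) \<and> (c \<in> \<tau> \<longrightarrow> (\<exists>x\<in>\<sigma>. x \<notin> \<tau> \<and> g x \<notin> \<tau>))}"
  let ?Z = "Y \<union> F"
  have "simplicial F"
    unfolding simplicial_def
  proof (intro conjI ballI allI impI)
    show "finite F"
      by (rule finite_subset[of _ "Pow (insert c (\<sigma> \<union> \<Delta>))"]) (use \<sigma> \<Delta> in \<open>auto simp: F_def\<close>)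
    show "finite \<tau>" if "\<tau> \<in> F" for \<tau>
      using that \<sigma> \<Delta> finite_subset[of \<tau> "insert c (\<sigma> \<union> \<Delta>)"] by (auto simp: F_def)
    show "\<rho> \<in> F" if "\<tau> \<in> F" "\<rho> \<subseteq> \<tau> \<and> \<rho> \<noteq> {}" for \<tau> \<rho>
      using that unfolding F_def by blast
  qed (auto simp: F_def)
  then have sZ: "simplicial ?Z" using Y simplicial_Un by blast
  \<comment> \<open>The vertices \<open>x\<close> and \<open>g x\<close> have the same image, so
    adding \<open>x\<close> next to \<open>g x\<close> never leaves \<open>F\<close>. Hence
    \<open>x\<close> is an apex for \<open>g x\<close>, and all of \<open>\<Delta>\<close> can be
    collapsed away.\<close>
  have "collapse (\<lambda>\<sigma>. \<sigma> \<noteq> {}) ?Z {\<tau>\<in>?Z. \<forall>\<rho>\<in>(\<lambda>y. {y}) ` \<Delta>. \<not> \<rho> \<subseteq> \<tau>}"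
  proof (rule collapse_family)
    show "finite ((\<lambda>y. {y}) ` \<Delta>)" using \<Delta> by simp
    fix \<rho> assume "\<rho> \<in> (\<lambda>y. {y}) ` \<Delta>"
    then obtain x where x: "x \<in> \<sigma>" "\<rho> = {g x}" using gsurj by blast
    have "insert x \<tau> \<in> ?Z" if "\<tau> \<in> ?Z" "\<rho> \<subseteq> \<tau>" for \<tau>
    proof -
      have "\<tau> \<in> F" using that nY g\<Delta> x by auto
      have "\<exists>z\<in>\<sigma>. z \<notin> insert x \<tau> \<and> g z \<notin> insert x \<tau>" if c: "c \<in> \<tau>"
      proof -
        obtain z where z: "z \<in> \<sigma>" "z \<notin> \<tau>" "g z \<notin> \<tau>" using \<open>\<tau> \<in> F\<close> c by (auto simp: F_def)
        moreover have "g z \<noteq> x" using g\<Delta>[OF z(1)] x(1) disj by blast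
        moreover have "z \<noteq> x" using z(3) \<open>\<rho> \<subseteq> \<tau>\<close> x(2) by blast
        ultimately show ?thesis by blast
      qed
      then have "insert x \<tau> \<in> F" using \<open>\<tau> \<in> F\<close> x(1) \<sigma>(3) by (auto simp: F_def)
      then show ?thesis ..
    qed
    moreover have "x \<notin> \<Delta>" "x \<noteq> g x" using x(1) disj g\<Delta>[OF x(1)] by (metis IntI emptyE)+
    ultimately show "\<rho> \<noteq> {} \<and> finite \<rho> \<and> (\<exists>w. w \<notin> \<rho> \<and> (\<forall>\<tau>\<in>?Z. \<rho> \<subseteq> \<tau> \<longrightarrow> insert w \<tau> \<in> ?Z \<and>
           (\<forall>\<sigma>'\<in>(\<lambda>y. {y}) ` \<Delta>. \<sigma>' \<subseteq> insert w \<tau> \<longrightarrow> \<sigma>' \<subseteq> \<tau>)))"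
      using x by (intro conjI exI[of _ x]) auto
  qed
  moreover have "{\<tau>\<in>?Z. \<forall>\<rho>\<in>(\<lambda>y. {y}) ` \<Delta>. \<not> \<rho> \<subseteq> \<tau>} = insert \<sigma> Y" (is "?A = _")
  proof (intro set_eqI iffI)
    fix \<tau> assume \<tau>: "\<tau> \<in> ?A"
    show "\<tau> \<in> insert \<sigma> Y"
    proof (cases "\<tau> \<in> Y")
      case False
      then have *: "\<tau> \<noteq> {}" "\<tau> \<subseteq> insert c \<sigma>" "c \<in> \<tau> \<longrightarrow> (\<exists>x\<in>\<sigma>. x \<notin> \<tau>)" using \<tau> by (auto simp: F_def)
      show ?thesis
      proof (cases "c \<in> \<tau>")
        case True
        then have "\<tau> - {c} \<subset> \<sigma>" using * by auto
        then have "insert c (\<tau> - {c}) \<in> Y" by (rule cone)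
        then show ?thesis using True by (simp add: insert_absorb)
      next
        case False
        then show ?thesis using * proper[of \<tau>] by auto
      qed
    qed simp
  next
    fix \<tau> assume "\<tau> \<in> insert \<sigma> Y"
    then show "\<tau> \<in> ?A" using nY disj \<sigma>ne \<sigma>(3) by (auto simp: F_def)
  qed
  ultimately have "collapse (\<lambda>\<sigma>. \<sigma> \<noteq> {}) ?Z (insert \<sigma> Y)" by (simp only:)
  then have 1: "realization ?Z homotopy_equivalent_space realization (insert \<sigma> Y)"
    using sZ by (rule collapse_nonempty_homotopy_equivalent)
  \<comment> \<open>The other direction cannot proceed vertex by vertex, as \<open>Y\<close> has to
    stay. Instead \<open>\<sigma>\<close> itself goes first, and then each
    \<open>x \<in> \<sigma>\<close> is cut off from \<open>\<Delta>\<close>: the edges from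
    \<open>x\<close> to \<open>y \<noteq> g x\<close> with apex \<open>g x\<close>, and finally the
    edge from \<open>x\<close> to \<open>g x\<close> with apex \<open>c\<close>.\<close>
  define Z where "Z A = {\<tau>\<in>?Z. \<not> \<sigma> \<subseteq> \<tau> \<and> (\<forall>x\<in>A. x \<in> \<tau> \<longrightarrow> \<tau> \<inter> \<Delta> = {})}" for A
  have "collapse (\<lambda>\<sigma>. \<sigma> \<noteq> {}) ?Z (Z A)" if "finite A" "A \<subseteq> \<sigma>" for A
    using that
  proof (induction A rule: finite_induct)
    case empty
    obtain x where x: "x \<in> \<sigma>" using \<sigma>ne by blast
    have "insert (g x) \<tau> \<in> ?Z" if "\<tau> \<in> ?Z" "\<sigma> \<subseteq> \<tau>" for \<tau>
    proof -
      have "\<tau> \<notin> Y" using simplicialD(3)[OF Y _ that(2) \<sigma>ne] \<sigma>(1) by blast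
      then have "insert (g x) \<tau> \<in> F" using that x g\<Delta> disj by (auto simp: F_def)
      then show ?thesis ..
    qed
    then have "free_face ?Z \<sigma> (g x)" using \<sigma> x g\<Delta> disj unfolding free_face_def by blast
    moreover have "Z {} = {\<tau>\<in>?Z. \<not> \<sigma> \<subseteq> \<tau>}" by (simp add: Z_def)
    ultimately show ?case
      using collapse.step[of "\<lambda>\<sigma>. \<sigma> \<noteq> {}" \<sigma> ?Z "g x" "Z {}"] collapse.none[of _ "Z {}"] \<sigma>ne by simp
  next
    case (insert x A)
    then have x: "x \<in> \<sigma>" by simp
    let ?F = "(\<lambda>y. {x,y}) ` (\<Delta> - {g x})"
    let ?Z1 = "{\<tau>\<in>Z A. \<forall>\<rho>\<in>?F. \<not> \<rho> \<subseteq> \<tau>}"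
    have "collapse (\<lambda>\<sigma>. \<sigma> \<noteq> {}) (Z A) ?Z1"
    proof (rule collapse_family)
      show "finite ?F" using \<Delta> by simp
      fix \<rho> assume "\<rho> \<in> ?F"
      then obtain y where y: "y \<in> \<Delta>" "y \<noteq> g x" "\<rho> = {x,y}" by blast
      have "insert (g x) \<tau> \<in> Z A" if "\<tau> \<in> Z A" "\<rho> \<subseteq> \<tau>" for \<tau>
      proof -
        have "\<tau> \<in> F" using that nY y by (auto simp: Z_def)
        have "\<exists>z\<in>\<sigma>. z \<notin> insert (g x) \<tau> \<and> g z \<notin> insert (g x) \<tau>" if c: "c \<in> \<tau>"
        proof -
          obtain z where z: "z \<in> \<sigma>" "z \<notin> \<tau>" "g z \<notin> \<tau>" using \<open>\<tau> \<in> F\<close> c by (auto simp: F_def)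
          moreover have "z \<noteq> g x" using z(1) g\<Delta>[OF x] disj by blast
          moreover have "g z \<noteq> g x" using ginj[OF z(1) x] z(2) \<open>\<rho> \<subseteq> \<tau>\<close> y(3) by blast
          ultimately show ?thesis by blast
        qed
        then have "insert (g x) \<tau> \<in> F" using \<open>\<tau> \<in> F\<close> g\<Delta>[OF x] disj by (auto simp: F_def)
        moreover have "\<not> \<sigma> \<subseteq> insert (g x) \<tau>" using that g\<Delta>[OF x] disj by (auto simp: Z_def)
        moreover have "x' \<notin> insert (g x) \<tau>" if "x' \<in> A" for x'
        proof -
          have "x' \<notin> \<tau>" using that y \<open>\<tau> \<in> Z A\<close> \<open>\<rho> \<subseteq> \<tau>\<close> by (auto simp: Z_def)
          moreover have "x' \<in> \<sigma>" using that insert.prems by auto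
          ultimately show ?thesis using g\<Delta>[OF x] disj by auto
        qed
        ultimately show ?thesis by (auto simp: Z_def)
      qed
      moreover have gx: "g x \<noteq> x" using x disj g\<Delta>[OF x] by (metis IntI emptyE)
      moreover have "\<sigma>' \<subseteq> \<tau>" if "\<sigma>' \<in> ?F" "\<sigma>' \<subseteq> insert (g x) \<tau>" for \<sigma>' \<tau>
        using that gx by auto
      ultimately show "\<rho> \<noteq> {} \<and> finite \<rho> \<and> (\<exists>w. w \<notin> \<rho> \<and> (\<forall>\<tau>\<in>Z A. \<rho> \<subseteq> \<tau> \<longrightarrow> insert w \<tau> \<in> Z A \<and>
           (\<forall>\<sigma>'\<in>?F. \<sigma>' \<subseteq> insert w \<tau> \<longrightarrow> \<sigma>' \<subseteq> \<tau>)))"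
        using y by (intro conjI exI[of _ "g x"]) auto
    qed
    moreover have "collapse (\<lambda>\<sigma>. \<sigma> \<noteq> {}) ?Z1 (Z (insert x A))"
    proof -
      \<comment> \<open>Since \<open>\<tau>\<close> meets \<open>\<Delta>\<close> only in
        \<open>g x\<close> and does not contain \<open>\<sigma>\<close>, a vertex
        \<open>z \<in> \<sigma>\<close> outside \<open>\<tau>\<close> also has \<open>g z\<close>
        outside \<open>\<tau>\<close>, and \<open>c\<close> may be added.\<close>
      have ins: "insert c \<tau> \<in> ?Z1" if "\<tau> \<in> ?Z1" "{x, g x} \<subseteq> \<tau>" for \<tau>
      proof -
        have "\<tau> \<in> F" using that nY x g\<Delta> by (auto simp: Z_def)
        have \<tau>\<Delta>: "\<tau> \<inter> \<Delta> = {g x}" using that g\<Delta>[OF x] by auto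
        from that(1) obtain z where z: "z \<in> \<sigma>" "z \<notin> \<tau>" by (auto simp: Z_def)
        then have "g z \<notin> \<tau>" using ginj[OF z(1) x] \<tau>\<Delta> g\<Delta> that by auto
        moreover have "z \<noteq> c" "g z \<noteq> c" using z \<sigma> g\<Delta> disj by auto
        ultimately have "insert c \<tau> \<in> F" using z \<open>\<tau> \<in> F\<close> by (auto simp: F_def)
        moreover have "\<not> \<sigma> \<subseteq> insert c \<tau>" using z \<open>z \<noteq> c\<close> by auto
        moreover have "x' \<notin> insert c \<tau>" if "x' \<in> A" for x'
        proof -
          have "x' \<notin> \<tau>" using that \<tau>\<Delta> \<open>\<tau> \<in> ?Z1\<close> by (auto simp: Z_def)
          moreover have "x' \<in> \<sigma>" using that insert.prems by auto
          ultimately show ?thesis using \<sigma>(3) by auto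
        qed
        moreover have "\<not> \<rho> \<subseteq> insert c \<tau>" if "\<rho> \<in> ?F" for \<rho>
          using that \<tau>\<Delta> disj by auto
        ultimately show ?thesis by (auto simp: Z_def)
      qed
      have "c \<notin> {x, g x}" using x g\<Delta>[OF x] disj(2) \<sigma>(3) by blast
      then have "free_face ?Z1 {x, g x} c"
        unfolding free_face_def using ins by (intro conjI ballI impI) simp_all
      moreover have "{\<tau>\<in>?Z1. \<not> {x, g x} \<subseteq> \<tau>} = Z (insert x A)"
        using g\<Delta>[OF x] unfolding Z_def by auto
      ultimately show ?thesis
        using collapse.step[of "\<lambda>\<sigma>. \<sigma> \<noteq> {}" "{x, g x}" ?Z1 c] collapse.none[of _ "Z (insert x A)"] by simp
    qed
    moreover have "collapse (\<lambda>\<sigma>. \<sigma> \<noteq> {}) ?Z (Z A)" using insert by simp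
    ultimately show ?case using collapse_trans by blast
  qed
  from this[OF \<sigma>(2)] have "collapse (\<lambda>\<sigma>. \<sigma> \<noteq> {}) ?Z (Z \<sigma>)" by blast
  moreover have "Z \<sigma> = Y \<union> sphere_at c \<Delta>"
  proof (intro set_eqI iffI)
    fix \<tau> assume \<tau>: "\<tau> \<in> Z \<sigma>"
    show "\<tau> \<in> Y \<union> sphere_at c \<Delta>"
    proof (cases "\<tau> \<in> Y")
      case False
      then have F: "\<tau> \<in> F" using \<tau> by (auto simp: Z_def)
      show ?thesis
      proof (cases "\<tau> \<inter> \<sigma> = {}")
        case True
        then have "\<tau> \<noteq> insert c \<Delta>" using F g\<Delta> by (auto simp: F_def)
        then show ?thesis using F True by (auto simp: F_def sphere_at_def)
      next
        case False
        then have "\<tau> \<inter> \<Delta> = {}" using \<tau> by (auto simp: Z_def)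
        then have *: "\<tau> \<noteq> {}" "\<tau> \<subseteq> insert c \<sigma>" using F by (auto simp: F_def)
        then have "\<tau> - {c} \<subset> \<sigma>" using \<tau> by (auto simp: Z_def)
        then have "\<tau> \<in> Y"
          using cone[of "\<tau> - {c}"] proper[of "\<tau> - {c}"] * by (cases "c \<in> \<tau>") (auto simp: insert_absorb)
        then show ?thesis by simp
      qed
    qed simp
  next
    fix \<tau> assume "\<tau> \<in> Y \<union> sphere_at c \<Delta>"
    then show "\<tau> \<in> Z \<sigma>"
    proof
      assume "\<tau> \<in> Y"
      then show ?thesis using nY simplicialD(3)[OF Y _ _ \<sigma>ne] \<sigma>(1) by (auto simp: Z_def)
    next
      assume \<tau>: "\<tau> \<in> sphere_at c \<Delta>"
      then have "\<tau> \<subseteq> insert c \<Delta>" "\<tau> \<noteq> {}" "\<tau> \<noteq> insert c \<Delta>" by (auto simp: sphere_at_def)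
      moreover have "\<exists>x\<in>\<sigma>. x \<notin> \<tau> \<and> g x \<notin> \<tau>" if c: "c \<in> \<tau>"
      proof -
        obtain y where "y \<in> \<Delta>" "y \<notin> \<tau>" using calculation c by blast
        then obtain x where "x \<in> \<sigma>" "g x \<notin> \<tau>" using gsurj by blast
        then show ?thesis using \<open>\<tau> \<subseteq> insert c \<Delta>\<close> disj \<sigma>(3) by blast
      qed
      moreover have "\<tau> \<inter> \<sigma> = {}" using \<open>\<tau> \<subseteq> insert c \<Delta>\<close> disj \<sigma>(3) by blast
      ultimately show ?thesis using \<sigma>ne by (auto simp: Z_def F_def)
    qed
  qed
  ultimately have "collapse (\<lambda>\<sigma>. \<sigma> \<noteq> {}) ?Z (Y \<union> sphere_at c \<Delta>)" by (simp only:)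
  then have "realization ?Z homotopy_equivalent_space realization (Y \<union> sphere_at c \<Delta>)"
    using sZ by (rule collapse_nonempty_homotopy_equivalent)
  with 1 show ?thesis
    using homotopy_eqv_trans homotopy_equivalent_space_sym by blast
qed

text \<open>A combinatorial form of null-homotopy: the boundary of \<open>\<sigma>\<close> lies in a
  collapsible subcomplex. The edge path from this subcomplex to \<open>q\<close> allows the
  resulting sphere to be carried to a prescribed attaching vertex.\<close>

definition null_boundary :: "'a set set \<Rightarrow> 'a \<Rightarrow> 'a set \<Rightarrow> bool" where
  "null_boundary X q \<sigma> \<longleftrightarrow> (\<exists>B\<subseteq>X. simplicial B \<and> collapsible B \<and> (\<forall>\<rho>. \<rho> \<subset> \<sigma> \<and> \<rho> \<noteq> {} \<longrightarrow> \<rho> \<in> B) \<and>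
     (\<exists>u. {u} \<in> B \<and> (\<lambda>u v. {u,v} \<in> X)\<^sup>*\<^sup>* u q))"

lemma null_boundary_mono:
  assumes "null_boundary X q \<sigma>" "X \<subseteq> Y"
  shows "null_boundary Y q \<sigma>"
proof -
  obtain B u where "B \<subseteq> X" "simplicial B" "collapsible B" "\<forall>\<rho>. \<rho> \<subset> \<sigma> \<and> \<rho> \<noteq> {} \<longrightarrow> \<rho> \<in> B"
    "{u} \<in> B" and path: "(\<lambda>u v. {u,v} \<in> X)\<^sup>*\<^sup>* u q"
    using assms(1) unfolding null_boundary_def by blast
  moreover have "(\<lambda>u v. {u,v} \<in> Y)\<^sup>*\<^sup>* u q"
    using path by induction (use assms(2) in \<open>auto intro: rtranclp.rtrancl_into_rtrancl\<close>)
  ultimately show ?thesis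
    using assms(2) unfolding null_boundary_def by blast
qed

text \<open>A fresh cone point \<open>c\<close> over the collapsible \<open>B\<close> changes
  nothing up to homotopy, but now the cone over the boundary of \<open>\<sigma>\<close> is present
  and \<open>sphere_detach\<close> applies, with the sphere hanging at \<open>c\<close>. The sphere
  is moved along the edge from \<open>c\<close> to \<open>u\<close> and the path from
  \<open>u\<close> to \<open>q\<close>, and then the cone is collapsed again.\<close>

lemma attach_simplex:
  fixes X :: "'a set set"
  assumes inf: "infinite (UNIV :: 'a set)" and X: "simplicial X"
    and \<sigma>: "\<sigma> \<notin> X" "finite \<sigma>" "2 \<le> card \<sigma>" and null: "null_boundary X q \<sigma>"
    and \<Delta>: "finite \<Delta>" "card \<Delta> = card \<sigma>" "\<Delta> \<inter> \<Union>X = {}"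
  shows "realization (insert \<sigma> X) homotopy_equivalent_space realization (X \<union> sphere_at q \<Delta>)"
proof -
  obtain B u where B: "B \<subseteq> X" "simplicial B" "collapsible B"
    and bd': "\<forall>\<rho>. \<rho> \<subset> \<sigma> \<and> \<rho> \<noteq> {} \<longrightarrow> \<rho> \<in> B"
    and u: "{u} \<in> B" "(\<lambda>u v. {u,v} \<in> X)\<^sup>*\<^sup>* u q"
    using null unfolding null_boundary_def by blast
  have bd: "\<rho> \<in> B" if "\<rho> \<subset> \<sigma>" "\<rho> \<noteq> {}" for \<rho> using bd' that by blast
  have fin: "finite (\<Union>X \<union> \<sigma> \<union> \<Delta> \<union> {q})" using simplicial_finite_vertices[OF X] \<sigma>(2) \<Delta>(1)
    by (simp only: finite_Un finite.emptyI finite_insert)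
  obtain c where c: "c \<notin> \<Union>X \<union> \<sigma> \<union> \<Delta> \<union> {q}" using ex_new_if_finite[OF inf fin] by blast
  let ?Y = "X \<union> cone_over c B"
  have \<sigma>ne: "\<sigma> \<noteq> {}" using \<sigma> by auto
  have sX\<sigma>: "simplicial (insert \<sigma> X)"
    using simplicial_insert[OF X \<sigma>(2) \<sigma>ne] bd B(1) by blast
  have Y: "simplicial ?Y" using simplicial_cone_over[OF X B(2,1)] .
  have UY: "\<Union>?Y = insert c (\<Union>X)" using B(1) by (auto simp: cone_over_def)
  have disj: "\<Delta> \<inter> \<Union>?Y = {}" using \<Delta> c UY by auto
  have \<Delta>ne: "\<Delta> \<noteq> {}" using \<Delta> \<sigma> by auto
  note P = homotopy_equivalent_space_sym[THEN iffD1]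
  have "collapse (\<lambda>\<sigma>. c \<in> \<sigma>) (insert \<sigma> X \<union> cone_over c B) (insert \<sigma> X)"
    using collapse_cone[OF B(3), of "insert \<sigma> X" c] B(1) c by blast
  moreover have "insert \<sigma> X \<union> cone_over c B = insert \<sigma> ?Y" by simp
  moreover have "simplicial (insert \<sigma> X \<union> cone_over c B)"
    using B(1) by (intro simplicial_cone_over sX\<sigma> B(2)) blast
  ultimately have "realization (insert \<sigma> ?Y) homotopy_equivalent_space realization (insert \<sigma> X)"
    using collapse_homotopy_equivalent[of "\<lambda>\<sigma>. c \<in> \<sigma>" "insert \<sigma> ?Y" "insert \<sigma> X"] by simp
  then have "realization (insert \<sigma> X) homotopy_equivalent_space realization (insert \<sigma> ?Y)"
    by (rule P)
  also have "realization (insert \<sigma> ?Y) homotopy_equivalent_space realization (?Y \<union> sphere_at c \<Delta>)"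
  proof (rule sphere_detach[OF Y])
    show "insert c \<rho> \<in> ?Y" if "\<rho> \<subset> \<sigma>" for \<rho>
      using bd[OF that] by (cases "\<rho> = {}") (auto simp: cone_over_def)
    show "\<sigma> \<notin> ?Y" using \<sigma>(1) c \<sigma>ne by (auto simp: cone_over_def)
  qed (use \<sigma> c \<Delta> disj in auto)
  also have "realization (?Y \<union> sphere_at c \<Delta>) homotopy_equivalent_space realization (?Y \<union> sphere_at u \<Delta>)"
  proof (rule sphere_move[OF Y])
    show "{c,u} \<in> ?Y" using u by (auto simp: cone_over_def)
    show "c \<noteq> u" using u B c by blast
  qed (use \<Delta> \<Delta>ne disj in auto)
  also have "\<dots> homotopy_equivalent_space realization (?Y \<union> sphere_at q \<Delta>)"
  proof (rule sphere_move_path[OF _ Y])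
    show "(\<lambda>u v. {u,v} \<in> ?Y)\<^sup>*\<^sup>* u q"
      using u(2) by induction (auto intro: rtranclp.rtrancl_into_rtrancl)
  qed (use \<Delta> \<Delta>ne disj in auto)
  also have "\<dots> homotopy_equivalent_space realization (X \<union> sphere_at q \<Delta>)"
  proof -
    have "collapse (\<lambda>\<sigma>. c \<in> \<sigma>) (?Y \<union> sphere_at q \<Delta>) (X \<union> sphere_at q \<Delta>)"
      using c by (intro collapse_Un collapse_cone B) (auto simp: sphere_at_def)
    then show ?thesis
      using collapse_homotopy_equivalent simplicial_Un[OF Y simplicial_sphere_at[OF \<Delta>(1)]] by blast
  qed
  finally show ?thesis .
qed

text \<open>All boundaries lie in \<open>X\<close> itself, so the simplices can be exchanged one
  after another: the remaining ones belong to the complex while \<open>\<sigma>\<close> is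
  exchanged, and the new sphere joins \<open>X\<close> afterwards, which keeps
  \<open>null_boundary\<close> by monotonicity.\<close>

lemma attach_simplices:
  fixes X :: "'a set set"
  assumes "finite S" and inf: "infinite (UNIV :: 'a set)" and "simplicial X"
    and "\<And>\<sigma>. \<sigma> \<in> S \<Longrightarrow> \<sigma> \<notin> X \<and> finite \<sigma> \<and> 2 \<le> card \<sigma> \<and> null_boundary X q \<sigma>"
    and "\<And>\<sigma>. \<sigma> \<in> S \<Longrightarrow> finite (\<Delta> \<sigma>) \<and> card (\<Delta> \<sigma>) = card \<sigma> \<and> \<Delta> \<sigma> \<inter> \<Union>X = {}"
    and "\<And>\<sigma> \<tau>. \<sigma> \<in> S \<Longrightarrow> \<tau> \<in> S \<Longrightarrow> \<sigma> \<noteq> \<tau> \<Longrightarrow> \<Delta> \<sigma> \<inter> \<Delta> \<tau> = {}" and "q \<in> \<Union>X"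
  shows "realization (X \<union> S) homotopy_equivalent_space realization (X \<union> (\<Union>\<sigma>\<in>S. sphere_at q (\<Delta> \<sigma>)))"
  using assms(1,3-7)
proof (induction S arbitrary: X rule: finite_induct)
  case empty
  then show ?case by (simp add: homotopy_equivalent_space_refl)
next
  case (insert \<sigma> S X)
  note X = \<open>simplicial X\<close>
  have vert: "\<tau> \<subseteq> \<Union>X" "\<rho> \<subset> \<tau> \<Longrightarrow> \<rho> \<noteq> {} \<Longrightarrow> \<rho> \<in> X" if "\<tau> \<in> insert \<sigma> S" for \<tau> \<rho>
  proof -
    have \<tau>: "finite \<tau>" "2 \<le> card \<tau>" and bd: "\<And>\<rho>. \<rho> \<subset> \<tau> \<Longrightarrow> \<rho> \<noteq> {} \<Longrightarrow> \<rho> \<in> X"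
      using insert.prems(2)[OF that] unfolding null_boundary_def by blast+
    then show "\<rho> \<subset> \<tau> \<Longrightarrow> \<rho> \<noteq> {} \<Longrightarrow> \<rho> \<in> X" by blast
    have "{x} \<in> X" if "x \<in> \<tau>" for x
    proof -
      have "{x} \<noteq> \<tau>" using \<tau> by auto
      then show ?thesis using bd[of "{x}"] that by blast
    qed
    then show "\<tau> \<subseteq> \<Union>X" by blast
  qed
  let ?X = "X \<union> sphere_at q (\<Delta> \<sigma>)"
  have XS: "simplicial (X \<union> S)"
    unfolding simplicial_def
  proof (intro conjI ballI allI impI)
    show "finite (X \<union> S)" using X insert.hyps(1) unfolding simplicial_def by blast
    fix \<tau> assume \<tau>: "\<tau> \<in> X \<union> S"
    have "finite \<sigma>" "\<sigma> \<noteq> {}" if "\<sigma> \<in> S" for \<sigma>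
      using insert.prems(2)[of \<sigma>] that by auto
    then show "finite \<tau>" "\<tau> \<noteq> {}" using \<tau> simplicialD(1,2)[OF X] by blast+
    show "\<rho> \<in> X \<union> S" if "\<rho> \<subseteq> \<tau> \<and> \<rho> \<noteq> {}" for \<rho>
      using \<tau> that vert(2)[of \<tau> \<rho>] simplicialD(3)[OF X, of \<tau> \<rho>] by auto
  qed
  have "realization (X \<union> insert \<sigma> S) homotopy_equivalent_space realization (X \<union> S \<union> sphere_at q (\<Delta> \<sigma>))"
  proof -
    have "\<Union>(X \<union> S) = \<Union>X" using vert(1) by blast
    moreover have "\<sigma> \<notin> X \<union> S" using insert by blast
    moreover have "null_boundary (X \<union> S) q \<sigma>" using insert.prems(2)[of \<sigma>] null_boundary_mono[of X q \<sigma>] by simp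
    ultimately show ?thesis
      using attach_simplex[OF inf XS, of \<sigma> q "\<Delta> \<sigma>"] insert.prems(2,3)[of \<sigma>] by simp
  qed
  also have "X \<union> S \<union> sphere_at q (\<Delta> \<sigma>) = ?X \<union> S" by blast
  also have "realization (?X \<union> S) homotopy_equivalent_space
      realization (?X \<union> (\<Union>\<sigma>\<in>S. sphere_at q (\<Delta> \<sigma>)))"
  proof (rule insert.IH)
    show "simplicial ?X" using insert.prems(3)[of \<sigma>] by (intro simplicial_Un X simplicial_sphere_at) simp
    have U: "\<Union>?X \<subseteq> \<Union>X \<union> \<Delta> \<sigma>" using insert.prems(5) by (auto simp: sphere_at_def)
    show "\<tau> \<notin> ?X \<and> finite \<tau> \<and> 2 \<le> card \<tau> \<and> null_boundary ?X q \<tau>" if "\<tau> \<in> S" for \<tau>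
    proof -
      have *: "\<tau> \<notin> X" "finite \<tau>" "2 \<le> card \<tau>" "null_boundary X q \<tau>"
        using insert.prems(2) that by blast+
      have "\<tau> \<notin> sphere_at q (\<Delta> \<sigma>)"
      proof
        assume "\<tau> \<in> sphere_at q (\<Delta> \<sigma>)"
        then have "\<tau> \<subseteq> {q}" using vert(1)[of \<tau>] that insert.prems(3)[of \<sigma>] by (auto simp: sphere_at_def)
        then have "card \<tau> \<le> card {q}" by (intro card_mono) auto
        then show False using *(3) by simp
      qed
      then show ?thesis using * null_boundary_mono[OF *(4)] by blast
    qed
    show "finite (\<Delta> \<tau>) \<and> card (\<Delta> \<tau>) = card \<tau> \<and> \<Delta> \<tau> \<inter> \<Union>?X = {}" if "\<tau> \<in> S" for \<tau>
      using that insert.prems(3)[of \<tau>] insert.prems(4)[of \<tau> \<sigma>] insert.hyps(2) U by blast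
    show "\<Delta> \<tau> \<inter> \<Delta> \<tau>' = {}" if "\<tau> \<in> S" "\<tau>' \<in> S" "\<tau> \<noteq> \<tau>'" for \<tau> \<tau>'
      using that insert.prems(4) by blast
    show "q \<in> \<Union>?X" using insert.prems(5) by blast
  qed
  finally show ?case by (simp add: Un_assoc)
qed

text \<open>The spheres are moved one at a time; the others count as part of the complex
  meanwhile.\<close>

lemma sphere_move_family:
  assumes "finite J" "simplicial Y" "{u,v} \<in> Y" "u \<noteq> v"
    and "\<And>j. j \<in> J \<Longrightarrow> finite (\<Delta> j) \<and> \<Delta> j \<noteq> {} \<and> \<Delta> j \<inter> \<Union>Y = {}"
    and "\<And>i j. i \<in> J \<Longrightarrow> j \<in> J \<Longrightarrow> i \<noteq> j \<Longrightarrow> \<Delta> i \<inter> \<Delta> j = {}"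
  shows "realization (Y \<union> (\<Union>j\<in>J. sphere_at u (\<Delta> j))) homotopy_equivalent_space
    realization (Y \<union> (\<Union>j\<in>J. sphere_at v (\<Delta> j)))"
  using assms
proof (induction J arbitrary: Y rule: finite_induct)
  case empty
  then show ?case by (simp add: homotopy_equivalent_space_refl)
next
  case (insert j J Y)
  let ?S = "\<Union>j\<in>J. sphere_at u (\<Delta> j)"
  have u: "u \<in> \<Union>Y" "v \<in> \<Union>Y" using insert.prems(2) by blast+
  have "\<Union>?S \<subseteq> insert u (\<Union>j\<in>J. \<Delta> j)" by (auto simp: sphere_at_def)
  moreover have "\<Delta> j \<inter> (\<Union>i\<in>J. \<Delta> i) = {}" using insert.prems(5) insert.hyps(2) by blast
  moreover have "\<Delta> j \<inter> \<Union>Y = {}" using insert.prems(4) by blast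
  ultimately have disj: "\<Delta> j \<inter> \<Union>(Y \<union> ?S) = {}" using u(1) by blast
  have "simplicial (Y \<union> ?S)"
    using insert by (intro simplicial_Un simplicial_UN simplicial_sphere_at) auto
  then have "realization ((Y \<union> ?S) \<union> sphere_at u (\<Delta> j)) homotopy_equivalent_space
    realization ((Y \<union> ?S) \<union> sphere_at v (\<Delta> j))"
    using insert.prems disj by (intro sphere_move) auto
  also have "(Y \<union> ?S) \<union> sphere_at v (\<Delta> j) = (Y \<union> sphere_at v (\<Delta> j)) \<union> ?S" by blast
  also have "realization ((Y \<union> sphere_at v (\<Delta> j)) \<union> ?S) homotopy_equivalent_space
    realization ((Y \<union> sphere_at v (\<Delta> j)) \<union> (\<Union>j\<in>J. sphere_at v (\<Delta> j)))"
  proof (rule insert.IH)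
    show "simplicial (Y \<union> sphere_at v (\<Delta> j))"
      using insert.prems by (intro simplicial_Un simplicial_sphere_at) auto
    have "\<Union>(Y \<union> sphere_at v (\<Delta> j)) \<subseteq> \<Union>Y \<union> \<Delta> j" using u by (auto simp: sphere_at_def)
    then show "finite (\<Delta> i) \<and> \<Delta> i \<noteq> {} \<and> \<Delta> i \<inter> \<Union>(Y \<union> sphere_at v (\<Delta> j)) = {}" if "i \<in> J" for i
      using that insert.prems(4)[of i] insert.prems(5)[of i j] insert.hyps(2) by blast
  qed (use insert.prems in auto)
  finally show ?case by (simp add: Un_ac)
qed

section \<open>Embeddings of wedges\<close>

text \<open>A continuous injection from a compact space into the Hausdorff space of functions is a
  homeomorphism onto its image. To recognize an abstract wedge as a set of barycentric coordinates
  it therefore suffices to write down such a map.\<close>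

definition compact_emb :: "'a topology \<Rightarrow> ('a \<Rightarrow> 'v \<Rightarrow> real) \<Rightarrow> ('v \<Rightarrow> real) set \<Rightarrow> bool" where
  "compact_emb X f S \<longleftrightarrow>
     compact_space X \<and> continuous_map X euclidean f \<and> inj_on f (topspace X) \<and> f ` topspace X = S"

lemma compact_emb_homeomorphic:
  assumes "compact_emb X f S"
  shows "X homeomorphic_space top_of_set S"
proof -
  have "homeomorphic_map X (top_of_set S) f"
    using assms Hausdorff_space_subtopology[OF Hausdorff_space_fun]
    by (intro continuous_imp_homeomorphic_map) (auto simp: compact_emb_def continuous_map_in_subtopology)
  then show ?thesis
    by (rule homeomorphic_map_imp_homeomorphic_space)
qed

lemma compact_space_quotient_space: "compact_space X \<Longrightarrow> compact_space (quotient_space X q)"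
  using image_compactin[of X "topspace X" "quotient_space X q" q]
    quotient_imp_continuous_map[OF quotient_map_quotient_space[of X q]]
  by (simp add: compact_space_def)

lemma continuous_map_quotient_space:
  "continuous_map X Z (h \<circ> q) \<Longrightarrow> continuous_map (quotient_space X q) Z h"
  using continuous_compose_quotient_map[OF quotient_map_quotient_space] by blast

lemma continuous_map_disjoint_union:
  assumes "continuous_map X Z (\<lambda>x. h (Inl x))" "continuous_map Y Z (\<lambda>y. h (Inr y))"
  shows "continuous_map (disjoint_union X Y) Z h"
proof -
  have "openin (disjoint_union X Y) {z \<in> topspace (disjoint_union X Y). h z \<in> U}" if "openin Z U" for U
  proof -
    have "Inl -` {z \<in> topspace (disjoint_union X Y). h z \<in> U} = {x \<in> topspace X. h (Inl x) \<in> U}"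
      and "Inr -` {z \<in> topspace (disjoint_union X Y). h z \<in> U} = {x \<in> topspace Y. h (Inr x) \<in> U}"
      by auto
    then show ?thesis
      using assms that by (simp only: openin_disjoint_union_sum continuous_map_def)
  qed
  moreover have "h \<in> topspace (disjoint_union X Y) \<rightarrow> topspace Z"
    using assms by (auto simp: continuous_map_def)
  ultimately show ?thesis by (auto simp: continuous_map_def)
qed

lemma compact_space_disjoint_union:
  assumes "compact_space X" "compact_space Y"
  shows "compact_space (disjoint_union X Y)"
proof -
  have "continuous_map X (disjoint_union X Y) Inl"
    unfolding continuous_map_def openin_disjoint_union_sum
  proof (intro conjI allI impI)
    fix U assume "openin X (Inl -` U) \<and> openin Y (Inr -` U)"
    moreover from this have "{x \<in> topspace X. Inl x \<in> U} = Inl -` U"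
      using openin_subset by auto
    ultimately show "openin X {x \<in> topspace X. Inl x \<in> U}" by simp
  qed auto
  moreover have "continuous_map Y (disjoint_union X Y) Inr"
    unfolding continuous_map_def openin_disjoint_union_sum
  proof (intro conjI allI impI)
    fix U assume "openin X (Inl -` U) \<and> openin Y (Inr -` U)"
    moreover from this have "{x \<in> topspace Y. Inr x \<in> U} = Inr -` U"
      using openin_subset by auto
    ultimately show "openin Y {x \<in> topspace Y. Inr x \<in> U}" by simp
  qed auto
  ultimately have "compactin (disjoint_union X Y) (Inl ` topspace X \<union> Inr ` topspace Y)"
    using assms unfolding compact_space_def by (intro compactin_Un) (auto intro: image_compactin)
  then show ?thesis
    by (simp add: compact_space_def Plus_def)
qed

lemma continuous_map_sum_topology:
  assumes "\<And>i. i \<in> I \<Longrightarrow> continuous_map (X i) Z (\<lambda>x. h (i, x))"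
  shows "continuous_map (sum_topology X I) Z h"
proof -
  have "openin (sum_topology X I) {z \<in> topspace (sum_topology X I). h z \<in> U}" if U: "openin Z U" for U
  proof -
    have "openin (X i) {x. (i, x) \<in> {z \<in> topspace (sum_topology X I). h z \<in> U}}" if "i \<in> I" for i
    proof -
      have "{x. (i, x) \<in> {z \<in> topspace (sum_topology X I). h z \<in> U}} = {x \<in> topspace (X i). h (i, x) \<in> U}"
        using that by auto
      then show ?thesis using assms[OF that] U by (simp add: continuous_map_def)
    qed
    then show ?thesis unfolding openin_sum_topology by auto
  qed
  moreover have "h \<in> topspace (sum_topology X I) \<rightarrow> topspace Z"
    using assms by (fastforce simp: continuous_map_def)
  ultimately show ?thesis by (auto simp: continuous_map_def)
qed

lemma compact_space_sum_topology:
  assumes "finite I" "\<And>i. i \<in> I \<Longrightarrow> compact_space (X i)"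
  shows "compact_space (sum_topology X I)"
proof -
  have "compactin (sum_topology X I) ((\<lambda>x. (i, x)) ` topspace (X i))" if "i \<in> I" for i
    using assms(2)[OF that] continuous_map_component_injection[OF that, of X]
    by (auto simp: compact_space_def intro: image_compactin)
  then have "compactin (sum_topology X I) (\<Union>i\<in>I. (\<lambda>x. (i, x)) ` topspace (X i))"
    using assms(1) by (intro compactin_Union) auto
  moreover have "(\<Union>i\<in>I. (\<lambda>x. (i, x)) ` topspace (X i)) = topspace (sum_topology X I)"
    by auto
  ultimately show ?thesis by (simp add: compact_space_def)
qed

lemma inj_on_image_quotient:
  assumes "\<And>z z'. z \<in> A \<Longrightarrow> z' \<in> A \<Longrightarrow> h (q z) = h (q z') \<Longrightarrow> q z = q z'"
  shows "inj_on h (q ` A)"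
  using assms unfolding inj_on_def by blast

text \<open>The images meet only in the common value \<open>e\<close> of the base points, so gluing
  \<open>f\<close> and \<open>g\<close> identifies exactly what the wedge identifies. The clauses
  about \<open>None\<close> allow the lemma to be iterated, the outer wedge being based at
  \<open>None\<close>.\<close>

lemma compact_emb_wedge:
  assumes f: "compact_emb X f S" and g: "compact_emb Y g T"
    and x: "x \<in> topspace X" "f x = e" and y: "y \<in> topspace Y" "g y = e" and ST: "S \<inter> T \<subseteq> {e}"
  shows "\<exists>h. compact_emb (wedge X x Y y) h (S \<union> T) \<and> h None = e \<and> None \<in> topspace (wedge X x Y y)"
proof -
  let ?q = "\<lambda>z. if z = Inl x \<or> z = Inr y then None else Some z"
  define h where "h z = (case z of None \<Rightarrow> e | Some (Inl a) \<Rightarrow> f a | Some (Inr b) \<Rightarrow> g b)" for z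
  have hl: "h (?q (Inl a)) = f a" for a using x by (simp add: h_def)
  have hr: "h (?q (Inr b)) = g b" for b using y by (simp add: h_def)
  have top: "topspace (wedge X x Y y) = ?q ` (topspace X <+> topspace Y)"
    by (simp add: wedge_def)
  have "continuous_map (disjoint_union X Y) euclidean (h \<circ> ?q)"
    using f g by (intro continuous_map_disjoint_union) (simp_all only: o_def hl hr compact_emb_def)
  then have "continuous_map (wedge X x Y y) euclidean h"
    unfolding wedge_def by (rule continuous_map_quotient_space)
  moreover have "compact_space (wedge X x Y y)"
    unfolding wedge_def using f g
    by (intro compact_space_quotient_space compact_space_disjoint_union) (auto simp: compact_emb_def)
  moreover have "inj_on h (topspace (wedge X x Y y))"
  proof -
    have fi: "f a = f b \<longleftrightarrow> a = b" if "a \<in> topspace X" "b \<in> topspace X" for a b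
      using f that by (auto simp: compact_emb_def dest: inj_onD)
    have gi: "g a = g b \<longleftrightarrow> a = b" if "a \<in> topspace Y" "b \<in> topspace Y" for a b
      using g that by (auto simp: compact_emb_def dest: inj_onD)
    have fg: "a = x \<and> b = y" if "a \<in> topspace X" "b \<in> topspace Y" "f a = g b" for a b
    proof -
      have "f a \<in> S" "g b \<in> T" using f g that(1,2) by (auto simp: compact_emb_def)
      then have "f a \<in> S \<inter> T" using that(3) by simp
      then have "f a = f x" "g b = g y" using ST x y that by auto
      then show ?thesis using fi gi that x y by blast
    qed
    have "?q z = ?q z'" if z: "z \<in> topspace X <+> topspace Y" "z' \<in> topspace X <+> topspace Y"
      and eq: "h (?q z) = h (?q z')" for z z'
    proof -
      consider a b where "z = Inl a" "z' = Inl b" | a b where "z = Inl a" "z' = Inr b"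
        | a b where "z = Inr b" "z' = Inl a" | a b where "z = Inr a" "z' = Inr b"
        by (metis sum.exhaust)
      then show ?thesis
      proof cases
        case (1 a b)
        have "f a = f b" using eq hl[of a] hl[of b] unfolding 1 by argo
        then show ?thesis using z fi 1 by auto
      next
        case (2 a b)
        have "f a = g b" using eq hl[of a] hr[of b] unfolding 2 by argo
        then show ?thesis using z fg[of a b] 2 by auto
      next
        case (3 a b)
        have "f a = g b" using eq hl[of a] hr[of b] unfolding 3 by argo
        then show ?thesis using z fg[of a b] 3 by auto
      next
        case (4 a b)
        have "g a = g b" using eq hr[of a] hr[of b] unfolding 4 by argo
        then show ?thesis using z gi 4 by auto
      qed
    qed
    then show ?thesis unfolding top by (rule inj_on_image_quotient)
  qed
  moreover have "h ` topspace (wedge X x Y y) = S \<union> T"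
  proof -
    have "h ` topspace (wedge X x Y y) = (\<lambda>a. h (?q (Inl a))) ` topspace X \<union> (\<lambda>b. h (?q (Inr b))) ` topspace Y"
      unfolding top Plus_def image_Un image_image ..
    then show ?thesis using f g unfolding hl hr compact_emb_def by blast
  qed
  moreover have "None \<in> topspace (wedge X x Y y)"
  proof -
    have "?q (Inl x) \<in> ?q ` (topspace X <+> topspace Y)" using x by (intro imageI InlI)
    then show ?thesis unfolding top by simp
  qed
  moreover have "h None = e" by (simp add: h_def)
  ultimately show ?thesis unfolding compact_emb_def by blast
qed

text \<open>Adding \<open>e\<close> to the image matters only for \<open>k = 0\<close>, where the
  wedge is a point; otherwise every \<open>T j\<close> contains \<open>e\<close> already.\<close>

lemma compact_emb_sphere_wedge:
  assumes b: "\<And>j. j < k \<Longrightarrow> compact_emb (nsphere d) (b j) (T j) \<and> b j nsphere_base = e"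
    and disj: "\<And>i j. i < k \<Longrightarrow> j < k \<Longrightarrow> i \<noteq> j \<Longrightarrow> T i \<inter> T j \<subseteq> {e}"
  shows "\<exists>h. compact_emb (sphere_wedge k d) h (insert e (\<Union>j<k. T j)) \<and> h None = e"
proof (cases "k = 0")
  case True
  have "compact_emb (discrete_topology {None}) (\<lambda>_ :: (nat \<times> (nat \<Rightarrow> real)) option. e) {e}"
    by (auto simp: compact_emb_def compact_space_discrete_topology)
  then show ?thesis using True by (auto simp: sphere_wedge_def intro: exI[of _ "\<lambda>_. e"])
next
  case False
  let ?q = "\<lambda>(j::nat, x). if x = nsphere_base then None else Some (j, x)"
  let ?X = "sum_topology (\<lambda>_. nsphere d) {..<k}"
  define h where "h z = (case z of None \<Rightarrow> e | Some (j, x) \<Rightarrow> b j x)" for z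
  have W: "sphere_wedge k d = quotient_space ?X ?q" using False by (simp add: sphere_wedge_def)
  have top: "topspace (sphere_wedge k d) = ?q ` ({..<k} \<times> topspace (nsphere d))"
    by (simp add: W o_def)
  have hq: "h (?q (j, x)) = b j x" if "j < k" for j x using b[OF that] by (simp add: h_def)
  have "continuous_map (nsphere d) euclidean (\<lambda>x. (h \<circ> ?q) (j, x))" if "j \<in> {..<k}" for j
    using that b[of j] hq[of j] by (simp add: compact_emb_def)
  then have "continuous_map (sphere_wedge k d) euclidean h"
    unfolding W by (intro continuous_map_quotient_space continuous_map_sum_topology)
  moreover have "compact_space (sphere_wedge k d)"
    unfolding W using b[of 0] False
    by (intro compact_space_quotient_space compact_space_sum_topology) (auto simp: compact_emb_def)
  moreover have "inj_on h (topspace (sphere_wedge k d))"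
  proof -
    have *: "?q (i, x) = ?q (j, y)" if "i < k" "j < k" "x \<in> topspace (nsphere d)" "y \<in> topspace (nsphere d)"
      "b i x = b j y" for i j x y
    proof (cases "i = j")
      case True
      then show ?thesis using that b[of i] by (auto simp: compact_emb_def dest: inj_onD)
    next
      case False
      have "b i x \<in> T i" "b j y \<in> T j" using that(1-4) b[of i] b[of j] by (auto simp: compact_emb_def)
      then have "b i x \<in> T i \<inter> T j" using that(5) by simp
      then have "b i x = b i nsphere_base" "b j y = b j nsphere_base"
        using disj[of i j] b[of i] b[of j] that False by auto
      then have "x = nsphere_base" "y = nsphere_base"
        using that(1-4) b[of i] b[of j] nsphere_base_in_nsphere[of d]
        unfolding compact_emb_def by (metis inj_onD)+
      then show ?thesis by simp
    qed
    have "?q z = ?q z'" if "z \<in> {..<k} \<times> topspace (nsphere d)" "z' \<in> {..<k} \<times> topspace (nsphere d)"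
      "h (?q z) = h (?q z')" for z z'
    proof -
      obtain i x j y where zz: "z = (i, x)" "z' = (j, y)" by (metis surj_pair)
      then have ij: "i < k" "j < k" "x \<in> topspace (nsphere d)" "y \<in> topspace (nsphere d)"
        using that(1,2) by auto
      have "b i x = b j y"
        using that(3) hq[OF ij(1), of x] hq[OF ij(2), of y] unfolding zz by argo
      then show ?thesis unfolding zz by (intro * ij)
    qed
    then show ?thesis unfolding top by (rule inj_on_image_quotient)
  qed
  moreover have "h ` topspace (sphere_wedge k d) = insert e (\<Union>j<k. T j)"
  proof -
    have "h ` topspace (sphere_wedge k d) = (\<Union>j<k. (\<lambda>x. h (?q (j, x))) ` topspace (nsphere d))"
      unfolding top image_image Sigma_def image_UN by blast
    also have "\<dots> = (\<Union>j<k. T j)"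
      using b hq by (intro SUP_cong) (auto simp: compact_emb_def)
    finally have "h ` topspace (sphere_wedge k d) = (\<Union>j<k. T j)" .
    moreover have "e \<in> T 0"
      using b[of 0] False nsphere_base_in_nsphere[of d] by (auto simp: compact_emb_def)
    ultimately show ?thesis using False by auto
  qed
  moreover have "h None = e" by (simp add: h_def)
  ultimately show ?thesis unfolding compact_emb_def by blast
qed

section \<open>Spheres as boundaries of simplices\<close>

definition vertex_point :: "'a \<Rightarrow> 'a \<Rightarrow> real" where
  "vertex_point v = (\<lambda>x. if x = v then 1 else 0)"

lemma underlying_Un: "underlying (K \<union> L) = underlying K \<union> underlying L"
  by (auto simp: underlying_def)

lemma underlying_UN: "underlying (\<Union>i\<in>I. K i) = (\<Union>i\<in>I. underlying (K i))"
  by (auto simp: underlying_def)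

text \<open>A common point is supported on common vertices only, so all its weight sits at
  \<open>y\<close>.\<close>

lemma underlying_Int_vertex:
  assumes "\<Union>K \<inter> \<Union>L \<subseteq> {y}"
  shows "underlying K \<inter> underlying L \<subseteq> {vertex_point y}"
proof
  fix t assume "t \<in> underlying K \<inter> underlying L"
  then obtain \<sigma> \<tau> where st: "\<sigma> \<in> K" "\<tau> \<in> L" "t \<in> closed_simplex \<sigma>" "t \<in> closed_simplex \<tau>"
    by (auto simp: underlying_def)
  have z: "t x = 0" if "x \<noteq> y" for x
  proof -
    have "x \<notin> \<sigma> \<or> x \<notin> \<tau>" using assms that st by blast
    then show ?thesis using st by (auto simp: closed_simplex_def)
  qed
  have s: "(\<Sum>v\<in>\<sigma>. t v) = 1" using st by (simp add: closed_simplex_def)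
  then have "finite \<sigma>" by (metis sum.infinite zero_neq_one)
  moreover have "(\<Sum>v\<in>\<sigma>. t v) = (\<Sum>v\<in>\<sigma>. if v = y then t y else 0)"
    using z by (intro sum.cong) auto
  ultimately have "t y = 1" using s by (auto split: if_splits)
  then show "t \<in> {vertex_point y}" using z by (auto simp: vertex_point_def)
qed

text \<open>With a zero coordinate appended, a vector of \<open>nsphere d\<close> has
  \<open>d + 2\<close> entries. Subtracting the smallest entry and dividing by the sum gives
  barycentric coordinates one of which is 0, that is, a point of the boundary of the simplex on
  \<open>d + 2\<close> vertices. Since the last entry is 0 and the norm is 1, the shift and the
  scaling can be undone.\<close>

lemma compact_emb_nsphere:
  assumes \<Delta>: "finite \<Delta>" "card \<Delta> = Suc d" "v \<notin> \<Delta>"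
  shows "\<exists>b. compact_emb (nsphere d) b (underlying (sphere_at v \<Delta>)) \<and> b nsphere_base = vertex_point v"
proof -
  let ?I = "{..Suc d}" and ?V = "insert v \<Delta>"
  \<comment> \<open>\<open>nsphere_base\<close> is the unit vector at index 0, so index 0 has to be
    the vertex \<open>v\<close>.\<close>
  obtain w where w: "bij_betw w ?I ?V" "w 0 = v"
  proof -
    have "card {1..Suc d} = card \<Delta>" using \<Delta> by simp
    then obtain w where "bij_betw w {1..Suc d} \<Delta>" using \<Delta>(1) by (metis finite_same_card_bij finite_atLeastAtMost)
    then have "bij_betw (w(0 := v)) (insert 0 {1..Suc d}) (insert v \<Delta>)"
      using \<Delta>(3) by (auto simp: bij_betw_def inj_on_def)
    moreover have "insert 0 {1..Suc d} = ?I" by auto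
    ultimately show ?thesis using that[of "w(0 := v)"] by simp
  qed
  define w' where "w' = the_inv_into ?I w"
  have w': "w' (w i) = i" if "i \<le> Suc d" for i
    unfolding w'_def using w(1) that by (auto simp: bij_betw_def intro: the_inv_into_f_f)
  have ww: "\<exists>i\<le>Suc d. x = w i" if "x \<in> ?V" for x using w(1) that by (auto simp: bij_betw_def)
  have wV: "w i \<in> ?V" if "i \<le> Suc d" for i using w(1) that by (auto simp: bij_betw_def)
  have sumw: "sum t ?V = (\<Sum>i\<le>Suc d. t (w i))" for t :: "'a \<Rightarrow> real"
    using sum.reindex_bij_betw[OF w(1), of t] by simp
  define \<mu> where "\<mu> u = Min (u ` ?I)" for u :: "nat \<Rightarrow> real"
  define N where "N u = (\<Sum>i\<le>Suc d. u i - \<mu> u)" for u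
  define b where "b u = (\<lambda>x. if x \<in> ?V then (u (w' x) - \<mu> u) / N u else 0)" for u
  have \<mu>le: "\<mu> u \<le> u i" if "i \<le> Suc d" for u i unfolding \<mu>_def using that by (intro Min_le) auto
  have \<mu>att: "\<exists>i\<le>Suc d. u i = \<mu> u" for u
  proof -
    have "\<mu> u \<in> u ` ?I" unfolding \<mu>_def by (rule Min_in) auto
    then show ?thesis by auto
  qed
  have top: "u \<in> topspace (nsphere d) \<longleftrightarrow> (\<Sum>i\<le>d. (u i)\<^sup>2) = 1 \<and> (\<forall>i>d. u i = 0)" for u
    by (simp add: nsphere)
  have Npos: "N u > 0" if "u \<in> topspace (nsphere d)" for u
  proof -
    have "N u \<noteq> 0"
    proof
      assume "N u = 0"
      then have "u i - \<mu> u = 0" if "i \<le> Suc d" for i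
        using that \<mu>le[of _ u] unfolding N_def by (subst (asm) sum_nonneg_eq_0_iff) auto
      then have eq: "u i = u (Suc d)" if "i \<le> Suc d" for i using that by (metis eq_iff_diff_eq_0 order_refl)
      have "u i = 0" if "i \<le> d" for i using eq[of i] top \<open>u \<in> _\<close> that by simp
      then have "(\<Sum>i\<le>d. (u i)\<^sup>2) = 0" by simp
      then show False using top that by simp
    qed
    moreover have "0 \<le> N u" unfolding N_def by (intro sum_nonneg) (use \<mu>le in auto)
    ultimately show ?thesis by simp
  qed
  have bw: "b u (w i) = (u i - \<mu> u) / N u" if "i \<le> Suc d" for u i
    using wV[OF that] w'[OF that] by (simp add: b_def)
  have cont: "continuous_map (nsphere d) euclidean b"
  proof -
    have c\<mu>: "continuous_on S \<mu>" for S
      using continuous_on_Min_coordinates[of ?I S "\<lambda>_. 1"] by (simp add: \<mu>_def[abs_def])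
    have cN: "continuous_on S N" for S
      unfolding N_def by (intro continuous_intros continuous_on_coordinate c\<mu>)
    have "continuous_on (topspace (nsphere d)) b"
      unfolding b_def
    proof (rule continuous_on_coordinatewise_then_product)
      fix x
      have "continuous_on (topspace (nsphere d)) (\<lambda>u. (u (w' x) - \<mu> u) / N u)"
        by (intro continuous_intros continuous_on_coordinate c\<mu> cN) (use Npos in \<open>metis less_irrefl\<close>)
      then show "continuous_on (topspace (nsphere d)) (\<lambda>u. if x \<in> ?V then (u (w' x) - \<mu> u) / N u else 0)"
        by (cases "x \<in> ?V") auto
    qed
    moreover have "nsphere d = top_of_set (topspace (nsphere d))"
      by (simp add: nsphere euclidean_product_topology)
    ultimately show ?thesis by (metis continuous_map_iff_continuous)
  qed
  have inj: "inj_on b (topspace (nsphere d))"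
  proof (rule inj_onI)
    fix u u' assume u: "u \<in> topspace (nsphere d)" "u' \<in> topspace (nsphere d)" and eq: "b u = b u'"
    define c where "c = N u / N u'"
    have c: "c > 0" unfolding c_def using Npos u by simp
    have *: "u i - \<mu> u = c * (u' i - \<mu> u')" if "i \<le> Suc d" for i
      using fun_cong[OF eq, of "w i"] that Npos[OF u(1)] Npos[OF u(2)]
      by (simp add: bw c_def field_simps)
    have "u (Suc d) = 0" "u' (Suc d) = 0" using u top by simp_all
    then have "\<mu> u = c * \<mu> u'" using *[of "Suc d"] by simp
    then have **: "u i = c * u' i" if "i \<le> Suc d" for i using *[OF that] by (simp add: algebra_simps)
    have "1 = (\<Sum>i\<le>d. (c * u' i)\<^sup>2)" using u(1) ** by (simp add: top)
    also have "\<dots> = c\<^sup>2" using u(2) by (simp add: top power_mult_distrib flip: sum_distrib_left)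
    finally have "c = 1" using c by (metis abs_of_pos abs_1 power2_eq_iff_nonneg less_imp_le power_one zero_le_one)
    show "u = u'"
    proof
      fix i show "u i = u' i"
        using ** \<open>c = 1\<close> u top by (cases "i \<le> d") auto
    qed
  qed
  have im1: "b u \<in> underlying (sphere_at v \<Delta>)" if u: "u \<in> topspace (nsphere d)" for u
  proof -
    obtain j where j: "j \<le> Suc d" "u j = \<mu> u" using \<mu>att by blast
    have "0 \<le> b u x" for x
    proof (cases "x \<in> ?V")
      case True
      then obtain i where "i \<le> Suc d" "x = w i" using ww by blast
      then show ?thesis using bw \<mu>le[of i u] Npos[OF u] by simp
    qed (simp add: b_def)
    moreover have z: "b u (w j) = 0" using bw j by simp
    moreover have "sum (b u) (?V - {w j}) = 1"
    proof -
      have "sum (b u) (?V - {w j}) = sum (b u) ?V" using z \<Delta>(1) by (simp add: sum_diff1 wV[OF j(1)])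
      also have "\<dots> = (\<Sum>i\<le>Suc d. (u i - \<mu> u) / N u)" unfolding sumw using bw by (intro sum.cong) auto
      also have "\<dots> = N u / N u" unfolding N_def by (rule sum_divide_distrib[symmetric])
      finally show ?thesis using Npos[OF u] by simp
    qed
    ultimately have "b u \<in> closed_simplex (?V - {w j})"
      unfolding closed_simplex_def by (auto simp: b_def)
    moreover have "?V - {w j} \<in> sphere_at v \<Delta>"
    proof -
      have "card (?V - {w j}) = Suc d" using \<Delta> wV[OF j(1)] by (simp add: card_Diff_singleton)
      then have "?V - {w j} \<noteq> {}" by (metis card.empty nat.distinct(1))
      then show ?thesis using wV[OF j(1)] by (auto simp: sphere_at_def)
    qed
    ultimately show ?thesis by (blast intro: underlyingI)
  qed
  have im2: "t \<in> b ` topspace (nsphere d)" if t: "t \<in> underlying (sphere_at v \<Delta>)" for t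
  proof -
    obtain \<tau> where \<tau>: "\<tau> \<subset> ?V" "t \<in> closed_simplex \<tau>" using t by (auto simp: underlying_def sphere_at_def)
    then have nn: "0 \<le> t x" and out: "x \<notin> ?V \<Longrightarrow> t x = 0" for x by (auto simp: closed_simplex_def)
    obtain j where j: "j \<le> Suc d" "t (w j) = 0"
    proof -
      obtain x where x: "x \<in> ?V" "x \<notin> \<tau>" using \<tau> by blast
      then have "t x = 0" using \<tau>(2) by (simp add: closed_simplex_def)
      then show thesis using that ww[OF x(1)] by metis
    qed
    have "sum t ?V = sum t \<tau>" using \<tau> \<Delta>(1) by (intro sum.mono_neutral_right) (auto simp: closed_simplex_def)
    then have s1: "(\<Sum>i\<le>Suc d. t (w i)) = 1" using \<tau> sumw by (simp add: closed_simplex_def)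
    \<comment> \<open>The inverse map: shift so that the last entry becomes 0, then scale to norm
      1.\<close>
    define a where "a i = (if i \<le> d then t (w i) - t (w (Suc d)) else 0)" for i
    define r where "r = sqrt (\<Sum>i\<le>d. (a i)\<^sup>2)"
    have r: "r > 0"
    proof -
      have "(\<Sum>i\<le>d. (a i)\<^sup>2) \<noteq> 0"
      proof
        assume "(\<Sum>i\<le>d. (a i)\<^sup>2) = 0"
        then have "a i = 0" if "i \<le> d" for i using that by (subst (asm) sum_nonneg_eq_0_iff) auto
        then have eq: "t (w i) = t (w (Suc d))" if "i \<le> Suc d" for i
          using that by (cases "i \<le> d") (auto simp: a_def le_Suc_eq)
        have "t (w i) = 0" if "i \<le> Suc d" for i using eq[OF that] eq[OF j(1)] j(2) by simp
        then show False using s1 by simp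
      qed
      moreover have "0 \<le> (\<Sum>i\<le>d. (a i)\<^sup>2)" by (intro sum_nonneg) auto
      ultimately show ?thesis unfolding r_def by simp
    qed
    define u where "u i = a i / r" for i
    have ui: "u i = (t (w i) - t (w (Suc d))) / r" if "i \<le> Suc d" for i
      using that by (cases "i \<le> d") (auto simp: u_def a_def le_Suc_eq)
    have r2: "r\<^sup>2 = (\<Sum>i\<le>d. (a i)\<^sup>2)" unfolding r_def by (simp add: sum_nonneg)
    have "(\<Sum>i\<le>d. (u i)\<^sup>2) = (\<Sum>i\<le>d. (a i)\<^sup>2) / r\<^sup>2"
      unfolding u_def power_divide by (rule sum_divide_distrib[symmetric])
    then have utop: "u \<in> topspace (nsphere d)" using r2 r unfolding top by (auto simp: u_def a_def)
    have "\<mu> u = u j" unfolding \<mu>_def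
    proof (rule Min_eqI)
      show "u j \<in> u ` ?I" using j by auto
      fix y assume "y \<in> u ` ?I"
      then obtain i where "i \<le> Suc d" "y = u i" by auto
      then show "u j \<le> y"
        using ui[of i] ui[OF j(1)] j(2) nn[of "w i"] r by (simp only:) (intro divide_right_mono; simp)
    qed simp
    then have d: "u i - \<mu> u = t (w i) / r" if "i \<le> Suc d" for i
      using ui[OF that] ui[OF j(1)] j(2) by (simp add: diff_divide_distrib)
    have "N u = (\<Sum>i\<le>Suc d. t (w i) / r)" unfolding N_def using d by (intro sum.cong) auto
    also have "\<dots> = (\<Sum>i\<le>Suc d. t (w i)) / r" by (rule sum_divide_distrib[symmetric])
    finally have Nu: "N u = 1 / r" using s1 by simp
    have "b u x = t x" for x
    proof (cases "x \<in> ?V")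
      case True
      then obtain i where "i \<le> Suc d" "x = w i" using ww by blast
      then show ?thesis using bw d Nu r by simp
    next
      case False
      then show ?thesis using out by (simp add: b_def)
    qed
    then have "b u = t" by (rule ext)
    then show ?thesis using utop by blast
  qed
  have compact: "compact_space (nsphere d)"
  proof -
    let ?P = "Pi\<^sub>E UNIV (\<lambda>i. if i \<le> d then {-1..1::real} else {0})"
    have "compactin (powertop_real UNIV) ?P"
      unfolding compactin_PiE by (auto simp: compact_Icc)
    moreover have "closedin euclidean {u::nat \<Rightarrow> real. (\<Sum>i\<le>d. (u i)\<^sup>2) = 1}"
      unfolding closed_closedin[symmetric]
      by (intro closed_Collect_eq continuous_intros continuous_on_coordinate)
    ultimately have "compactin euclidean (?P \<inter> {u. (\<Sum>i\<le>d. (u i)\<^sup>2) = 1})"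
      unfolding euclidean_product_topology by (metis closed_Int_compactin Int_commute)
    moreover have "?P \<inter> {u. (\<Sum>i\<le>d. (u i)\<^sup>2) = 1} = topspace (nsphere d)"
    proof (intro set_eqI iffI)
      fix u assume "u \<in> ?P \<inter> {u. (\<Sum>i\<le>d. (u i)\<^sup>2) = 1}"
      then have "u i \<in> (if i \<le> d then {-1..1::real} else {0})" "(\<Sum>i\<le>d. (u i)\<^sup>2) = 1" for i
        by (auto simp: PiE_iff)
      then show "u \<in> topspace (nsphere d)" unfolding top by (metis not_le singletonD)
    next
      fix u assume u: "u \<in> topspace (nsphere d)"
      have "u i \<in> {-1..1}" if "i \<le> d" for i
      proof -
        have "(u i)\<^sup>2 \<le> (\<Sum>i\<le>d. (u i)\<^sup>2)" using that by (intro member_le_sum) auto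
        then have "\<bar>u i\<bar> \<le> 1" using u by (simp add: top abs_square_le_1)
        then show ?thesis by auto
      qed
      then show "u \<in> ?P \<inter> {u. (\<Sum>i\<le>d. (u i)\<^sup>2) = 1}" using u by (auto simp: PiE_iff top)
    qed
    ultimately have "compactin euclidean (topspace (nsphere d))" by simp
    then have "compact_space (top_of_set (topspace (nsphere d)))"
      by (simp add: compact_space_subtopology)
    moreover have "nsphere d = top_of_set (topspace (nsphere d))"
      by (simp add: nsphere euclidean_product_topology)
    ultimately show ?thesis by simp
  qed
  have "b nsphere_base = vertex_point v"
  proof
    have m: "\<mu> nsphere_base = 0"
      unfolding \<mu>_def by (intro Min_eqI) (auto simp: nsphere_base_def image_iff intro: exI[of _ "Suc d"])
    have n: "N nsphere_base = 1"
      unfolding N_def m by (simp add: nsphere_base_def sum.atMost_shift)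
    fix x show "b nsphere_base x = vertex_point v x"
    proof (cases "x \<in> ?V")
      case True
      then obtain i where i: "i \<le> Suc d" "x = w i" using ww by blast
      have "x = v \<longleftrightarrow> i = 0" using w'[OF i(1)] w'[of 0] i w(2) by auto
      then show ?thesis using bw[OF i(1)] i m n by (simp add: nsphere_base_def vertex_point_def)
    next
      case False
      then show ?thesis by (auto simp: b_def vertex_point_def)
    qed
  qed
  moreover have "compact_emb (nsphere d) b (underlying (sphere_at v \<Delta>))"
    unfolding compact_emb_def using compact cont inj im1 im2 by blast
  ultimately show ?thesis by blast
qed

text \<open>Stellar subdivision at \<open>p\<close> turns an arbitrary base point into a vertex.\<close>

definition stellar :: "'a set set \<Rightarrow> 'a set \<Rightarrow> 'a \<Rightarrow> 'a set set" where
  "stellar K \<rho> y = {\<tau> \<in> K \<union> cone_over y {\<tau>\<in>K. \<tau> \<union> \<rho> \<in> K}. \<not> \<rho> \<subseteq> \<tau>}"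

definition support :: "('a \<Rightarrow> real) \<Rightarrow> 'a set" where
  "support p = {x. p x \<noteq> 0}"

lemma support_in_complex:
  assumes "simplicial K" "p \<in> underlying K"
  shows "support p \<in> K" "finite (support p)" "support p \<noteq> {}" "sum p (support p) = 1" "\<And>x. 0 \<le> p x"
proof -
  obtain \<tau> where \<tau>: "\<tau> \<in> K" "p \<in> closed_simplex \<tau>" using assms by (auto simp: underlying_def)
  have sub: "support p \<subseteq> \<tau>" using \<tau> by (auto simp: support_def closed_simplex_def)
  have fin: "finite \<tau>" using simplicialD(1)[OF assms(1) \<tau>(1)] .
  then show f: "finite (support p)" using sub finite_subset by blast
  have "sum p (support p) = sum p \<tau>"
    using sub fin by (intro sum.mono_neutral_left) (auto simp: support_def)
  then show s: "sum p (support p) = 1" using \<tau> by (simp add: closed_simplex_def)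
  then show ne: "support p \<noteq> {}" by auto
  show "support p \<in> K" using simplicialD(3)[OF assms(1) \<tau>(1) sub ne] .
  show "0 \<le> p x" for x using \<tau> by (simp add: closed_simplex_def)
qed

text \<open>The map subtracts from \<open>z\<close> the largest multiple of \<open>p\<close> that
  leaves nonnegative coordinates and puts that weight on the new vertex \<open>y\<close>. Some
  coordinate in the support of \<open>p\<close> becomes 0, so the image lies in a simplex that does
  not contain the support; \<open>p\<close> itself goes to \<open>y\<close>.\<close>

lemma compact_emb_stellar:
  assumes K: "simplicial K" and p: "p \<in> underlying K" and y: "y \<notin> \<Union>K"
  shows "\<exists>a. compact_emb (top_of_set (underlying K)) a (underlying (stellar K (support p) y)) \<and> a p = vertex_point y"
proof -
  let ?\<rho> = "support p" let ?L = "stellar K ?\<rho> y"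
  note \<rho> = support_in_complex[OF K p]
  have ppos: "0 < p x" if "x \<in> ?\<rho>" for x using that \<rho>(5)[of x] by (simp add: support_def)
  have pz: "p x = 0" if "x \<notin> ?\<rho>" for x using that by (simp add: support_def)
  have y\<rho>: "y \<notin> ?\<rho>" using y \<rho>(1) by blast
  have yt: "y \<notin> \<tau>" if "\<tau> \<in> K" for \<tau> using y that by blast
  define \<kappa> where "\<kappa> z = Min ((\<lambda>x. inverse (p x) * z x) ` ?\<rho>)" for z :: "'a \<Rightarrow> real"
  define a where "a z = (\<lambda>x. if x = y then \<kappa> z else z x - \<kappa> z * p x)" for z
  have lam: "\<kappa> z * p x \<le> z x" if "x \<in> ?\<rho>" for z x
  proof -
    have "\<kappa> z \<le> inverse (p x) * z x" unfolding \<kappa>_def using \<rho>(2) that by (intro Min_le) auto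
    then show ?thesis using ppos[OF that] by (simp add: field_simps)
  qed
  have lamatt: "\<exists>x\<in>?\<rho>. \<kappa> z * p x = z x" for z
  proof -
    have "\<kappa> z \<in> (\<lambda>x. inverse (p x) * z x) ` ?\<rho>" unfolding \<kappa>_def using \<rho>(2,3) by (intro Min_in) auto
    then obtain x where x: "x \<in> ?\<rho>" "\<kappa> z = inverse (p x) * z x" by blast
    then have "\<kappa> z * p x = z x" using ppos[OF x(1)] by simp
    then show ?thesis using x(1) by blast
  qed
  \<comment> \<open>\<open>\<kappa> z\<close> is the largest \<open>c\<close> with
    \<open>c * p x \<le> z x\<close> on the support, so it is determined by these inequalities
    together with one equality.\<close>
  have lameq: "\<kappa> z = c" if "\<And>x. x \<in> ?\<rho> \<Longrightarrow> c * p x \<le> z x" "x0 \<in> ?\<rho>" "c * p x0 = z x0" for z c x0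
  proof -
    obtain x where x: "x \<in> ?\<rho>" "\<kappa> z * p x = z x" using lamatt by blast
    have "c \<le> \<kappa> z" using that(1)[OF x(1)] x ppos[OF x(1)] by (metis mult_le_cancel_right_pos)
    moreover have "\<kappa> z \<le> c" using lam[OF that(2), of z] that(3) ppos[OF that(2)] by (metis mult_le_cancel_right_pos)
    ultimately show ?thesis by simp
  qed
  have cont: "continuous_map (top_of_set (underlying K)) euclidean a"
  proof -
    have c\<kappa>: "continuous_on S \<kappa>" for S
      unfolding \<kappa>_def by (rule continuous_on_Min_coordinates[OF \<rho>(2,3)])
    have "continuous_on (underlying K) (\<lambda>z. if x = y then \<kappa> z else z x - \<kappa> z * p x)" for x
      by (cases "x = y") (auto intro!: continuous_intros c\<kappa> continuous_on_coordinate)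
    then have "continuous_on (underlying K) a"
      unfolding a_def by (rule continuous_on_coordinatewise_then_product)
    then show ?thesis by simp
  qed
  have zy: "z y = 0" if "z \<in> underlying K" for z
    using that yt by (auto simp: underlying_def closed_simplex_def)
  have inj: "inj_on a (underlying K)"
  proof (rule inj_onI)
    fix z z' assume z: "z \<in> underlying K" "z' \<in> underlying K" and eq: "a z = a z'"
    have l: "\<kappa> z = \<kappa> z'" using fun_cong[OF eq, of y] by (simp add: a_def)
    show "z = z'"
    proof
      fix x show "z x = z' x"
        using fun_cong[OF eq, of x] l zy[OF z(1)] zy[OF z(2)] by (cases "x = y") (auto simp: a_def)
    qed
  qed
  have lam0: "\<kappa> z = 0" if "z \<in> closed_simplex \<tau>" "\<not> ?\<rho> \<subseteq> \<tau>" for z \<tau>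
  proof -
    from that(2) obtain x where "x \<in> ?\<rho>" "x \<notin> \<tau>" by blast
    then show ?thesis using that by (intro lameq[of 0 z x]) (auto simp: closed_simplex_def)
  qed
  have aid: "a z = z" if "\<tau> \<in> K" "z \<in> closed_simplex \<tau>" "\<not> ?\<rho> \<subseteq> \<tau>" for z \<tau>
    using lam0[OF that(2,3)] zy[of z] that by (auto simp: a_def fun_eq_iff intro: underlyingI)
  have im1: "a z \<in> underlying ?L" if z: "z \<in> underlying K" for z
  proof -
    obtain \<tau> where \<tau>: "\<tau> \<in> K" "z \<in> closed_simplex \<tau>" using z by (auto simp: underlying_def)
    show ?thesis
    proof (cases "?\<rho> \<subseteq> \<tau>")
      case False
      then show ?thesis using aid[OF \<tau> False] \<tau> by (auto simp: stellar_def intro: underlyingI)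
    next
      case True
      obtain x0 where x0: "x0 \<in> ?\<rho>" "\<kappa> z * p x0 = z x0" using lamatt by blast
      have fin: "finite \<tau>" using simplicialD(1)[OF K \<tau>(1)] .
      have nnz: "0 \<le> z x" for x using \<tau> by (simp add: closed_simplex_def)
      have l0: "0 \<le> \<kappa> z" using x0 nnz[of x0] ppos[OF x0(1)] by (metis zero_le_mult_iff not_less)
      have "0 \<le> a z x" for x
        using l0 lam[of x z] nnz[of x] pz[of x] by (cases "x \<in> ?\<rho>") (auto simp: a_def)
      moreover have "a z x = 0" if "x \<notin> insert y (\<tau> - {x0})" for x
        using that x0 True \<tau>(2) pz[of x] by (cases "x = x0") (auto simp: a_def closed_simplex_def)
      moreover have "sum (a z) (insert y (\<tau> - {x0})) = 1"
      proof -
        have "sum (a z) (insert y (\<tau> - {x0})) = \<kappa> z + sum (\<lambda>x. z x - \<kappa> z * p x) (\<tau> - {x0})"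
        proof -
          have "a z x = z x - \<kappa> z * p x" if "x \<in> \<tau> - {x0}" for x
            using yt[OF \<tau>(1)] that by (metis DiffD1 a_def)
          then have "sum (a z) (\<tau> - {x0}) = sum (\<lambda>x. z x - \<kappa> z * p x) (\<tau> - {x0})"
            by (intro sum.cong) auto
          moreover have "a z y = \<kappa> z" by (simp add: a_def)
          ultimately show ?thesis using fin yt[OF \<tau>(1)] by simp
        qed
        also have "sum (\<lambda>x. z x - \<kappa> z * p x) (\<tau> - {x0}) = sum (\<lambda>x. z x - \<kappa> z * p x) \<tau>"
          using fin x0 True by (auto simp: sum_diff1)
        also have "\<dots> = sum z \<tau> - \<kappa> z * sum p \<tau>"
          by (simp add: sum_subtractf sum_distrib_left)
        also have "sum p \<tau> = sum p ?\<rho>"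
          using fin True by (intro sum.mono_neutral_right) (auto simp: support_def)
        finally show ?thesis using \<rho>(4) \<tau>(2) by (simp add: closed_simplex_def)
      qed
      ultimately have "a z \<in> closed_simplex (insert y (\<tau> - {x0}))" by (simp add: closed_simplex_def)
      moreover have "insert y (\<tau> - {x0}) \<in> ?L"
      proof -
        have "(\<tau> - {x0}) \<union> ?\<rho> = \<tau>" using True x0 by blast
        then have "\<tau> - {x0} = {} \<or> \<tau> - {x0} \<in> {\<tau>\<in>K. \<tau> \<union> ?\<rho> \<in> K}"
          using simplicialD(3)[OF K \<tau>(1), of "\<tau> - {x0}"] \<tau>(1) by auto
        then have "insert y (\<tau> - {x0}) \<in> cone_over y {\<tau>\<in>K. \<tau> \<union> ?\<rho> \<in> K}"
          unfolding cone_over_def by auto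
        moreover have "\<not> ?\<rho> \<subseteq> insert y (\<tau> - {x0})" using x0(1) y\<rho> by blast
        ultimately show ?thesis unfolding stellar_def by blast
      qed
      ultimately show ?thesis by (rule underlyingI[rotated])
    qed
  qed
  have im2: "t \<in> a ` underlying K" if t: "t \<in> underlying ?L" for t
  proof -
    obtain \<tau> where \<tau>: "\<tau> \<in> ?L" "t \<in> closed_simplex \<tau>" using t by (auto simp: underlying_def)
    then have n\<rho>: "\<not> ?\<rho> \<subseteq> \<tau>" by (simp add: stellar_def)
    show ?thesis
    proof (cases "\<tau> \<in> K")
      case True
      then have "a t = t" "t \<in> underlying K" using aid[OF True \<tau>(2) n\<rho>] \<tau>(2) by (auto intro: underlyingI)
      then show ?thesis by (metis imageI)
    next
      case False
      then obtain \<tau>' where \<tau>': "\<tau> = insert y \<tau>'" "\<tau>' \<union> ?\<rho> \<in> K" "y \<notin> \<tau>'" "finite \<tau>'"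
      proof -
        have "\<tau> = {y} \<or> (\<exists>\<tau>'\<in>{\<tau>\<in>K. \<tau> \<union> ?\<rho> \<in> K}. \<tau> = insert y \<tau>')"
          using \<tau>(1) False by (auto simp: stellar_def cone_over_def)
        then show thesis using that[of "{}"] that \<rho>(1) yt simplicialD(1)[OF K] by auto
      qed
      have nn: "0 \<le> t x" for x using \<tau>(2) by (simp add: closed_simplex_def)
      \<comment> \<open>The inverse map spreads the weight at \<open>y\<close> over the support
        again, in the proportions given by \<open>p\<close>.\<close>
      define z where "z x = (if x = y then 0 else t x + t y * p x)" for x
      have "z \<in> closed_simplex (\<tau>' \<union> ?\<rho>)"
        unfolding closed_simplex_def mem_Collect_eq
      proof (intro conjI allI impI)
        show "0 \<le> z x" for x using nn \<rho>(5) by (simp add: z_def)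
        show "z x = 0" if "x \<notin> \<tau>' \<union> ?\<rho>" for x
          using that \<tau>(2) \<tau>'(1) pz[of x] by (auto simp: z_def closed_simplex_def)
        have "sum z (\<tau>' \<union> ?\<rho>) = (\<Sum>x\<in>\<tau>' \<union> ?\<rho>. t x + t y * p x)"
          using \<tau>'(3) y\<rho> by (intro sum.cong) (auto simp: z_def)
        also have "\<dots> = sum t (\<tau>' \<union> ?\<rho>) + t y * sum p (\<tau>' \<union> ?\<rho>)"
          by (simp add: sum.distrib sum_distrib_left)
        also have "sum t (\<tau>' \<union> ?\<rho>) = sum t \<tau>'"
          using \<tau>'(3,4) \<rho>(2) \<tau>(2) \<tau>'(1) y\<rho> by (intro sum.mono_neutral_right) (auto simp: closed_simplex_def)
        also have "sum p (\<tau>' \<union> ?\<rho>) = sum p ?\<rho>"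
          using \<tau>'(4) \<rho>(2) by (intro sum.mono_neutral_right) (auto simp: support_def)
        also have "sum t \<tau>' + t y * sum p ?\<rho> = sum t (insert y \<tau>')"
          using \<tau>'(3,4) \<rho>(4) by simp
        also have "\<dots> = 1" using \<tau>(2) \<tau>'(1) by (simp add: closed_simplex_def)
        finally show "sum z (\<tau>' \<union> ?\<rho>) = 1" .
      qed
      then have zK: "z \<in> underlying K" using \<tau>'(2) by (blast intro: underlyingI)
      obtain x0 where "x0 \<in> ?\<rho>" "x0 \<notin> \<tau>" using n\<rho> by blast
      then have "\<kappa> z = t y"
        using nn y\<rho> \<tau>(2) by (intro lameq[of "t y" z x0]) (auto simp: z_def closed_simplex_def)
      then have "a z = t" by (auto simp: a_def z_def fun_eq_iff)
      then show ?thesis using zK by (metis imageI)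
    qed
  qed
  have "\<kappa> p = 1"
  proof -
    obtain x0 where "x0 \<in> ?\<rho>" using \<rho>(3) by blast
    then show ?thesis by (intro lameq[of 1 p x0]) auto
  qed
  then have "a p = vertex_point y" using y\<rho> by (auto simp: a_def vertex_point_def fun_eq_iff)
  moreover have "compact_space (top_of_set (underlying K))"
    using compactin_underlying[OF K] by (simp add: compact_space_subtopology)
  then have "compact_emb (top_of_set (underlying K)) a (underlying ?L)"
    unfolding compact_emb_def using cont inj im1 im2 by auto
  ultimately show ?thesis by blast
qed

text \<open>The spheres hang at a vertex \<open>q\<close> of the support of \<open>f x\<close>,
  while the wedge is based at \<open>f x\<close>. The star of the support is a cone with apex
  \<open>q\<close>, so coning it off with a fresh \<open>y\<close> is harmless, and the spheres can
  move along the edge from \<open>q\<close> to \<open>y\<close>. Deleting the open star of the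
  support then leaves its stellar subdivision, in which \<open>y\<close> is the point
  \<open>f x\<close>. The rest is an embedding of the wedge onto the resulting union.\<close>

lemma bouquet_homotopy_equivalent_wedge:
  fixes K :: "'a set set" and \<Delta> :: "nat \<Rightarrow> 'a set"
  assumes inf: "infinite (UNIV :: 'a set)" and K: "simplicial K"
    and f: "compact_emb X f (underlying K)" and x: "x \<in> topspace X" and q: "q \<in> support (f x)"
    and \<Delta>: "\<And>j. j < k + l \<Longrightarrow>
       finite (\<Delta> j) \<and> card (\<Delta> j) = (if j < k then Suc d else Suc d') \<and> \<Delta> j \<inter> \<Union>K = {}"
    and disj: "\<And>i j. i < k + l \<Longrightarrow> j < k + l \<Longrightarrow> i \<noteq> j \<Longrightarrow> \<Delta> i \<inter> \<Delta> j = {}"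
  shows "realization (K \<union> (\<Union>j<k+l. sphere_at q (\<Delta> j))) homotopy_equivalent_space
    wedge (wedge X x (sphere_wedge k d) None) None (sphere_wedge l d') None"
proof -
  let ?p = "f x"
  let ?\<rho> = "support ?p"
  let ?St = "{\<tau>\<in>K. \<tau> \<union> ?\<rho> \<in> K}"
  let ?S = "\<lambda>v. \<Union>j<k+l. sphere_at v (\<Delta> j)"
  have p: "?p \<in> underlying K" using f x by (auto simp: compact_emb_def)
  note \<rho> = support_in_complex[OF K p]
  have finU: "finite (\<Union>K \<union> (\<Union>j<k+l. \<Delta> j))"
    using simplicial_finite_vertices[OF K] \<Delta> by (simp only: finite_Un) auto
  obtain y where y: "y \<notin> \<Union>K \<union> (\<Union>j<k+l. \<Delta> j)" using ex_new_if_finite[OF inf finU] by blast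
  let ?Z = "K \<union> cone_over y ?St"
  have qK: "q \<in> \<Union>K" using q \<rho>(1) by blast
  have yq: "y \<noteq> q" using qK y by blast
  have St: "simplicial ?St"
  proof (rule simplicial_subset[OF K])
    fix \<tau> \<sigma> assume "\<tau> \<in> ?St" "\<sigma> \<subseteq> \<tau>" "\<sigma> \<noteq> {}"
    moreover from this have "\<sigma> \<union> ?\<rho> \<in> K" using simplicialD(3)[OF K, of "\<tau> \<union> ?\<rho>" "\<sigma> \<union> ?\<rho>"] by blast
    ultimately show "\<sigma> \<in> ?St" using simplicialD(3)[OF K] by blast
  qed blast
  have "{q} \<in> ?St"
    using simplicialD(3)[OF K \<rho>(1), of "{q}"] q \<rho>(1) by (simp add: insert_absorb)
  moreover have "insert q \<tau> \<in> ?St" if "\<tau> \<in> ?St" for \<tau>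
  proof -
    have "insert q \<tau> \<union> ?\<rho> = \<tau> \<union> ?\<rho>" using q by auto
    moreover have "insert q \<tau> \<in> K"
      using simplicialD(3)[OF K, of "\<tau> \<union> ?\<rho>" "insert q \<tau>"] that q by auto
    ultimately show ?thesis using that by auto
  qed
  ultimately have colSt: "collapsible ?St" by (rule collapsible.cone)
  have sS: "simplicial (?S v)" for v using \<Delta> by (intro simplicial_UN simplicial_sphere_at) auto
  have sZ: "simplicial ?Z" using simplicial_cone_over[OF K St] by blast
  have UZ: "\<Union>?Z \<subseteq> insert y (\<Union>K)" by (auto simp: cone_over_def)
  have \<Delta>Z: "finite (\<Delta> j) \<and> \<Delta> j \<noteq> {} \<and> \<Delta> j \<inter> \<Union>?Z = {}" if "j \<in> {..<k+l}" for j
  proof (intro conjI)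
    have j: "j < k + l" using that by simp
    show "finite (\<Delta> j)" using \<Delta>[OF j] by blast
    show "\<Delta> j \<noteq> {}" using \<Delta>[OF j] by (auto split: if_splits)
    have "y \<notin> \<Delta> j" using y j by blast
    have "\<Delta> j \<inter> \<Union>?Z \<subseteq> \<Delta> j \<inter> insert y (\<Union>K)" by (rule Int_mono[OF order_refl UZ])
    also have "\<dots> = {}" using \<open>y \<notin> \<Delta> j\<close> \<Delta>[OF j] by simp
    finally show "\<Delta> j \<inter> \<Union>?Z = {}" by (rule subset_antisym[OF _ empty_subsetI])
  qed
  have "realization (?Z \<union> ?S q) homotopy_equivalent_space realization (K \<union> ?S q)"
  proof -
    have "y \<notin> \<Union>(K \<union> ?S q)" using y yq by (auto simp: sphere_at_def)
    then have "collapse (\<lambda>\<sigma>. y \<in> \<sigma>) ((K \<union> ?S q) \<union> cone_over y ?St) (K \<union> ?S q)"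
      by (intro collapse_cone[OF colSt]) auto
    moreover have "(K \<union> ?S q) \<union> cone_over y ?St = ?Z \<union> ?S q" by blast
    ultimately show ?thesis
      using collapse_homotopy_equivalent[of "\<lambda>\<sigma>. y \<in> \<sigma>" "?Z \<union> ?S q" "K \<union> ?S q"] simplicial_Un[OF sZ sS] by simp
  qed
  then have "realization (K \<union> ?S q) homotopy_equivalent_space realization (?Z \<union> ?S q)"
    by (rule homotopy_equivalent_space_sym[THEN iffD1])
  also have "realization (?Z \<union> ?S q) homotopy_equivalent_space realization (?Z \<union> ?S y)"
  proof (rule sphere_move_family[OF _ sZ])
    show "{q, y} \<in> ?Z" using \<open>{q} \<in> ?St\<close> by (auto simp: cone_over_def insert_commute)
    show "\<And>j. j \<in> {..<k+l} \<Longrightarrow> finite (\<Delta> j) \<and> \<Delta> j \<noteq> {} \<and> \<Delta> j \<inter> \<Union>?Z = {}" by (rule \<Delta>Z)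
  qed (use yq disj in auto)
  also have "realization (?Z \<union> ?S y) homotopy_equivalent_space realization (stellar K ?\<rho> y \<union> ?S y)"
  proof -
    have y\<rho>: "y \<notin> ?\<rho>" using \<rho>(1) y by blast
    have nS: "\<not> ?\<rho> \<subseteq> \<tau>" if "\<tau> \<in> ?S y" for \<tau>
    proof
      assume "?\<rho> \<subseteq> \<tau>"
      then have "q \<in> insert y (\<Union>j<k+l. \<Delta> j)" using q that by (auto simp: sphere_at_def)
      then show False using yq qK \<Delta> by blast
    qed
    \<comment> \<open>Every simplex containing the support is in its star, which \<open>y\<close>
      cones off entirely; so \<open>y\<close> is an apex for the support.\<close>
    have "insert y \<tau> \<in> ?Z" if "\<tau> \<in> ?Z" "?\<rho> \<subseteq> \<tau>" for \<tau>
    proof (cases "\<tau> \<in> K")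
      case True
      then have "\<tau> \<in> ?St" using that(2) by (simp add: Un_absorb2)
      then show ?thesis by (auto simp: cone_over_def)
    next
      case False
      then have "y \<in> \<tau>" using that(1) by (auto simp: cone_over_def)
      then show ?thesis using that(1) by (simp add: insert_absorb)
    qed
    then have "free_face (?Z \<union> ?S y) ?\<rho> y"
      using \<rho>(2) y\<rho> nS unfolding free_face_def by (intro conjI ballI impI) blast+
    from free_face_homotopy_equivalent[OF simplicial_Un[OF sZ sS] this \<rho>(3)]
    have "realization (?Z \<union> ?S y) homotopy_equivalent_space
      realization {\<tau> \<in> ?Z \<union> ?S y. \<not> ?\<rho> \<subseteq> \<tau>}" .
    moreover have "{\<tau> \<in> ?Z \<union> ?S y. \<not> ?\<rho> \<subseteq> \<tau>} = stellar K ?\<rho> y \<union> ?S y"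
      using nS unfolding stellar_def by blast
    ultimately show ?thesis by simp
  qed
  also have "realization (stellar K ?\<rho> y \<union> ?S y) homotopy_equivalent_space
    wedge (wedge X x (sphere_wedge k d) None) None (sphere_wedge l d') None"
  proof -
    let ?e = "vertex_point y"
    let ?L = "stellar K ?\<rho> y"
    have yK: "y \<notin> \<Union>K" using y by blast
    obtain a where a: "compact_emb (top_of_set (underlying K)) a (underlying ?L)" "a ?p = ?e"
      using compact_emb_stellar[OF K p yK] by blast
    have af: "compact_emb X (a \<circ> f) (underlying ?L)"
    proof -
      have "continuous_map X (top_of_set (underlying K)) f"
        using f by (auto simp: compact_emb_def continuous_map_in_subtopology)
      then have "continuous_map X euclidean (a \<circ> f)"
        using a continuous_map_compose unfolding compact_emb_def by blast
      moreover have "inj_on (a \<circ> f) (topspace X)"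
        using f a by (auto simp: compact_emb_def intro!: comp_inj_on)
      moreover have "(a \<circ> f) ` topspace X = underlying ?L"
        using f a(1) unfolding compact_emb_def image_comp[symmetric] by simp
      moreover have "compact_space X" using f by (simp add: compact_emb_def)
      ultimately show ?thesis unfolding compact_emb_def by blast
    qed
    have sph: "\<exists>b. compact_emb (nsphere (if j < k then d else d')) b (underlying (sphere_at y (\<Delta> j))) \<and>
        b nsphere_base = ?e" if "j < k + l" for j
      using \<Delta>[OF that] y that by (intro compact_emb_nsphere) auto
    have inter: "underlying (sphere_at y (\<Delta> i)) \<inter> underlying (sphere_at y (\<Delta> j)) \<subseteq> {?e}"
      if "i < k + l" "j < k + l" "i \<noteq> j" for i j
      using disj[OF that] by (intro underlying_Int_vertex) (auto simp: sphere_at_def)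
    have interL: "underlying ?L \<inter> underlying (sphere_at y (\<Delta> j)) \<subseteq> {?e}" if "j < k + l" for j
    proof (rule underlying_Int_vertex)
      have "\<Union>?L \<subseteq> insert y (\<Union>K)" using UZ by (auto simp: stellar_def)
      then show "\<Union>?L \<inter> \<Union>(sphere_at y (\<Delta> j)) \<subseteq> {y}"
        using \<Delta>[OF that] by (auto simp: sphere_at_def)
    qed
    let ?T1 = "insert ?e (\<Union>j<k. underlying (sphere_at y (\<Delta> j)))"
    let ?T2 = "insert ?e (\<Union>j<l. underlying (sphere_at y (\<Delta> (k + j))))"
    have "\<exists>h. compact_emb (sphere_wedge k d) h ?T1 \<and> h None = ?e"
    proof -
      have "\<forall>j. \<exists>b. j < k \<longrightarrow> compact_emb (nsphere d) b (underlying (sphere_at y (\<Delta> j))) \<and> b nsphere_base = ?e"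
        using sph by (metis trans_less_add1)
      then obtain b where "\<forall>j. j < k \<longrightarrow>
          compact_emb (nsphere d) (b j) (underlying (sphere_at y (\<Delta> j))) \<and> b j nsphere_base = ?e"
        by metis
      then show ?thesis using inter by (intro compact_emb_sphere_wedge[of k d b]) auto
    qed
    then obtain h1 where h1: "compact_emb (sphere_wedge k d) h1 ?T1" "h1 None = ?e" by blast
    have "\<exists>h. compact_emb (sphere_wedge l d') h ?T2 \<and> h None = ?e"
    proof -
      have "\<forall>j. \<exists>b. j < l \<longrightarrow> compact_emb (nsphere d') b (underlying (sphere_at y (\<Delta> (k + j)))) \<and> b nsphere_base = ?e"
        using sph by (metis add_less_cancel_left not_add_less1)
      then obtain b where "\<forall>j. j < l \<longrightarrow>
          compact_emb (nsphere d') (b j) (underlying (sphere_at y (\<Delta> (k + j)))) \<and> b j nsphere_base = ?e"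
        by metis
      then show ?thesis using inter by (intro compact_emb_sphere_wedge[of l d' b]) auto
    qed
    then obtain h2 where h2: "compact_emb (sphere_wedge l d') h2 ?T2" "h2 None = ?e" by blast
    have "underlying ?L \<inter> ?T1 \<subseteq> {?e}"
    proof
      fix t assume t: "t \<in> underlying ?L \<inter> ?T1"
      show "t \<in> {?e}"
      proof (cases "t = ?e")
        case False
        then obtain j where "j < k" "t \<in> underlying (sphere_at y (\<Delta> j))" using t by blast
        then show ?thesis using interL[of j] t by auto
      qed simp
    qed
    from compact_emb_wedge[OF af h1(1) x _ None_in_sphere_wedge h1(2) this] a(2)
    obtain h3 where h3: "compact_emb (wedge X x (sphere_wedge k d) None) h3 (underlying ?L \<union> ?T1)" "h3 None = ?e"
        "None \<in> topspace (wedge X x (sphere_wedge k d) None)"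
      by auto
    have "(underlying ?L \<union> ?T1) \<inter> ?T2 \<subseteq> {?e}"
    proof
      fix t assume t: "t \<in> (underlying ?L \<union> ?T1) \<inter> ?T2"
      show "t \<in> {?e}"
      proof (cases "t = ?e")
        case False
        then obtain j where j: "j < l" "t \<in> underlying (sphere_at y (\<Delta> (k + j)))" using t by blast
        show ?thesis
        proof (cases "t \<in> underlying ?L")
          case True
          then show ?thesis using interL[of "k + j"] j by auto
        next
          case F: False
          then obtain i where "i < k" "t \<in> underlying (sphere_at y (\<Delta> i))" using t False by blast
          then show ?thesis using inter[of i "k + j"] j by auto
        qed
      qed simp
    qed
    from compact_emb_wedge[OF h3(1) h2(1) h3(3,2) None_in_sphere_wedge h2(2) this]
    obtain h4 where h4: "compact_emb (wedge (wedge X x (sphere_wedge k d) None) None (sphere_wedge l d') None) h4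
        (underlying ?L \<union> ?T1 \<union> ?T2)"
      by blast
    have eL: "?e \<in> underlying ?L"
      using af a(2) x unfolding compact_emb_def by (metis comp_apply imageI)
    have sL: "simplicial (?L \<union> ?S y)"
      using simplicial_deletion[OF sZ] sS by (intro simplicial_Un) (auto simp: stellar_def)
    have "{..<k+l} = {..<k} \<union> (+) k ` {..<l}"
      by (auto simp: image_iff Bex_def) presburger
    then have "underlying (?L \<union> ?S y) = underlying ?L \<union> ?T1 \<union> ?T2"
      using eL by (simp add: underlying_Un underlying_UN) blast
    then have "realization (?L \<union> ?S y) = top_of_set (underlying ?L \<union> ?T1 \<union> ?T2)"
      using realization_eq[OF sL] by simp
    then show ?thesis
      using compact_emb_homeomorphic[OF h4] homeomorphic_imp_homotopy_equivalent_space
        homotopy_equivalent_space_sym by metis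
  qed
  finally show ?thesis .
qed

section \<open>Relabelling vertices by an involution\<close>

lemma simplicial_relabel:
  assumes "simplicial K"
  shows "simplicial ((`) \<phi> ` K)"
  unfolding simplicial_def
proof (intro conjI ballI allI impI)
  show "finite ((`) \<phi> ` K)" using assms unfolding simplicial_def by blast
  fix \<tau> assume "\<tau> \<in> (`) \<phi> ` K"
  then obtain \<sigma> where \<sigma>: "\<sigma> \<in> K" "\<tau> = \<phi> ` \<sigma>" by blast
  then show "finite \<tau>" "\<tau> \<noteq> {}" using simplicialD(1,2)[OF assms \<sigma>(1)] by simp_all
  fix \<rho> assume \<rho>: "\<rho> \<subseteq> \<tau> \<and> \<rho> \<noteq> {}"
  then obtain \<sigma>' where "\<sigma>' \<subseteq> \<sigma>" "\<rho> = \<phi> ` \<sigma>'" using \<sigma> by (metis subset_image_iff)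
  then show "\<rho> \<in> (`) \<phi> ` K" using \<rho> simplicialD(3)[OF assms \<sigma>(1), of \<sigma>'] by blast
qed

text \<open>For an involution the barycentric coordinates of the image are obtained by composing
  with \<open>\<phi>\<close> itself.\<close>

lemma compact_emb_relabel:
  fixes \<phi> :: "'a \<Rightarrow> 'a"
  assumes K: "simplicial K" and \<phi>: "\<And>x. \<phi> (\<phi> x) = x"
  shows "compact_emb (realization K) (\<lambda>t. t \<circ> \<phi>) (underlying ((`) \<phi> ` K))"
proof -
  have inj: "inj_on \<phi> S" for S by (metis \<phi> inj_onI)
  have "t \<circ> \<phi> \<in> closed_simplex (\<phi> ` \<sigma>)" if t: "t \<in> closed_simplex \<sigma>" for t \<sigma>
  proof -
    have "sum (t \<circ> \<phi>) (\<phi> ` \<sigma>) = sum t \<sigma>"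
      by (subst sum.reindex[OF inj]) (simp add: \<phi>)
    moreover have "(t \<circ> \<phi>) x = 0" if "x \<notin> \<phi> ` \<sigma>" for x
    proof -
      have "\<phi> x \<notin> \<sigma>" using that \<phi> by (metis imageI)
      then show ?thesis using t by (simp add: closed_simplex_def)
    qed
    ultimately show ?thesis using t by (simp add: closed_simplex_def)
  qed
  note sub = this
  have "(\<lambda>t. t \<circ> \<phi>) ` underlying K = underlying ((`) \<phi> ` K)"
  proof (intro subset_antisym subsetI)
    fix t assume "t \<in> (\<lambda>t. t \<circ> \<phi>) ` underlying K"
    then show "t \<in> underlying ((`) \<phi> ` K)" using sub unfolding underlying_def by blast
  next
    fix t assume "t \<in> underlying ((`) \<phi> ` K)"
    then obtain \<sigma> where \<sigma>: "\<sigma> \<in> K" "t \<in> closed_simplex (\<phi> ` \<sigma>)" unfolding underlying_def by blast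
    have "\<phi> ` \<phi> ` \<sigma> = \<sigma>" by (simp add: image_image \<phi>)
    then have "t \<circ> \<phi> \<in> underlying K" using sub[OF \<sigma>(2)] \<sigma>(1) by (metis underlyingI)
    moreover have "t = (t \<circ> \<phi>) \<circ> \<phi>" by (simp add: fun_eq_iff \<phi>)
    ultimately show "t \<in> (\<lambda>t. t \<circ> \<phi>) ` underlying K" by blast
  qed
  moreover have "inj_on (\<lambda>t::'a \<Rightarrow> real. t \<circ> \<phi>) S" for S
    by (rule inj_onI) (metis (no_types, lifting) \<phi> comp_apply ext)
  moreover have "continuous_on (underlying K) (\<lambda>t. t \<circ> \<phi>)"
    unfolding o_def by (intro continuous_on_coordinatewise_then_product continuous_on_coordinate)
  ultimately show ?thesis
    unfolding compact_emb_def realization_eq[OF K]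
    using compactin_underlying[OF K] by (simp add: compact_space_subtopology)
qed

text \<open>The distance hypotheses say that, in the graph of distances at most 3, two points of the
  octahedron are non-adjacent exactly if they are complementary in \<open>U\<close>.\<close>

lemma octahedron_boundary:
  fixes U :: "nat set" and P :: "nat set set"
  assumes U: "finite U" "4 \<le> card U" and P: "P \<subseteq> Pow U" "{} \<in> P"
    and dist: "\<And>D E. D \<in> P \<Longrightarrow> E \<in> P \<Longrightarrow> D \<noteq> E \<Longrightarrow>
       card (sym_diff D E) \<le> 3 \<and> card U \<le> 3 + card (sym_diff D E)"
  shows "\<exists>B. simplicial B \<and> collapsible B \<and> {U} \<in> B \<and> (\<forall>\<rho>. \<rho> \<subset> P \<and> \<rho> \<noteq> {} \<longrightarrow> \<rho> \<in> B) \<and>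
    (\<forall>\<tau>\<in>B. \<tau> \<subseteq> P \<union> (\<lambda>D. U - D) ` P \<and> \<tau> \<noteq> {} \<and> \<not> P \<subseteq> \<tau> \<and> (\<forall>D\<in>\<tau>. \<forall>E\<in>\<tau>. card (sym_diff D E) \<le> 3))"
proof -
  let ?\<alpha> = "\<lambda>D. U - D"
  define B where "B = {\<tau>. \<tau> \<noteq> {} \<and> \<tau> \<subseteq> P \<union> ?\<alpha> ` P \<and> (\<forall>p\<in>P. p \<notin> \<tau> \<or> ?\<alpha> p \<notin> \<tau>) \<and> \<not> P \<subseteq> \<tau>}"
  have finP: "finite P" using P(1) U(1) by (metis finite_Pow_iff finite_subset)
  have PU: "D \<subseteq> U" if "D \<in> P" for D using P(1) that by blast
  have Une: "U \<noteq> {}" using U by auto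
  have compl: "sym_diff D (U - D) = U" if "D \<subseteq> U" for D using that by blast
  \<comment> \<open>Complementary sets in \<open>U\<close> are at distance \<open>card U\<close>,
    which is at least 4, so no two members of \<open>P\<close> are complementary.\<close>
  have \<alpha>P: "?\<alpha> ` P \<inter> P = {}"
  proof -
    have False if "D \<in> P" "U - D \<in> P" for D
    proof -
      have "D \<noteq> U - D" using Une PU[OF that(1)] by blast
      then have "card (sym_diff D (U - D)) \<le> 3" using dist that by blast
      then show False using compl[OF PU[OF that(1)]] U(2) by simp
    qed
    then show ?thesis by blast
  qed
  have inj: "inj_on ?\<alpha> P" by (rule inj_onI) (metis PU double_diff order_refl)
  have "collapsible B" unfolding B_def
    using P(2) by (intro collapsible_octahedron finP \<alpha>P inj) auto
  moreover have "simplicial B"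
    unfolding simplicial_def
  proof (intro conjI ballI allI impI)
    show "finite B" by (rule finite_subset[of _ "Pow (P \<union> ?\<alpha> ` P)"]) (use finP in \<open>auto simp: B_def\<close>)
    fix \<tau> assume \<tau>: "\<tau> \<in> B"
    then show "\<tau> \<noteq> {}" by (simp add: B_def)
    show "finite \<tau>" using \<tau> finP by (auto simp: B_def intro: finite_subset)
    show "\<rho> \<in> B" if "\<rho> \<subseteq> \<tau> \<and> \<rho> \<noteq> {}" for \<rho> using \<tau> that unfolding B_def by blast
  qed
  moreover have "{U} \<in> B"
  proof -
    have "U = ?\<alpha> {}" by simp
    then have "U \<in> ?\<alpha> ` P" using P(2) by blast
    moreover from this have "U \<notin> P" using \<alpha>P by blast
    ultimately show ?thesis using P(2) Une unfolding B_def by blast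
  qed
  moreover have "\<rho> \<in> B" if "\<rho> \<subset> P" "\<rho> \<noteq> {}" for \<rho>
    using that \<alpha>P unfolding B_def by blast
  moreover have "card (sym_diff D E) \<le> 3" if \<tau>: "\<tau> \<in> B" "D \<in> \<tau>" "E \<in> \<tau>" for \<tau> D E
  proof -
    \<comment> \<open>Replacing \<open>E\<close> by its complement turns the distance
      \<open>d\<close> into \<open>card U - d\<close>; this is what the lower bound in
      \<open>dist\<close> is for.\<close>
    have main: "card (sym_diff D (U - E)) \<le> 3" if "D \<in> P" "E \<in> P" "D \<noteq> E" for D E
    proof -
      have "sym_diff D (U - E) = U - sym_diff D E" using PU that by blast
      moreover have "card (U - sym_diff D E) = card U - card (sym_diff D E)"
        using PU that U(1) by (intro card_Diff_subset) (auto intro: finite_subset)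
      ultimately have "card (sym_diff D (U - E)) = card U - card (sym_diff D E)" by (simp only:)
      then show ?thesis using dist[OF that] by arith
    qed
    have PP: "card (sym_diff D E) \<le> 3" if "D \<in> P" "E \<in> P" for D E
      using dist[OF that] by (cases "D = E") auto
    have "D \<in> P \<union> ?\<alpha> ` P" "E \<in> P \<union> ?\<alpha> ` P" using \<tau> by (auto simp: B_def)
    then consider "D \<in> P" "E \<in> P" | E' where "D \<in> P" "E' \<in> P" "E = U - E'"
      | D' where "D' \<in> P" "E \<in> P" "D = U - D'" | D' E' where "D' \<in> P" "E' \<in> P" "D = U - D'" "E = U - E'"
      by blast
    then show ?thesis
    proof cases
      case 1
      then show ?thesis by (rule PP)
    next
      case (2 E')
      then have "D \<noteq> E'" using \<tau> unfolding B_def by blast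
      then show ?thesis using main 2 by blast
    next
      case (3 D')
      then have "E \<noteq> D'" using \<tau> unfolding B_def by blast
      then have "card (sym_diff E (U - D')) \<le> 3" using main 3 by blast
      then show ?thesis using 3 by (simp add: Un_commute)
    next
      case (4 D' E')
      then have "sym_diff D E = sym_diff D' E'" using PU by blast
      then show ?thesis using PP 4 by simp
    qed
  qed
  ultimately show ?thesis by (intro exI[of _ B]) (auto simp: B_def)
qed

section \<open>The order on subsets\<close>

lemma set_prec_asym: "set_prec A B \<Longrightarrow> \<not> set_prec B A"
  unfolding set_prec_def by (metis linorder_neqE_nat not_less_iff_gr_or_eq)

lemma sorted_list_of_set_Un:
  fixes X Y :: "nat set"
  assumes "finite X" "finite Y" "\<And>x y. x \<in> X \<Longrightarrow> y \<in> Y \<Longrightarrow> x < y"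
  shows "sorted_list_of_set (X \<union> Y) = sorted_list_of_set X @ sorted_list_of_set Y"
proof (rule sorted_distinct_set_unique)
  show "sorted (sorted_list_of_set X @ sorted_list_of_set Y)"
    using assms by (auto simp: sorted_append intro: less_imp_le)
  show "distinct (sorted_list_of_set X @ sorted_list_of_set Y)"
    using assms by fastforce
qed (use assms in auto)

text \<open>The sorted lists agree on the elements below \<open>b\<close>; in the next position
  \<open>b\<close> competes with the least element of \<open>A\<close> above \<open>b\<close>, which
  exists because \<open>b < r\<close>.\<close>

lemma set_prec_exchange:
  assumes "finite A" "r \<in> A" "b \<notin> A" "b < r"
  shows "set_prec (insert b (A - {r})) A"
proof -
  let ?C = "{a\<in>A. a < b}" and ?Y = "{a\<in>A. b < a}"
  let ?S = "insert b (A - {r})"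
  have S: "?S = ?C \<union> ({b} \<union> (?Y - {r}))" and A: "A = ?C \<union> ?Y"
  proof -
    have "a < b \<or> b < a" if "a \<in> A" for a using assms(3) that by (metis linorder_neqE_nat)
    then show "?S = ?C \<union> ({b} \<union> (?Y - {r}))" "A = ?C \<union> ?Y" using assms(4) by auto
  qed
  have "sorted_list_of_set ?S = sorted_list_of_set ?C @ sorted_list_of_set ({b} \<union> (?Y - {r}))"
    unfolding S using assms by (intro sorted_list_of_set_Un) auto
  also have "sorted_list_of_set ({b} \<union> (?Y - {r})) = sorted_list_of_set {b} @ sorted_list_of_set (?Y - {r})"
    using assms by (intro sorted_list_of_set_Un) auto
  finally have lS: "sorted_list_of_set ?S = sorted_list_of_set ?C @ b # sorted_list_of_set (?Y - {r})"
    by simp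
  have lA: "sorted_list_of_set A = sorted_list_of_set ?C @ sorted_list_of_set ?Y"
    by (subst A, rule sorted_list_of_set_Un) (use assms in auto)
  have card: "card ?S = card A"
    using assms card.remove[OF assms(1,2)] by (metis DiffD1 card_insert_disjoint finite_Diff)
  let ?k = "length (sorted_list_of_set ?C)"
  have len: "length (sorted_list_of_set ?S) = card ?S" by (rule length_sorted_list_of_set)
  have "sorted_list_of_set ?Y ! 0 \<in> set (sorted_list_of_set ?Y)"
    using assms by (intro nth_mem) (auto simp: card_gt_0_iff)
  then have "b < sorted_list_of_set ?Y ! 0" using assms(1) by simp
  then have "sorted_list_of_set ?S ! ?k < sorted_list_of_set A ! ?k"
    unfolding lS lA by (simp add: nth_append)
  moreover have "\<forall>l<?k. sorted_list_of_set ?S ! l = sorted_list_of_set A ! l"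
    unfolding lS lA by (simp add: nth_append)
  moreover have "?k < card ?S" using len unfolding lS by simp
  ultimately show ?thesis unfolding set_prec_def using card by blast
qed

section \<open>The link of the last vertex\<close>

text \<open>A subset \<open>S\<close> is represented by its difference \<open>D = sym_diff A S\<close>, so that the vertex \<open>A\<close>
  becomes \<open>{}\<close>.\<close>

lemma card_sym_diff_le_iff:
  assumes "finite D" "finite E"
  shows "card (sym_diff D E) \<le> 3 \<longleftrightarrow> card D + card E \<le> 3 + 2 * card (D \<inter> E)"
proof -
  have "card (sym_diff D E) = card (D - E) + card (E - D)"
    using assms by (intro card_Un_disjoint) auto
  moreover have "card D = card (D \<inter> E) + card (D - E)"
    using assms(1) by (metis Int_Diff_Un Int_Diff_disjoint card_Un_disjoint finite_Diff finite_Int)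
  moreover have "card E = card (D \<inter> E) + card (E - D)"
    using assms(2) by (metis Int_Diff_Un Int_Diff_disjoint Int_commute card_Un_disjoint finite_Diff finite_Int)
  ultimately show ?thesis by linarith
qed

lemma adj_single:
  assumes "finite E"
  shows "card (sym_diff {x} E) \<le> 3 \<longleftrightarrow> card E \<le> 2 + 2 * of_bool (x \<in> E)"
  using assms by (simp add: card_sym_diff_le_iff)

lemma adj_pair:
  assumes "finite E" "x \<noteq> y"
  shows "card (sym_diff {x,y} E) \<le> 3 \<longleftrightarrow> card E \<le> 1 + 2 * (of_bool (x \<in> E) + of_bool (y \<in> E))"
  using assms by (auto simp: card_sym_diff_le_iff Int_insert_left)

lemma adj_triple:
  assumes "finite E" "x \<noteq> y" "x \<noteq> z" "y \<noteq> z"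
  shows "card (sym_diff {x,y,z} E) \<le> 3 \<longleftrightarrow>
    card E \<le> 2 * (of_bool (x \<in> E) + of_bool (y \<in> E) + of_bool (z \<in> E))"
  using assms by (auto simp: card_sym_diff_le_iff Int_insert_left)

lemma card_two_le: "finite E \<Longrightarrow> x \<in> E \<Longrightarrow> y \<in> E \<Longrightarrow> x \<noteq> y \<Longrightarrow> 2 \<le> card E"
  using card_mono[of E "{x,y}"] by simp

lemma card_two_eq: "card E = 2 \<Longrightarrow> x \<in> E \<Longrightarrow> y \<in> E \<Longrightarrow> x \<noteq> y \<Longrightarrow> E = {x,y}"
  using card_subset_eq[of E "{x,y}"] by (metis card_2_iff insert_commute insert_iff singletonD)

lemma card_three_eq:
  assumes "card E = 3" "x \<in> E" "y \<in> E" "z \<in> E" "x \<noteq> y" "x \<noteq> z" "y \<noteq> z"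
  shows "E = {x,y,z}"
proof -
  have "finite E" using assms(1) card_ge_0_finite by force
  then show ?thesis using card_subset_eq[of E "{x,y,z}"] assms by simp
qed

definition tri :: "'a set \<Rightarrow> 'a set set" where
  "tri W = (\<lambda>w. W - {w}) ` W"

lemma Union_tri:
  assumes "2 \<le> card W"
  shows "\<Union>(tri W) = W"
proof
  show "W \<subseteq> \<Union>(tri W)"
  proof
    fix x assume "x \<in> W"
    have "W \<noteq> {x}" using assms by auto
    then obtain w where "w \<in> W" "w \<noteq> x" using \<open>x \<in> W\<close> by blast
    then show "x \<in> \<Union>(tri W)" using \<open>x \<in> W\<close> by (auto simp: tri_def)
  qed
qed (auto simp: tri_def)

definition btri :: "'a \<Rightarrow> 'a set \<Rightarrow> 'a set set" where
  "btri b S = (\<lambda>s. insert b (S - {s})) ` S"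

lemma btri_3: "x \<noteq> y \<Longrightarrow> x \<noteq> z \<Longrightarrow> y \<noteq> z \<Longrightarrow> btri b {x,y,z} = {{x,y,b},{x,z,b},{y,z,b}}"
  by (auto simp: btri_def)

lemma tri_4: "distinct [r,s,t,x] \<Longrightarrow> tri {r,s,t,x} = {{r,s,t},{r,s,x},{r,t,x},{s,t,x}}"
  by (auto simp: tri_def)

section \<open>Vertices and simplices in terms of differences with the last set\<close>

locale segment =
  fixes m :: nat and A :: "nat set"
  assumes A_sub: "A \<subseteq> {1..m}" and A_card: "4 \<le> card A"
begin

lemma fin_A: "finite A"
  using A_sub finite_subset by blast

definition h :: nat where "h = Max A"

lemma h_A: "h \<in> A"
  unfolding h_def using fin_A A_card by (intro Max_in) auto

lemma h_ge: "a \<in> A \<Longrightarrow> a \<le> h"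
  unfolding h_def using fin_A by simp

definition V :: "nat set set" where
  "V = {D. D \<subseteq> {1..m} \<and> sym_diff A D \<in> fam_preceq m A}"

lemma V_iff: "D \<in> V \<longleftrightarrow> D \<subseteq> {1..m} \<and> (D = {} \<or> set_prec (sym_diff A D) A)"
proof -
  have "sym_diff A D = A \<longleftrightarrow> D = {}" by blast
  moreover have "sym_diff A D \<subseteq> {1..m}" if "D \<subseteq> {1..m}" using A_sub that by blast
  ultimately show ?thesis by (auto simp: V_def fam_preceq_def fam_prec_def)
qed

lemma fin_V: "finite V"
  by (rule finite_subset[of _ "Pow {1..m}"]) (auto simp: V_def)

lemma empty_V: "{} \<in> V"
  by (simp add: V_iff)

lemma card_sym_diff_A:
  assumes "D \<subseteq> {1..m}"
  shows "card (sym_diff A D) + card (D \<inter> A) = card A + card (D - A)"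
proof -
  have "finite D" using assms finite_subset by blast
  then have "card (sym_diff A D) = card (A - D) + card (D - A)"
    using fin_A by (intro card_Un_disjoint) auto
  moreover have "card A = card (D \<inter> A) + card (A - D)"
    using fin_A by (metis Int_Diff_Un Int_Diff_disjoint Int_commute card_Un_disjoint finite_Diff finite_Int)
  ultimately show ?thesis by linarith
qed

text \<open>More elements are taken from \<open>A\<close> than are added to it, so the set
  represented by \<open>D\<close> is smaller than \<open>A\<close>.\<close>

lemma V_I:
  assumes "D \<subseteq> {1..m}" "card (D - A) < card (D \<inter> A)"
  shows "D \<in> V"
  using card_sym_diff_A[OF assms(1)] assms by (auto simp: V_iff set_prec_def)

lemma V_subset_A: "D \<subseteq> A \<Longrightarrow> D \<in> V"
proof (cases "D = {}")
  case False
  assume "D \<subseteq> A"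
  moreover from this have "finite D" using fin_A finite_subset by blast
  moreover from \<open>D \<subseteq> A\<close> have "D - A = {}" "D \<inter> A = D" by auto
  ultimately have "card (D - A) < card (D \<inter> A)" using False by (simp only:) (simp add: card_gt_0_iff)
  then show ?thesis using \<open>D \<subseteq> A\<close> A_sub by (intro V_I) blast+
qed (simp add: empty_V)

lemma V_exchange:
  assumes "r \<in> A" "b \<in> {1..m} - A" "b < r"
  shows "{r,b} \<in> V"
proof -
  have "sym_diff A {r,b} = insert b (A - {r})" using assms by auto
  moreover have "set_prec (insert b (A - {r})) A"
    using assms fin_A by (intro set_prec_exchange) auto
  moreover have "{r,b} \<subseteq> {1..m}" using assms A_sub by blast
  ultimately show ?thesis by (simp only: V_iff simp_thms)
qed

text \<open>Symmetric difference with \<open>A\<close> is an isometry, so the distances between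
  differences are the distances between the sets they represent.\<close>

definition K :: "nat set set set" where
  "K = {\<tau>. \<tau> \<noteq> {} \<and> \<tau> \<subseteq> V \<and> (\<forall>D\<in>\<tau>. \<forall>E\<in>\<tau>. card (sym_diff D E) \<le> 3)}"

lemma simplicial_K: "simplicial K"
  unfolding simplicial_def
proof (intro conjI ballI allI impI)
  show "finite K" by (rule finite_subset[of _ "Pow V"]) (use fin_V in \<open>auto simp: K_def\<close>)
  show "finite \<tau>" if "\<tau> \<in> K" for \<tau> using that fin_V finite_subset by (auto simp: K_def)
qed (auto simp: K_def)

text \<open>The stages of the collapse: the open stars of the faces in \<open>G\<close>, called
  patterns below, have been deleted.\<close>

definition KK :: "nat set set set \<Rightarrow> nat set set set" where
  "KK G = {\<tau>\<in>K. \<forall>\<sigma>\<in>G. \<not> \<sigma> \<subseteq> \<tau>}"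

lemma simplicial_KK: "simplicial (KK G)"
proof (rule simplicial_subset[OF simplicial_K])
  show "\<rho> \<in> KK G" if "\<tau> \<in> KK G" "\<rho> \<subseteq> \<tau>" "\<rho> \<noteq> {}" for \<tau> \<rho>
    using that simplicialD(3)[OF simplicial_K, of \<tau> \<rho>] by (auto simp: KK_def)
qed (auto simp: KK_def)

lemma K_D:
  assumes "\<tau> \<in> K" "D \<in> \<tau>" "E \<in> \<tau>"
  shows "D \<in> V" "card (sym_diff D E) \<le> 3"
  using assms by (auto simp: K_def)

lemma KK_K: "\<tau> \<in> KK G \<Longrightarrow> \<tau> \<in> K"
  by (simp add: KK_def)

lemma nbr:
  assumes "\<tau> \<in> K" "{} \<in> \<tau>" "E \<in> \<tau>" "E \<noteq> {}"
  shows "finite E" "E \<subseteq> {1..m}" "1 \<le> card E" "card E \<le> 3"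
proof -
  show "E \<subseteq> {1..m}" using K_D(1)[OF assms(1,3,3)] by (simp add: V_def)
  then show f: "finite E" using finite_subset by blast
  then show "1 \<le> card E" using assms(4) by (simp add: Suc_le_eq card_gt_0_iff)
  show "card E \<le> 3" using K_D(2)[OF assms(1,2,3)] by simp
qed

text \<open>As \<open>A\<close> is the last set, a neighbour cannot add more elements than it
  removes. With at most three changes this leaves at most one added element, and if one element is
  exchanged for one other, the lexicographic order forces the added one to be the smaller.\<close>

lemma nbr_cases [consumes 4, case_names inA triple pair]:
  assumes "\<tau> \<in> K" "{} \<in> \<tau>" "E \<in> \<tau>" "E \<noteq> {}"
  obtains "E \<subseteq> A"
  | x y b where "x \<in> A" "y \<in> A" "x \<noteq> y" "b \<in> {1..m} - A" "E = {x,y,b}"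
  | r b where "r \<in> A" "b \<in> {1..m} - A" "b < r" "E = {r,b}"
proof -
  note E = nbr[OF assms]
  have prec: "set_prec (sym_diff A E) A" using K_D(1)[OF assms(1,3,3)] assms(4) by (simp add: V_iff)
  then have le: "card (sym_diff A E) \<le> card A" by (auto simp: set_prec_def)
  have sum: "card E = card (E \<inter> A) + card (E - A)"
    using E(1) by (metis Int_Diff_Un Int_Diff_disjoint card_Un_disjoint finite_Diff finite_Int)
  have le': "card (E - A) \<le> card (E \<inter> A)" using card_sym_diff_A[OF E(2)] le by linarith
  consider "card (E - A) = 0" | "card (E - A) = 1" "card (E \<inter> A) = 2" | "card (E - A) = 1" "card (E \<inter> A) = 1"
    using sum le' E(4) by linarith
  then show thesis
  proof cases
    case 1
    then have "E \<subseteq> A" using E(1) by auto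
    then show thesis by (rule that(1))
  next
    case 2
    obtain b where b: "E - A = {b}" using 2(1) by (auto simp: card_1_singleton_iff)
    obtain x y where xy: "E \<inter> A = {x,y}" "x \<noteq> y" using 2(2) by (auto simp: card_2_iff)
    have "E = {x,y,b}" using b xy by blast
    then show thesis using b xy E(2) by (intro that(2)[of x y b]) auto
  next
    case 3
    obtain b where b: "E - A = {b}" using 3(1) by (auto simp: card_1_singleton_iff)
    obtain r where r: "E \<inter> A = {r}" using 3(2) by (auto simp: card_1_singleton_iff)
    have Erb: "E = {r,b}" using b r by blast
    have rA: "r \<in> A" and bA: "b \<notin> A" using b r by blast+
    have "b < r"
    proof (rule ccontr)
      assume "\<not> b < r"
      then have "r < b" using rA bA by (metis linorder_neqE_nat)
      \<comment> \<open>If \<open>r < b\<close>, then \<open>A\<close> arises from this set by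
        exchanging \<open>b\<close> for the smaller \<open>r\<close> and would precede it.\<close>
      let ?S = "insert b (A - {r})"
      have "A = insert r (?S - {b})" using rA bA by auto
      moreover have "set_prec (insert r (?S - {b})) ?S"
        using \<open>r < b\<close> fin_A by (intro set_prec_exchange) auto
      ultimately have "set_prec A ?S" by simp
      moreover have "sym_diff A E = ?S" using Erb rA bA by auto
      ultimately show False using prec set_prec_asym by metis
    qed
    then show thesis using b rA bA E(2) Erb by (intro that(3)[of r b]) auto
  qed
qed

lemma KK_not: "\<tau> \<in> KK G \<Longrightarrow> \<sigma> \<in> G \<Longrightarrow> \<not> \<sigma> \<subseteq> \<tau>"
  by (simp add: KK_def)

lemma insert_K:
  assumes "\<tau> \<in> K" "v \<in> V" "\<And>E. E \<in> \<tau> \<Longrightarrow> card (sym_diff v E) \<le> 3"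
  shows "insert v \<tau> \<in> K"
  using assms by (auto simp: K_def Un_commute)

text \<open>An apex \<open>v\<close> has to be adjacent to \<open>{}\<close>, hence
  \<open>card v \<le> 3\<close>, and to the other vertices. It must not complete a pattern of
  \<open>G\<close>, which would lead out of \<open>KK G\<close>, nor one of \<open>F\<close>, as
  \<open>collapse_family\<close> requires. Only patterns through \<open>v\<close> can be completed
  by it.\<close>

lemma collapse_KK:
  assumes F: "F \<subseteq> Pow (Pow {1..m})" "\<And>\<sigma>. \<sigma> \<in> F \<Longrightarrow> {} \<in> \<sigma>"
    and v: "\<And>\<sigma>. \<sigma> \<in> F \<Longrightarrow> \<exists>v\<in>V. card v \<le> 3 \<and> v \<notin> \<sigma> \<and>
      (\<forall>\<tau>\<in>KK G. \<sigma> \<subseteq> \<tau> \<longrightarrow> (\<forall>E\<in>\<tau>. E \<noteq> {} \<longrightarrow> card (sym_diff v E) \<le> 3) \<and>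
         (\<forall>\<sigma>'\<in>G \<union> F. v \<in> \<sigma>' \<longrightarrow> \<not> \<sigma>' \<subseteq> insert v \<tau>))"
  shows "collapse (\<lambda>\<sigma>. {} \<in> \<sigma>) (KK G) (KK (G \<union> F))"
proof -
  have "collapse (\<lambda>\<sigma>. {} \<in> \<sigma>) (KK G) {\<tau>\<in>KK G. \<forall>\<sigma>\<in>F. \<not> \<sigma> \<subseteq> \<tau>}"
  proof (rule collapse_family)
    show "finite F" using F(1) by (rule finite_subset) simp
    fix \<sigma> assume \<sigma>: "\<sigma> \<in> F"
    obtain v where v: "v \<in> V" "card v \<le> 3" "v \<notin> \<sigma>" and
      vv: "\<forall>\<tau>\<in>KK G. \<sigma> \<subseteq> \<tau> \<longrightarrow> (\<forall>E\<in>\<tau>. E \<noteq> {} \<longrightarrow> card (sym_diff v E) \<le> 3) \<and>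
         (\<forall>\<sigma>'\<in>G \<union> F. v \<in> \<sigma>' \<longrightarrow> \<not> \<sigma>' \<subseteq> insert v \<tau>)"
      using assms(3)[OF \<sigma>] by metis
    have *: "card (sym_diff v E) \<le> 3" if "\<tau> \<in> KK G" "\<sigma> \<subseteq> \<tau>" "E \<in> \<tau>" "E \<noteq> {}" for \<tau> E
      using vv that by blast
    have **: "\<not> \<sigma>' \<subseteq> insert v \<tau>" if "\<tau> \<in> KK G" "\<sigma> \<subseteq> \<tau>" "\<sigma>' \<in> G \<union> F" "v \<in> \<sigma>'" for \<tau> \<sigma>'
      using vv that by blast
    have new: "\<sigma>' \<subseteq> \<tau>" if "\<tau> \<in> KK G" "\<sigma> \<subseteq> \<tau>" "\<sigma>' \<in> G \<union> F" "\<sigma>' \<subseteq> insert v \<tau>" for \<tau> \<sigma>'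
      using **[OF that(1-3)] that(4) by blast
    have "insert v \<tau> \<in> KK G" if \<tau>: "\<tau> \<in> KK G" "\<sigma> \<subseteq> \<tau>" for \<tau>
    proof -
      have "insert v \<tau> \<in> K"
      proof (rule insert_K[OF KK_K[OF \<tau>(1)] v(1)])
        fix E assume "E \<in> \<tau>"
        then show "card (sym_diff v E) \<le> 3" using *[OF \<tau>] v(2) by (cases "E = {}") auto
      qed
      then show ?thesis using new[OF \<tau>] \<tau>(1) unfolding KK_def by blast
    qed
    moreover have "finite \<sigma>" using F(1) \<sigma> by (metis PowD finite_Pow_iff finite_atLeastAtMost finite_subset subsetD)
    ultimately show "{} \<in> \<sigma> \<and> finite \<sigma> \<and> (\<exists>v. v \<notin> \<sigma> \<and> (\<forall>\<tau>\<in>KK G. \<sigma> \<subseteq> \<tau> \<longrightarrow> insert v \<tau> \<in> KK G \<and>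
           (\<forall>\<sigma>'\<in>F. \<sigma>' \<subseteq> insert v \<tau> \<longrightarrow> \<sigma>' \<subseteq> \<tau>)))"
      using F(2)[OF \<sigma>] v(3) new by (intro conjI exI[of _ v] ballI impI) simp_all
  qed
  moreover have "{\<tau>\<in>KK G. \<forall>\<sigma>\<in>F. \<not> \<sigma> \<subseteq> \<tau>} = KK (G \<union> F)" by (auto simp: KK_def)
  ultimately show ?thesis by simp
qed

text \<open>By \<open>adj_triple\<close>, each of the three triples contains at least half of
  \<open>E\<close>. Without \<open>b\<close> this forces two of \<open>x\<close>, \<open>y\<close>,
  \<open>z\<close> into \<open>E\<close>, and all three if \<open>card E = 3\<close>. With
  \<open>b\<close>, a three-element \<open>E\<close> must contain two of them, while
  \<open>nbr_cases\<close> leaves only \<open>{w,b}\<close> with \<open>b < w\<close> as a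
  doubleton.\<close>

lemma btri_link:
  assumes \<tau>: "\<tau> \<in> K" "{} \<in> \<tau>" and S: "x \<in> A" "y \<in> A" "z \<in> A" "x \<noteq> y" "x \<noteq> z" "y \<noteq> z"
    and b: "b \<in> {1..m} - A" and sub: "{{x,y,b},{x,z,b},{y,z,b}} \<subseteq> \<tau>" and E: "E \<in> \<tau>" "E \<noteq> {}"
  shows "E \<in> {{x,y,b},{x,z,b},{y,z,b}} \<or> (\<exists>w\<in>A. b < w \<and> E = {w,b}) \<or> E \<in> {{x,y},{x,z},{y,z},{x,y,z}}"
proof -
  note n = nbr[OF \<tau> E]
  have d: "x \<noteq> b" "y \<noteq> b" "z \<noteq> b" using S b by auto
  have "card (sym_diff {x,y,b} E) \<le> 3" "card (sym_diff {x,z,b} E) \<le> 3" "card (sym_diff {y,z,b} E) \<le> 3"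
    using K_D(2)[OF \<tau>(1) _ E(1)] sub by blast+
  then have c: "card E \<le> 2 * (of_bool (x \<in> E) + of_bool (y \<in> E) + of_bool (b \<in> E))"
    "card E \<le> 2 * (of_bool (x \<in> E) + of_bool (z \<in> E) + of_bool (b \<in> E))"
    "card E \<le> 2 * (of_bool (y \<in> E) + of_bool (z \<in> E) + of_bool (b \<in> E))"
    using adj_triple[OF n(1)] S d by metis+
  show ?thesis
  proof (cases "b \<in> E")
    case True
    from \<tau> E show ?thesis
    proof (cases rule: nbr_cases)
      case inA
      then have False using True b by blast
      then show ?thesis ..
    next
      case (triple x' y' b')
      then have "x' \<noteq> b'" "y' \<noteq> b'" by auto
      then have "card E = 3" using triple by simp
      then have "(x \<in> E \<and> y \<in> E) \<or> (x \<in> E \<and> z \<in> E) \<or> (y \<in> E \<and> z \<in> E)"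
        using c True by (cases "x \<in> E"; cases "y \<in> E"; cases "z \<in> E"; simp)
      then have "E = {x,y,b} \<or> E = {x,z,b} \<or> E = {y,z,b}"
      proof (elim disjE conjE)
        assume "x \<in> E" "y \<in> E"
        then have "E = {x,y,b}" by (rule card_three_eq[OF \<open>card E = 3\<close> _ _ True S(4) d(1,2)])
        then show ?thesis ..
      next
        assume "x \<in> E" "z \<in> E"
        then have "E = {x,z,b}" by (rule card_three_eq[OF \<open>card E = 3\<close> _ _ True S(5) d(1,3)])
        then show ?thesis by (intro disjI2 disjI1)
      next
        assume "y \<in> E" "z \<in> E"
        then have "E = {y,z,b}" by (rule card_three_eq[OF \<open>card E = 3\<close> _ _ True S(6) d(2,3)])
        then show ?thesis by (intro disjI2)
      qed
      then show ?thesis by simp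
    next
      case (pair r b')
      then have "b' = b" using True b by auto
      then have "\<exists>w\<in>A. b < w \<and> E = {w,b}" using pair by (intro bexI[of _ r]) simp_all
      then show ?thesis by (intro disjI2 disjI1)
    qed
  next
    case False
    have two: "(x \<in> E \<and> y \<in> E) \<or> (x \<in> E \<and> z \<in> E) \<or> (y \<in> E \<and> z \<in> E)"
      using c n(3) False by (cases "x \<in> E"; cases "y \<in> E"; cases "z \<in> E"; simp)
    then have "2 \<le> card E" using card_two_le[OF n(1)] S by metis
    then consider "card E = 2" | "card E = 3" using n(4) by linarith
    then have "E \<in> {{x,y},{x,z},{y,z},{x,y,z}}"
    proof cases
      case 1
      have "E = {x,y} \<or> E = {x,z} \<or> E = {y,z}"
        using two card_two_eq[OF 1 _ _ S(4)] card_two_eq[OF 1 _ _ S(5)] card_two_eq[OF 1 _ _ S(6)] by metis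
      then show ?thesis by (elim disjE) simp_all
    next
      case 2
      then have "x \<in> E" "y \<in> E" "z \<in> E"
        using c False by (cases "x \<in> E"; cases "y \<in> E"; cases "z \<in> E"; simp)+
      then have "E = {x,y,z}" by (rule card_three_eq[OF 2 _ _ _ S(4-6)])
      then show ?thesis by simp
    qed
    then show ?thesis by (intro disjI2)
  qed
qed

lemma btri_inj:
  assumes "b \<notin> S" "b \<notin> S'" "2 \<le> card S'" "btri b S' \<subseteq> btri b S"
  shows "S' \<subseteq> S"
proof -
  have "S' \<subseteq> \<Union>(btri b S')"
  proof
    fix s assume s: "s \<in> S'"
    have "S' \<noteq> {s}" using assms(3) by auto
    then obtain s' where "s' \<in> S'" "s' \<noteq> s" using s by blast
    then show "s \<in> \<Union>(btri b S')" using s by (auto simp: btri_def)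
  qed
  also have "\<dots> \<subseteq> \<Union>(btri b S)" using assms(4) by blast
  also have "\<dots> \<subseteq> insert b S" by (auto simp: btri_def)
  finally show ?thesis using assms(2) by blast
qed

section \<open>Collapsing the neighbours with an added element\<close>

definition triples :: "nat set set" where
  "triples = {S. S \<subseteq> A \<and> card S = 3}"

lemma triplesE:
  assumes "S \<in> triples"
  obtains x y z where "S = {x,y,z}" "x \<in> A" "y \<in> A" "z \<in> A" "x \<noteq> y" "x \<noteq> z" "y \<noteq> z"
    "\<And>b. btri b S = {{x,y,b},{x,z,b},{y,z,b}}"
proof -
  obtain x y z where "S = {x,y,z}" "x \<noteq> y" "x \<noteq> z" "y \<noteq> z"
    using assms by (auto simp: triples_def card_3_iff)
  then show thesis using assms btri_3[of x y z] by (intro that[of x y z]) (auto simp: triples_def)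
qed

lemma triplesI: "x \<in> A \<Longrightarrow> y \<in> A \<Longrightarrow> z \<in> A \<Longrightarrow> x \<noteq> y \<Longrightarrow> x \<noteq> z \<Longrightarrow> y \<noteq> z \<Longrightarrow> {x,y,z} \<in> triples"
  by (simp add: triples_def)

text \<open>The doubleton \<open>{apex b S, b}\<close> survives when the other \<open>{t,b}\<close>
  with \<open>t \<notin> S\<close> are deleted around \<open>btri b S\<close>. If
  \<open>b < Max S\<close>, choosing \<open>Max S\<close> leaves only doubletons meeting
  \<open>S\<close>, so that \<open>S\<close> itself can be the next apex. If \<open>S\<close> lies
  below \<open>b\<close>, no element of \<open>S\<close> can be exchanged for \<open>b\<close> and
  \<open>h\<close> is taken; for \<open>b < h\<close> this leaves \<open>crit4 b S\<close>.\<close>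

definition apex :: "nat \<Rightarrow> nat set \<Rightarrow> nat" where
  "apex b S = (if b < Max S then Max S else h)"

text \<open>The patterns are deleted from large to small: a doubleton with three triples, then three
  triples, two triples, one triple, and one doubleton, always together with \<open>{}\<close>. Each
  deletion removes the obstructions to an apex for the next family.\<close>

definition added_pairs :: "nat set set set" where
  "added_pairs = {insert {} (insert {t,b} (btri b S)) | t b S.
     b \<in> {1..m} - A \<and> S \<in> triples \<and> t \<in> A \<and> b < t \<and> t \<notin> S \<and> t \<noteq> apex b S}"

definition crit4 :: "nat \<Rightarrow> nat set \<Rightarrow> nat set set" where
  "crit4 b S = insert {} (insert {h,b} (btri b S))"

definition crit4s :: "nat set set set" where
  "crit4s = {crit4 b S | b S. b \<in> {1..m} - A \<and> b < h \<and> S \<in> triples \<and> S \<subseteq> {..<b}}"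

definition btris :: "nat set set set" where
  "btris = {insert {} (btri b S) | b S. b \<in> {1..m} - A \<and> S \<in> triples}"

definition added_triple_pairs :: "nat set set set" where
  "added_triple_pairs = {{{},{x,y,b},{x,z,b}} | x y z b. b \<in> {1..m} - A \<and> x \<in> A \<and> y \<in> A \<and> z \<in> A \<and> x \<noteq> y \<and> x \<noteq> z \<and> y \<noteq> z}"

definition added_triples :: "nat set set set" where
  "added_triples = {{{},{x,y,b}} | x y b. b \<in> {1..m} - A \<and> x \<in> A \<and> y \<in> A \<and> x \<noteq> y}"

definition added_doubletons :: "nat set set set" where
  "added_doubletons = {{{},{r,b}} | r b. b \<in> {1..m} - A \<and> r \<in> A}"

lemma A_range: "a \<in> A \<Longrightarrow> a \<in> {1..m}"
  using A_sub by blast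

lemma triples_fin: "S \<in> triples \<Longrightarrow> finite S" "S \<in> triples \<Longrightarrow> S \<noteq> {}" "S \<in> triples \<Longrightarrow> S \<subseteq> A"
  using fin_A finite_subset by (auto simp: triples_def)

lemma apex_A: "S \<in> triples \<Longrightarrow> apex b S \<in> A"
  using Max_in[OF triples_fin(1,2)] triples_fin(3)[of S] h_A unfolding apex_def by (metis subsetD)

lemma btri_Pow: "b \<in> {1..m} - A \<Longrightarrow> S \<in> triples \<Longrightarrow> btri b S \<subseteq> Pow {1..m}"
  using triples_fin(3)[of S] A_sub by (auto simp: btri_def)

lemma card_btri: "S \<in> triples \<Longrightarrow> b \<notin> A \<Longrightarrow> E \<in> btri b S \<Longrightarrow> card E = 3"
proof -
  assume S: "S \<in> triples" and b: "b \<notin> A" and E: "E \<in> btri b S"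
  obtain s where s: "s \<in> S" "E = insert b (S - {s})" using E by (auto simp: btri_def)
  have "b \<notin> S - {s}" using triples_fin(3)[OF S] b by blast
  then have "card E = Suc (card (S - {s}))" using s(2) triples_fin(1)[OF S] by simp
  then show "card E = 3" using card.remove[OF triples_fin(1)[OF S] s(1)] S by (simp add: triples_def)
qed

lemma btri_notin_A: "S \<in> triples \<Longrightarrow> b \<notin> A \<Longrightarrow> E \<in> btri b S \<Longrightarrow> \<not> E \<subseteq> A"
  by (auto simp: btri_def)

text \<open>By \<open>btri_link\<close>, the only three-element vertices of such a simplex that
  contain \<open>b\<close> are those of \<open>btri b S\<close>. This keeps the apex chosen for one
  \<open>S\<close> from completing a pattern of another.\<close>

lemma btri_same:
  assumes \<tau>: "\<tau> \<in> K" "{} \<in> \<tau>" and b: "b \<in> {1..m} - A" and S: "S \<in> triples" "btri b S \<subseteq> \<tau>"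
    and S': "S' \<in> triples" "btri b S' \<subseteq> \<tau>"
  shows "S' = S"
proof -
  obtain x y z where S3: "S = {x,y,z}" "x \<in> A" "y \<in> A" "z \<in> A" "x \<noteq> y" "x \<noteq> z" "y \<noteq> z"
    "btri b S = {{x,y,b},{x,z,b},{y,z,b}}" using S(1) by (elim triplesE) blast
  have "btri b S' \<subseteq> btri b S"
  proof
    fix E assume E: "E \<in> btri b S'"
    then have "E \<in> \<tau>" using S' by blast
    have "card E = 3" "\<not> E \<subseteq> A" using card_btri btri_notin_A E S' b by blast+
    then have "E \<noteq> {}" by auto
    have disj: "E \<in> {{x,y,b},{x,z,b},{y,z,b}} \<or> (\<exists>w\<in>A. b < w \<and> E = {w,b}) \<or> E \<in> {{x,y},{x,z},{y,z},{x,y,z}}"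
      using btri_link[OF \<tau> S3(2-7) b _ \<open>E \<in> \<tau>\<close> \<open>E \<noteq> {}\<close>] S(2) unfolding S3(8) .
    have "E \<noteq> {w,b}" for w
    proof
      assume "E = {w,b}"
      then have "card E \<le> 2" by (simp add: card_insert_if)
      then show False using \<open>card E = 3\<close> by simp
    qed
    moreover have "E \<notin> {{x,y},{x,z},{y,z},{x,y,z}}" using \<open>\<not> E \<subseteq> A\<close> S3(2-4) by auto
    ultimately show "E \<in> btri b S" using disj unfolding S3(8) by metis
  qed
  then have "S' \<subseteq> S"
    using b triples_fin(3)[OF S(1)] triples_fin(3)[OF S'(1)] S'(1)
    by (intro btri_inj[of b]) (auto simp: triples_def)
  then show ?thesis
    using S(1) S'(1) triples_fin(1)[OF S(1)] by (intro card_subset_eq) (auto simp: triples_def)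
qed

text \<open>In the presence of \<open>btri b S\<close> and \<open>{t,b}\<close> with
  \<open>t \<notin> S\<close>, every further vertex contains \<open>b\<close>: otherwise it would be
  a subset of \<open>S\<close> with at least two elements, too far from \<open>{t,b}\<close>. A set
  of at most three elements containing \<open>b\<close> is adjacent to
  \<open>{apex b S, b}\<close>.\<close>

lemma collapse_added_pairs: "collapse (\<lambda>\<sigma>. {} \<in> \<sigma>) K (KK added_pairs)"
proof -
  have "collapse (\<lambda>\<sigma>. {} \<in> \<sigma>) (KK {}) (KK ({} \<union> added_pairs))"
  proof (rule collapse_KK)
    show "added_pairs \<subseteq> Pow (Pow {1..m})" unfolding added_pairs_def using btri_Pow A_range by fastforce
    show "\<And>\<sigma>. \<sigma> \<in> added_pairs \<Longrightarrow> {} \<in> \<sigma>" by (auto simp: added_pairs_def)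
    fix \<sigma> assume "\<sigma> \<in> added_pairs"
    then obtain t b S where \<sigma>: "\<sigma> = insert {} (insert {t,b} (btri b S))" and b: "b \<in> {1..m} - A"
      and S: "S \<in> triples" and t: "t \<in> A" "b < t" "t \<notin> S" "t \<noteq> apex b S" by (auto simp: added_pairs_def)
    obtain x y z where S3: "S = {x,y,z}" "x \<in> A" "y \<in> A" "z \<in> A" "x \<noteq> y" "x \<noteq> z" "y \<noteq> z"
      "btri b S = {{x,y,b},{x,z,b},{y,z,b}}" using S by (elim triplesE) blast
    let ?g = "apex b S" and ?v = "{apex b S, b}"
    have g: "?g \<in> A" "b < ?g" using apex_A[OF S] h_ge[OF t(1)] t(2) by (auto simp: apex_def)
    then have gb: "?g \<noteq> b" by simp
    have "?v \<notin> \<sigma>"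
    proof -
      have "?v \<notin> btri b S" using card_btri[OF S, of b ?v] b gb by auto
      moreover have "?v \<noteq> {t,b}" using t gb by (auto simp: doubleton_eq_iff)
      ultimately show ?thesis using \<sigma> by auto
    qed
    moreover have "card (sym_diff ?v E) \<le> 3" if \<tau>: "\<tau> \<in> KK {}" "\<sigma> \<subseteq> \<tau>" and E: "E \<in> \<tau>" "E \<noteq> {}" for \<tau> E
    proof -
      have \<tau>K: "\<tau> \<in> K" "{} \<in> \<tau>" "btri b S \<subseteq> \<tau>" "{t,b} \<in> \<tau>" using KK_K[OF \<tau>(1)] \<tau>(2) \<sigma> by auto
      note n = nbr[OF \<tau>K(1,2) E]
      have tb: "card E \<le> 1 + 2 * (of_bool (t \<in> E) + of_bool (b \<in> E))"
        using K_D(2)[OF \<tau>K(1,4) E(1)] adj_pair[OF n(1), of t b] t by simp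
      have "b \<in> E"
        using btri_link[OF \<tau>K(1,2) S3(2-7) b _ E] \<tau>K(3) tb S3 b t unfolding S3(8) by auto
      then show ?thesis using adj_pair[OF n(1) gb] n(4) by simp
    qed
    \<comment> \<open>A pattern completed by \<open>?v\<close> would have \<open>?v\<close> as its
      doubleton and, by \<open>btri_same\<close>, the same \<open>S\<close>; but
      \<open>added_pairs\<close> excludes the apex doubleton.\<close>
    moreover have "\<not> \<sigma>' \<subseteq> insert ?v \<tau>" if \<tau>: "\<tau> \<in> KK {}" "\<sigma> \<subseteq> \<tau>" and \<sigma>': "\<sigma>' \<in> {} \<union> added_pairs" "?v \<in> \<sigma>'" for \<tau> \<sigma>'
    proof
      assume sub: "\<sigma>' \<subseteq> insert ?v \<tau>"
      obtain t' b' S' where \<sigma>'': "\<sigma>' = insert {} (insert {t',b'} (btri b' S'))" and b': "b' \<in> {1..m} - A"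
        and S': "S' \<in> triples" and t': "t' \<in> A" "t' \<noteq> apex b' S'" using \<sigma>'(1) by (auto simp: added_pairs_def)
      have nv: "?v \<notin> btri b' S'" using card_btri[OF S', of b' ?v] b' gb by auto
      then have "?v = {t',b'}" using \<sigma>'(2) \<sigma>'' by auto
      then have eq: "t' = ?g" "b' = b" using g t'(1) b b' by (auto simp: doubleton_eq_iff)
      have "btri b S' \<subseteq> \<tau>" using sub nv \<sigma>'' eq by auto
      then have "S' = S" using \<tau> \<sigma> by (intro btri_same[of \<tau> b S S'] b S S') (auto simp: KK_def)
      then show False using t'(2) eq by simp
    qed
    ultimately show "\<exists>v\<in>V. card v \<le> 3 \<and> v \<notin> \<sigma> \<and> (\<forall>\<tau>\<in>KK {}. \<sigma> \<subseteq> \<tau> \<longrightarrow>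
        (\<forall>E\<in>\<tau>. E \<noteq> {} \<longrightarrow> card (sym_diff v E) \<le> 3) \<and>
        (\<forall>\<sigma>'\<in>{} \<union> added_pairs. v \<in> \<sigma>' \<longrightarrow> \<not> \<sigma>' \<subseteq> insert v \<tau>))"
      using V_exchange[OF g(1) b g(2)] gb by (intro bexI[of _ ?v] conjI ballI impI) auto
  qed
  moreover have "KK {} = K" by (simp add: KK_def)
  ultimately show ?thesis by simp
qed

text \<open>All vertices of these patterns other than \<open>{}\<close> contain an added element. So
  an apex that is a nonempty subset of \<open>A\<close> never completes a pattern.\<close>

lemma v_notin_patterns:
  assumes "v \<subseteq> A" "v \<noteq> {}" "\<sigma> \<in> added_pairs \<union> crit4s \<union> btris \<union> added_triple_pairs \<union> added_triples \<union> added_doubletons"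
  shows "v \<notin> \<sigma>"
  using assms btri_notin_A unfolding added_pairs_def crit4s_def crit4_def btris_def added_triple_pairs_def added_triples_def added_doubletons_def by auto

text \<open>\<open>S\<close> is adjacent to every vertex with at least half its elements in
  \<open>S\<close>. By \<open>btri_link\<close> the only obstruction is a doubleton
  \<open>{w,b}\<close> with \<open>w \<notin> S\<close>. It was deleted with
  \<open>added_pairs\<close> unless \<open>w = apex b S\<close>; then \<open>w = h\<close> and
  \<open>S\<close> lies below \<open>b\<close>, and this case was deleted with
  \<open>crit4s\<close>.\<close>

lemma collapse_btris: "collapse (\<lambda>\<sigma>. {} \<in> \<sigma>) (KK (added_pairs \<union> crit4s)) (KK (added_pairs \<union> crit4s \<union> btris))"
proof (rule collapse_KK)
  show "btris \<subseteq> Pow (Pow {1..m})" unfolding btris_def using btri_Pow by fastforce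
  show "\<And>\<sigma>. \<sigma> \<in> btris \<Longrightarrow> {} \<in> \<sigma>" by (auto simp: btris_def)
  fix \<sigma> assume "\<sigma> \<in> btris"
  then obtain b S where \<sigma>: "\<sigma> = insert {} (btri b S)" and b: "b \<in> {1..m} - A" and S: "S \<in> triples"
    by (auto simp: btris_def)
  obtain x y z where S3: "S = {x,y,z}" "x \<in> A" "y \<in> A" "z \<in> A" "x \<noteq> y" "x \<noteq> z" "y \<noteq> z"
    "btri b S = {{x,y,b},{x,z,b},{y,z,b}}" using S by (elim triplesE) blast
  have SA: "S \<subseteq> A" "S \<noteq> {}" "card S \<le> 3"
    using triples_fin(2,3)[OF S] S by (simp_all add: triples_def)
  have adj: "card (sym_diff S E) \<le> 3" if \<tau>: "\<tau> \<in> KK (added_pairs \<union> crit4s)" "\<sigma> \<subseteq> \<tau>" and E: "E \<in> \<tau>" "E \<noteq> {}" for \<tau> E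
  proof -
    have \<tau>K: "\<tau> \<in> K" "{} \<in> \<tau>" "btri b S \<subseteq> \<tau>" using KK_K[OF \<tau>(1)] \<tau>(2) \<sigma> by auto
    note n = nbr[OF \<tau>K(1,2) E]
    have w: "w \<in> S" if w: "w \<in> A" "b < w" "E = {w,b}" for w
    proof (rule ccontr)
      assume nw: "w \<notin> S"
      show False
      proof (cases "w = apex b S")
        case False
        then have "insert {} (insert {w,b} (btri b S)) \<in> added_pairs" using w nw b S by (auto simp: added_pairs_def)
        then have "\<not> insert {} (insert {w,b} (btri b S)) \<subseteq> \<tau>" using KK_not[OF \<tau>(1)] by blast
        then show False using \<tau>K E w by blast
      next
        case True
        have "Max S \<in> S" using triples_fin[OF S] by simp
        then have "\<not> b < Max S" and wh: "w = h" using True nw by (auto simp: apex_def split: if_splits)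
        then have "s < b" if "s \<in> S" for s
          using Max_ge[OF triples_fin(1)[OF S] that] b SA that by (metis DiffD2 le_less_trans linorder_neqE_nat
              nat_less_le order_less_le_trans subsetD)
        then have "crit4 b S \<in> crit4s" using b w wh S by (auto simp: crit4s_def)
        then have "\<not> crit4 b S \<subseteq> \<tau>" using KK_not[OF \<tau>(1)] by blast
        then show False using \<tau>K E w wh unfolding crit4_def by blast
      qed
    qed
    have "b \<notin> S" using SA b by blast
    have "E \<in> {{x,y,b},{x,z,b},{y,z,b}} \<or> (\<exists>w\<in>A. b < w \<and> E = {w,b}) \<or> E \<in> {{x,y},{x,z},{y,z},{x,y,z}}"
      using btri_link[OF \<tau>K(1,2) S3(2-7) b _ E] \<tau>K(3) unfolding S3(8) .
    then have "card E \<le> 2 * (of_bool (x \<in> E) + of_bool (y \<in> E) + of_bool (z \<in> E))"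
    proof (elim disjE bexE)
      fix w assume "w \<in> A" "b < w \<and> E = {w,b}"
      moreover from this have "w = x \<or> w = y \<or> w = z" using w[of w] S3(1) by blast
      ultimately show ?thesis by (auto simp: card_insert_if)
    next
      have d: "x \<noteq> b" "y \<noteq> b" "z \<noteq> b" using \<open>b \<notin> S\<close> S3(1) by auto
      assume "E \<in> {{x,y,b},{x,z,b},{y,z,b}}"
      then show ?thesis using S3(5-7) d by (elim insertE emptyE) simp_all
    next
      assume "E \<in> {{x,y},{x,z},{y,z},{x,y,z}}"
      then show ?thesis using S3(5-7) by (elim insertE emptyE) simp_all
    qed
    then show ?thesis using adj_triple[OF n(1) S3(5-7)] S3(1) by simp
  qed
  have "S \<notin> \<sigma>" using v_notin_patterns[OF SA(1,2), of \<sigma>] \<open>\<sigma> \<in> btris\<close> by blast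
  then show "\<exists>v\<in>V. card v \<le> 3 \<and> v \<notin> \<sigma> \<and> (\<forall>\<tau>\<in>KK (added_pairs \<union> crit4s). \<sigma> \<subseteq> \<tau> \<longrightarrow>
      (\<forall>E\<in>\<tau>. E \<noteq> {} \<longrightarrow> card (sym_diff v E) \<le> 3) \<and>
      (\<forall>\<sigma>'\<in>added_pairs \<union> crit4s \<union> btris. v \<in> \<sigma>' \<longrightarrow> \<not> \<sigma>' \<subseteq> insert v \<tau>))"
    using v_notin_patterns[OF SA(1,2)] V_subset_A[OF SA(1)] SA(3) adj
    by (intro bexI[of _ S] conjI ballI impI) blast+
qed

text \<open>A singleton is adjacent to every set with at most two elements, so \<open>{x}\<close> is
  an apex as soon as all three-element vertices contain \<open>x\<close>.\<close>

lemma collapse_KK_singleton: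
  assumes F: "F \<subseteq> Pow (Pow {1..m})" "\<And>\<sigma>. \<sigma> \<in> F \<Longrightarrow> {} \<in> \<sigma>"
    and v: "\<And>\<sigma>. \<sigma> \<in> F \<Longrightarrow> \<exists>x\<in>A. \<forall>\<tau>\<in>KK G. \<sigma> \<subseteq> \<tau> \<longrightarrow> (\<forall>E\<in>\<tau>. card E = 3 \<longrightarrow> x \<in> E)"
    and no: "\<And>\<sigma> x. x \<in> A \<Longrightarrow> \<sigma> \<in> G \<union> F \<Longrightarrow> {x} \<notin> \<sigma>"
  shows "collapse (\<lambda>\<sigma>. {} \<in> \<sigma>) (KK G) (KK (G \<union> F))"
proof (rule collapse_KK[OF F])
  fix \<sigma> assume \<sigma>: "\<sigma> \<in> F"
  obtain x where x: "x \<in> A" "\<And>\<tau> E. \<tau> \<in> KK G \<Longrightarrow> \<sigma> \<subseteq> \<tau> \<Longrightarrow> E \<in> \<tau> \<Longrightarrow> card E = 3 \<Longrightarrow> x \<in> E"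
    using v[OF \<sigma>] by blast
  have "card (sym_diff {x} E) \<le> 3" if "\<tau> \<in> KK G" "\<sigma> \<subseteq> \<tau>" "E \<in> \<tau>" "E \<noteq> {}" for \<tau> E
  proof -
    note n = nbr[OF KK_K[OF that(1)] _ that(3,4)]
    have "{} \<in> \<tau>" using F(2)[OF \<sigma>] that(2) by blast
    then show ?thesis using adj_single[of E x] n x(2)[OF that(1-3)] by (cases "card E = 3") auto
  qed
  then show "\<exists>v\<in>V. card v \<le> 3 \<and> v \<notin> \<sigma> \<and> (\<forall>\<tau>\<in>KK G. \<sigma> \<subseteq> \<tau> \<longrightarrow>
      (\<forall>E\<in>\<tau>. E \<noteq> {} \<longrightarrow> card (sym_diff v E) \<le> 3) \<and>
      (\<forall>\<sigma>'\<in>G \<union> F. v \<in> \<sigma>' \<longrightarrow> \<not> \<sigma>' \<subseteq> insert v \<tau>))"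
    using no[OF x(1)] \<sigma> V_subset_A[of "{x}"] x(1) by (intro bexI[of _ "{x}"] conjI ballI impI) auto
qed

text \<open>Apex \<open>{x}\<close>: a three-element vertex without \<open>x\<close> that is
  adjacent to both triples is \<open>{y,z,b}\<close>, and it completes the already deleted pattern
  \<open>btri b {x,y,z}\<close>.\<close>

lemma collapse_added_triple_pairs: "collapse (\<lambda>\<sigma>. {} \<in> \<sigma>) (KK (added_pairs \<union> crit4s \<union> btris)) (KK (added_pairs \<union> crit4s \<union> btris \<union> added_triple_pairs))"
proof (rule collapse_KK_singleton)
  show "added_triple_pairs \<subseteq> Pow (Pow {1..m})" using A_range by (fastforce simp: added_triple_pairs_def)
  show "\<And>\<sigma>. \<sigma> \<in> added_triple_pairs \<Longrightarrow> {} \<in> \<sigma>" by (auto simp: added_triple_pairs_def)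
  show "\<And>\<sigma> x. x \<in> A \<Longrightarrow> \<sigma> \<in> added_pairs \<union> crit4s \<union> btris \<union> added_triple_pairs \<Longrightarrow> {x} \<notin> \<sigma>"
    by (rule v_notin_patterns) auto
  fix \<sigma> assume "\<sigma> \<in> added_triple_pairs"
  then obtain x y z b where \<sigma>: "\<sigma> = {{},{x,y,b},{x,z,b}}" and b: "b \<in> {1..m} - A"
    and xyz: "x \<in> A" "y \<in> A" "z \<in> A" "x \<noteq> y" "x \<noteq> z" "y \<noteq> z" by (auto simp: added_triple_pairs_def)
  have d: "x \<noteq> b" "y \<noteq> b" "z \<noteq> b" using xyz b by auto
  have "x \<in> E" if \<tau>: "\<tau> \<in> KK (added_pairs \<union> crit4s \<union> btris)" "\<sigma> \<subseteq> \<tau>" "E \<in> \<tau>" "card E = 3" for \<tau> E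
  proof (rule ccontr)
    assume nx: "x \<notin> E"
    have fE: "finite E" using that(4) card_ge_0_finite by force
    have "card (sym_diff {x,y,b} E) \<le> 3" "card (sym_diff {x,z,b} E) \<le> 3"
      using K_D(2)[OF KK_K[OF \<tau>(1)] _ \<tau>(3)] \<tau>(2) \<sigma> by blast+
    then have "(3::nat) \<le> 2 * (of_bool (y \<in> E) + of_bool (b \<in> E))" "(3::nat) \<le> 2 * (of_bool (z \<in> E) + of_bool (b \<in> E))"
      unfolding adj_triple[OF fE xyz(4) d(1,2)] adj_triple[OF fE xyz(5) d(1,3)] \<tau>(4) using nx by simp_all
    then have "y \<in> E" "z \<in> E" "b \<in> E"
      by (cases "y \<in> E"; cases "z \<in> E"; cases "b \<in> E"; simp)+
    then have "E = {y,z,b}" using card_three_eq[OF \<tau>(4)] d xyz by metis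
    then have "insert {} (btri b {x,y,z}) \<subseteq> \<tau>"
      using \<tau> \<sigma> btri_3[OF xyz(4-6), of b] by auto
    moreover have "insert {} (btri b {x,y,z}) \<in> btris"
      using b triplesI[OF xyz] by (auto simp: btris_def)
    ultimately show False using KK_not[OF \<tau>(1)] by blast
  qed
  then show "\<exists>x\<in>A. \<forall>\<tau>\<in>KK (added_pairs \<union> crit4s \<union> btris). \<sigma> \<subseteq> \<tau> \<longrightarrow> (\<forall>E\<in>\<tau>. card E = 3 \<longrightarrow> x \<in> E)"
    using xyz(1) by blast
qed

text \<open>Apex \<open>{x}\<close>: a three-element vertex without \<open>x\<close> has to contain
  \<open>y\<close> and \<open>b\<close>, so it is \<open>{y,z,b}\<close> with
  \<open>z \<in> A\<close>; together with \<open>{y,x,b}\<close> it would form one of the deleted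
  \<open>added_triple_pairs\<close>.\<close>

lemma collapse_added_triples: "collapse (\<lambda>\<sigma>. {} \<in> \<sigma>) (KK (added_pairs \<union> crit4s \<union> btris \<union> added_triple_pairs)) (KK (added_pairs \<union> crit4s \<union> btris \<union> added_triple_pairs \<union> added_triples))"
proof (rule collapse_KK_singleton)
  show "added_triples \<subseteq> Pow (Pow {1..m})" using A_range by (fastforce simp: added_triples_def)
  show "\<And>\<sigma>. \<sigma> \<in> added_triples \<Longrightarrow> {} \<in> \<sigma>" by (auto simp: added_triples_def)
  show "\<And>\<sigma> x. x \<in> A \<Longrightarrow> \<sigma> \<in> added_pairs \<union> crit4s \<union> btris \<union> added_triple_pairs \<union> added_triples \<Longrightarrow> {x} \<notin> \<sigma>"
    by (rule v_notin_patterns) auto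
  fix \<sigma> assume "\<sigma> \<in> added_triples"
  then obtain x y b where \<sigma>: "\<sigma> = {{},{x,y,b}}" and b: "b \<in> {1..m} - A"
    and xy: "x \<in> A" "y \<in> A" "x \<noteq> y" by (auto simp: added_triples_def)
  have d: "x \<noteq> b" "y \<noteq> b" using xy b by auto
  have "x \<in> E" if \<tau>: "\<tau> \<in> KK (added_pairs \<union> crit4s \<union> btris \<union> added_triple_pairs)" "\<sigma> \<subseteq> \<tau>" "E \<in> \<tau>" "card E = 3" for \<tau> E
  proof (rule ccontr)
    assume nx: "x \<notin> E"
    have fE: "finite E" using that(4) card_ge_0_finite by force
    have \<tau>K: "\<tau> \<in> K" "{} \<in> \<tau>" using KK_K[OF \<tau>(1)] \<tau>(2) \<sigma> by auto
    have "card (sym_diff {x,y,b} E) \<le> 3"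
      using K_D(2)[OF \<tau>K(1) _ \<tau>(3)] \<tau>(2) \<sigma> by blast
    then have yb: "y \<in> E" "b \<in> E"
      using adj_triple[OF fE, of x y b] d xy nx \<tau>(4)
      by (cases "y \<in> E"; cases "b \<in> E"; simp)+
    have "E \<noteq> {}" using yb by blast
    from \<tau>K \<tau>(3) this show False
    proof (cases rule: nbr_cases)
      case inA
      then show ?thesis using yb b by blast
    next
      case (triple x' y' b')
      then have "b' = b" using yb b by auto
      obtain z where z: "z \<in> A" "z \<noteq> y" "E = {y,z,b}"
        using triple \<open>b' = b\<close> yb d by (cases "y = x'") auto
      then have "{{},{y,x,b},{y,z,b}} \<in> added_triple_pairs" using b xy nx by (auto simp: added_triple_pairs_def)
      moreover have "{{},{y,x,b},{y,z,b}} \<subseteq> \<tau>" using \<tau> \<sigma> z by (auto simp: insert_commute)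
      ultimately show ?thesis using KK_not[OF \<tau>(1)] by blast
    next
      case (pair r b')
      then have "card E \<le> 2" by (simp add: card_insert_if)
      then show ?thesis using \<tau>(4) by simp
    qed
  qed
  then show "\<exists>x\<in>A. \<forall>\<tau>\<in>KK (added_pairs \<union> crit4s \<union> btris \<union> added_triple_pairs). \<sigma> \<subseteq> \<tau> \<longrightarrow> (\<forall>E\<in>\<tau>. card E = 3 \<longrightarrow> x \<in> E)"
    using xy(1) by blast
qed

text \<open>Apex \<open>{r}\<close>: the three-element vertices still joined to \<open>{}\<close>
  lie in \<open>A\<close>, hence avoid \<open>b\<close>, and adjacency to \<open>{r,b}\<close>
  forces \<open>r\<close> into them.\<close>

lemma collapse_added_doubletons: "collapse (\<lambda>\<sigma>. {} \<in> \<sigma>) (KK (added_pairs \<union> crit4s \<union> btris \<union> added_triple_pairs \<union> added_triples)) (KK (added_pairs \<union> crit4s \<union> btris \<union> added_triple_pairs \<union> added_triples \<union> added_doubletons))"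
proof (rule collapse_KK_singleton)
  show "added_doubletons \<subseteq> Pow (Pow {1..m})" using A_range by (fastforce simp: added_doubletons_def)
  show "\<And>\<sigma>. \<sigma> \<in> added_doubletons \<Longrightarrow> {} \<in> \<sigma>" by (auto simp: added_doubletons_def)
  show "\<And>\<sigma> x. x \<in> A \<Longrightarrow> \<sigma> \<in> added_pairs \<union> crit4s \<union> btris \<union> added_triple_pairs \<union> added_triples \<union> added_doubletons \<Longrightarrow> {x} \<notin> \<sigma>"
    by (rule v_notin_patterns) auto
  fix \<sigma> assume "\<sigma> \<in> added_doubletons"
  then obtain r b where \<sigma>: "\<sigma> = {{},{r,b}}" and b: "b \<in> {1..m} - A" and r: "r \<in> A" by (auto simp: added_doubletons_def)
  have d: "r \<noteq> b" using r b by auto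
  have "r \<in> E" if \<tau>: "\<tau> \<in> KK (added_pairs \<union> crit4s \<union> btris \<union> added_triple_pairs \<union> added_triples)" "\<sigma> \<subseteq> \<tau>" "E \<in> \<tau>" "card E = 3" for \<tau> E
  proof -
    have fE: "finite E" and "E \<noteq> {}" using that(4) card_ge_0_finite by force+
    have \<tau>K: "\<tau> \<in> K" "{} \<in> \<tau>" using KK_K[OF \<tau>(1)] \<tau>(2) \<sigma> by auto
    have adj: "card (sym_diff {r,b} E) \<le> 3"
      using K_D(2)[OF \<tau>K(1) _ \<tau>(3)] \<tau>(2) \<sigma> by blast
    from \<tau>K \<tau>(3) \<open>E \<noteq> {}\<close> show "r \<in> E"
    proof (cases rule: nbr_cases)
      case inA
      then have "b \<notin> E" using b by blast
      then show ?thesis using adj adj_pair[OF fE d] \<tau>(4) by (cases "r \<in> E") auto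
    next
      case (triple x' y' b')
      then have "{{},E} \<in> added_triples" by (auto simp: added_triples_def)
      then have "\<not> {{},E} \<subseteq> \<tau>" using KK_not[OF \<tau>(1)] by blast
      then show ?thesis using \<tau>(3) \<tau>K by blast
    next
      case (pair r' b')
      then have "card E \<le> 2" by (simp add: card_insert_if)
      then show ?thesis using \<tau>(4) by simp
    qed
  qed
  then show "\<exists>x\<in>A. \<forall>\<tau>\<in>KK (added_pairs \<union> crit4s \<union> btris \<union> added_triple_pairs \<union> added_triples). \<sigma> \<subseteq> \<tau> \<longrightarrow> (\<forall>E\<in>\<tau>. card E = 3 \<longrightarrow> x \<in> E)"
    using r by blast
qed

definition with_added :: "nat set set set" where
  "with_added = {{{},E} | E. \<not> E \<subseteq> A}"

text \<open>Every pattern contains an edge from \<open>{}\<close> to a vertex with an added element,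
  and by \<open>nbr_cases\<close> every such edge of \<open>K\<close> belongs to one of the last two
  families. So the record of six families can be replaced by a single one.\<close>

lemma KK_with_added: "KK (added_pairs \<union> crit4s \<union> btris \<union> added_triple_pairs \<union> added_triples \<union> added_doubletons) = KK with_added" (is "KK ?G = _")
proof (intro set_eqI iffI)
  fix \<tau> assume \<tau>: "\<tau> \<in> KK ?G"
  show "\<tau> \<in> KK with_added"
    unfolding KK_def mem_Collect_eq
  proof (intro conjI ballI notI)
    show K: "\<tau> \<in> K" using \<tau> by (rule KK_K)
    fix \<sigma> assume "\<sigma> \<in> with_added" "\<sigma> \<subseteq> \<tau>"
    then obtain E where E: "{} \<in> \<tau>" "E \<in> \<tau>" "\<not> E \<subseteq> A" by (auto simp: with_added_def)
    then have "E \<noteq> {}" by auto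
    from K E(1,2) this have "{{},E} \<in> added_triples \<union> added_doubletons"
    proof (cases rule: nbr_cases)
      case inA
      then show ?thesis using E by blast
    qed (auto simp: added_triples_def added_doubletons_def)
    then have "\<not> {{},E} \<subseteq> \<tau>" using KK_not[OF \<tau>] by blast
    then show False using E by blast
  qed
next
  fix \<tau> assume \<tau>: "\<tau> \<in> KK with_added"
  show "\<tau> \<in> KK ?G"
    unfolding KK_def mem_Collect_eq
  proof (intro conjI ballI notI)
    show "\<tau> \<in> K" using \<tau> by (rule KK_K)
    fix \<sigma> assume \<sigma>: "\<sigma> \<in> ?G" "\<sigma> \<subseteq> \<tau>"
    have "\<exists>E\<in>\<sigma>. \<not> E \<subseteq> A \<and> {} \<in> \<sigma>"
      using \<sigma>(1) unfolding added_pairs_def crit4s_def crit4_def btris_def added_triple_pairs_def added_triples_def added_doubletons_def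
      by (auto elim!: triplesE)
    then obtain E where "{{},E} \<in> with_added" "{{},E} \<subseteq> \<tau>" using \<sigma>(2) unfolding with_added_def by blast
    then show False using KK_not[OF \<tau>] by blast
  qed
qed

lemma collapse_to_with_added: "collapse (\<lambda>\<sigma>. {} \<in> \<sigma>) (KK (added_pairs \<union> crit4s)) (KK with_added)"
  using collapse_btris collapse_added_triple_pairs collapse_added_triples collapse_added_doubletons collapse_trans unfolding KK_with_added by metis

text \<open>Maximality of \<open>crit4 b S\<close>. Among the vertices allowed by
  \<open>btri_link\<close>, subsets of \<open>S\<close> are too far from \<open>{h,b}\<close>, and a
  doubleton \<open>{w,b}\<close> with \<open>w \<noteq> h\<close> was deleted with
  \<open>added_pairs\<close>, because \<open>apex b S = h\<close> when \<open>S\<close> lies below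
  \<open>b\<close>.\<close>

lemma crit4_link:
  assumes b: "b \<in> {1..m} - A" "b < h" and S: "S \<in> triples" "S \<subseteq> {..<b}"
    and \<tau>: "\<tau> \<in> KK added_pairs" "crit4 b S \<subseteq> \<tau>"
  shows "\<tau> = crit4 b S"
proof -
  obtain x y z where S3: "S = {x,y,z}" "x \<in> A" "y \<in> A" "z \<in> A" "x \<noteq> y" "x \<noteq> z" "y \<noteq> z"
    "btri b S = {{x,y,b},{x,z,b},{y,z,b}}" using S(1) by (elim triplesE) blast
  have \<tau>K: "\<tau> \<in> K" "{} \<in> \<tau>" "btri b S \<subseteq> \<tau>" "{h,b} \<in> \<tau>" using KK_K[OF \<tau>(1)] \<tau>(2) by (auto simp: crit4_def)
  have "E \<in> crit4 b S" if E: "E \<in> \<tau>" for E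
  proof (cases "E = {}")
    case False
    note n = nbr[OF \<tau>K(1,2) E False]
    have hS: "h \<notin> S" using S(2) b(2) by auto
    have tb: "card E \<le> 1 + 2 * (of_bool (h \<in> E) + of_bool (b \<in> E))"
      using K_D(2)[OF \<tau>K(1,4) E] adj_pair[OF n(1), of h b] b by simp
    have "E \<in> {{x,y,b},{x,z,b},{y,z,b}} \<or> (\<exists>w\<in>A. b < w \<and> E = {w,b}) \<or> E \<in> {{x,y},{x,z},{y,z},{x,y,z}}"
      using btri_link[OF \<tau>K(1,2) S3(2-7) b(1) _ E False] \<tau>K(3) unfolding S3(8) .
    then show ?thesis
    proof (elim disjE bexE)
      fix w assume w: "w \<in> A" "b < w \<and> E = {w,b}"
      have "w = h"
      proof (rule ccontr)
        assume "w \<noteq> h"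
        have "Max S \<in> S" using triples_fin[OF S(1)] by simp
        then have "\<not> b < Max S" using S(2) by auto
        then have "apex b S = h" by (simp add: apex_def)
        moreover have "w \<notin> S" using S(2) w(2) by auto
        ultimately have "insert {} (insert {w,b} (btri b S)) \<in> added_pairs"
          unfolding added_pairs_def mem_Collect_eq using w \<open>w \<noteq> h\<close> b(1) S(1)
          by (intro exI[of _ w] exI[of _ b] exI[of _ S]) simp
        then have "\<not> insert {} (insert {w,b} (btri b S)) \<subseteq> \<tau>" using KK_not[OF \<tau>(1)] by blast
        then show False using \<tau>K E w by blast
      qed
      then show ?thesis using w by (simp add: crit4_def)
    next
      assume "E \<in> {{x,y,b},{x,z,b},{y,z,b}}"
      then show ?thesis using S3(8) by (auto simp: crit4_def)
    next
      assume "E \<in> {{x,y},{x,z},{y,z},{x,y,z}}"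
      then have "E \<subseteq> S" "2 \<le> card E" using S3(1,5-7) by (elim insertE emptyE; simp)+
      moreover have "h \<notin> E" "b \<notin> E" using \<open>E \<subseteq> S\<close> hS triples_fin(3)[OF S(1)] b(1) by blast+
      ultimately show ?thesis using tb by simp
    qed
  qed (simp add: crit4_def)
  then show ?thesis using \<tau>(2) by blast
qed


section \<open>Collapsing the neighbours inside the last set\<close>

definition quads :: "nat set set" where
  "quads = {W. W \<subseteq> A \<and> card W = 4}"

definition crit7 :: "nat set \<Rightarrow> nat set set" where
  "crit7 W = insert {} (tri W \<union> (\<lambda>w. {Max W, w}) ` (W - {Max W}))"

definition crit7s :: "nat set set set" where
  "crit7s = crit7 ` quads"

text \<open>Again from large to small: all four triples of a \<open>W\<close> with two, one or no
  pairs through \<open>Max W\<close>, then three triples with a common element, two triples with a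
  common pair, and a single triple.\<close>

definition quads_two :: "nat set set set" where
  "quads_two = {insert {} (tri W \<union> {{Max W,s},{Max W,t}}) | W s t.
     W \<in> quads \<and> s \<in> W - {Max W} \<and> t \<in> W - {Max W} \<and> s \<noteq> t}"

definition quads_one :: "nat set set set" where
  "quads_one = {insert {} (tri W \<union> {{Max W,t}}) | W t. W \<in> quads \<and> t \<in> W - {Max W}}"

definition quads_none :: "nat set set set" where
  "quads_none = {insert {} (tri W) | W. W \<in> quads}"

definition triple_stars :: "nat set set set" where
  "triple_stars = {{{},{r,a,b},{r,a,c},{r,b,c}} | r a b c. {r,a,b,c} \<subseteq> A \<and> distinct [r,a,b,c]}"

definition triple_pairs :: "nat set set set" where
  "triple_pairs = {{{},{r,s,t},{r,s,x}} | r s t x. {r,s,t,x} \<subseteq> A \<and> distinct [r,s,t,x]}"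

definition triple_singles :: "nat set set set" where
  "triple_singles = {{{},{r,s,t}} | r s t. {r,s,t} \<subseteq> A \<and> distinct [r,s,t]}"

text \<open>A common bound for \<open>crit7s\<close> and the three families of \<open>quads\<close>:
  the triples determine \<open>W\<close>, and any other nonempty vertex contains
  \<open>Max W\<close>.\<close>

definition quad_pattern :: "nat set set \<Rightarrow> bool" where
  "quad_pattern \<sigma> \<longleftrightarrow> (\<exists>W\<in>quads. insert {} (tri W) \<subseteq> \<sigma> \<and>
     \<sigma> \<subseteq> insert {} (tri W \<union> (\<lambda>w. {Max W, w}) ` W))"

lemma quadsD:
  assumes "W \<in> quads"
  shows "W \<subseteq> A" "card W = 4" "finite W" "W \<noteq> {}" "Max W \<in> W"
proof -
  show W: "W \<subseteq> A" "card W = 4" using assms by (auto simp: quads_def)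
  then show f: "finite W" using fin_A finite_subset by blast
  show ne: "W \<noteq> {}" using W by auto
  show "Max W \<in> W" using f ne by simp
qed

lemma quads_other: "W \<in> quads \<Longrightarrow> \<exists>r. r \<in> W - {Max W}"
proof -
  assume W: "W \<in> quads"
  have "card (W - {Max W}) = 3" using quadsD(2,3,5)[OF W] by simp
  then have "W - {Max W} \<noteq> {}" by (metis card.empty zero_neq_numeral)
  then show ?thesis by blast
qed

lemma quads_split:
  assumes "W \<in> quads" "r \<in> W - {Max W}"
  obtains s t where "W = {r,s,t,Max W}" "distinct [r,s,t,Max W]" "W - {Max W, r} = {s,t}"
proof -
  note W = quadsD[OF assms(1)]
  have "card (W - {Max W, r}) = card W - card {Max W, r}"
    using W assms(2) by (intro card_Diff_subset) auto
  then have "card (W - {Max W, r}) = 2" using W(2) assms(2) by simp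
  then obtain s t where st: "W - {Max W, r} = {s,t}" "s \<noteq> t" by (auto simp: card_2_iff)
  have "s \<in> W - {Max W, r}" "t \<in> W - {Max W, r}" unfolding st(1) by simp_all
  then have "distinct [r,s,t,Max W]" using assms(2) st(2) by auto
  moreover have "W = {r,s,t,Max W}" using st(1) W(5) assms(2) by blast
  ultimately show thesis using st(1) that by blast
qed

lemma card_tri:
  assumes "W \<in> quads" "E \<in> tri W"
  shows "card E = 3"
  using assms(2) quadsD[OF assms(1)] by (auto simp: tri_def)

text \<open>Each triple \<open>W - {w}\<close> contains at least half of \<open>E\<close>. Taking
  \<open>w\<close> in \<open>W \<inter> E\<close> gives
  \<open>card E \<le> 2 * (card (W \<inter> E) - 1)\<close>, which rules out singletons and, for two
  or three elements, forces \<open>E\<close> into \<open>W\<close>.\<close>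

lemma tri_link:
  assumes \<tau>: "\<tau> \<in> K" "{} \<in> \<tau>" and W: "W \<in> quads" "tri W \<subseteq> \<tau>" and E: "E \<in> \<tau>" "E \<noteq> {}"
  shows "E \<subseteq> W" "2 \<le> card E" "card E \<le> 3"
proof -
  note n = nbr[OF \<tau> E]
  note Wq = quadsD[OF W(1)]
  have adj: "card E \<le> 2 * card ((W - {w}) \<inter> E)" if "w \<in> W" for w
  proof -
    have "W - {w} \<in> tri W" using that by (auto simp: tri_def)
    then have "card (sym_diff (W - {w}) E) \<le> 3" using K_D(2)[OF \<tau>(1) _ E(1)] W(2) by blast
    moreover have "card (W - {w}) = 3" using that Wq(2,3) by simp
    moreover have "finite (W - {w})" using Wq(3) by simp
    ultimately show ?thesis using card_sym_diff_le_iff[of "W - {w}" E] n(1) by simp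
  qed
  have "W \<inter> E \<noteq> {}"
  proof
    assume "W \<inter> E = {}"
    then have "(W - {Max W}) \<inter> E = {}" by blast
    then show False using adj[OF Wq(5)] n(3) by simp
  qed
  then obtain w where w: "w \<in> W" "w \<in> E" by blast
  have "(W - {w}) \<inter> E = (W \<inter> E) - {w}" by blast
  then have "card ((W - {w}) \<inter> E) = card (W \<inter> E) - 1"
    using w Wq(3) by simp
  then have le: "card E \<le> 2 * (card (W \<inter> E) - 1)" using adj[OF w(1)] by simp
  show "card E \<le> 3" by (rule n(4))
  have cle: "card (W \<inter> E) \<le> card E" using n(1) by (intro card_mono) auto
  then show "2 \<le> card E" using le n(3) by linarith
  show "E \<subseteq> W"
  proof (rule ccontr)
    assume "\<not> E \<subseteq> W"
    then have "card (W \<inter> E) < card E" using n(1) by (intro psubset_card_mono) auto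
    then show False using le n(3,4) by linarith
  qed
qed

lemma tri_same:
  assumes \<tau>: "\<tau> \<in> K" "{} \<in> \<tau>" and W: "W \<in> quads" "tri W \<subseteq> \<tau>" and W': "W' \<in> quads" "tri W' \<subseteq> \<tau>"
  shows "W' = W"
proof -
  have "E \<subseteq> W" if "E \<in> tri W'" for E
  proof -
    have "E \<noteq> {}" using card_tri[OF W'(1) that] by auto
    then show ?thesis using tri_link(1)[OF \<tau> W] W'(2) that by blast
  qed
  then have "\<Union>(tri W') \<subseteq> W" by blast
  then have "W' \<subseteq> W" using Union_tri[of W'] quadsD(2)[OF W'(1)] by simp
  then show ?thesis using quadsD[OF W(1)] quadsD[OF W'(1)] by (intro card_subset_eq) auto
qed

lemma with_added_A:
  assumes "\<tau> \<in> KK G" "with_added \<subseteq> G" "{} \<in> \<tau>" "E \<in> \<tau>"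
  shows "E \<subseteq> A"
proof (rule ccontr)
  assume "\<not> E \<subseteq> A"
  then have "{{},E} \<in> G" using assms(2) by (auto simp: with_added_def)
  then show False using KK_not[OF assms(1)] assms(3,4) by blast
qed

text \<open>Among the pairs and triples in \<open>W\<close>, the only one not adjacent to \<open>W - {Max W, r}\<close> is \<open>{Max W, r}\<close>.
  So \<open>W - {Max W, r}\<close> is an apex as soon as \<open>{Max W, r}\<close> is absent.\<close>

lemma collapse_KK_quads:
  assumes F: "F \<subseteq> Pow (Pow {1..m})"
    and a: "\<And>\<sigma>. \<sigma> \<in> F \<Longrightarrow> \<exists>W\<in>quads. \<exists>r\<in>W - {Max W}. insert {} (tri W) \<subseteq> \<sigma> \<and>
      (\<forall>\<tau>\<in>KK G. \<sigma> \<subseteq> \<tau> \<longrightarrow> {Max W, r} \<notin> \<tau>)"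
    and b: "\<And>\<sigma>. \<sigma> \<in> G \<union> F \<Longrightarrow> \<sigma> \<in> with_added \<or> quad_pattern \<sigma>"
  shows "collapse (\<lambda>\<sigma>. {} \<in> \<sigma>) (KK G) (KK (G \<union> F))"
proof (rule collapse_KK[OF F])
  show "{} \<in> \<sigma>" if "\<sigma> \<in> F" for \<sigma> using a[OF that] by blast
  fix \<sigma> assume \<sigma>: "\<sigma> \<in> F"
  obtain W r where W: "W \<in> quads" and r: "r \<in> W - {Max W}" and tri: "insert {} (tri W) \<subseteq> \<sigma>"
    and no: "\<forall>\<tau>\<in>KK G. \<sigma> \<subseteq> \<tau> \<longrightarrow> {Max W, r} \<notin> \<tau>" using a[OF \<sigma>] by blast
  obtain s t where st: "W = {r,s,t,Max W}" "distinct [r,s,t,Max W]" "W - {Max W, r} = {s,t}"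
    using quads_split[OF W r] by blast
  note Wq = quadsD[OF W]
  let ?v = "{s,t}"
  have stW: "?v \<subseteq> W" using st(3) by blast
  have vV: "?v \<in> V" using V_subset_A[of ?v] stW Wq(1) by blast
  have vtri: "?v \<notin> tri W'" if "W' \<in> quads" for W'
  proof
    assume "?v \<in> tri W'"
    then have "card ?v = 3" by (rule card_tri[OF that])
    then show False using st(2) by simp
  qed
  \<comment> \<open>By \<open>tri_same\<close> a completed pattern belongs to the same
    \<open>W\<close>, so \<open>?v\<close> would have to contain \<open>Max W\<close>; but
    \<open>s\<close> and \<open>t\<close> differ from \<open>Max W\<close>.\<close>
  have nopat: "\<not> \<sigma>' \<subseteq> insert ?v \<tau>"
    if \<tau>: "\<tau> \<in> K" "\<sigma> \<subseteq> \<tau>" and \<sigma>': "\<sigma>' \<in> G \<union> F" "?v \<in> \<sigma>'" for \<tau> \<sigma>'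
  proof
    assume sub: "\<sigma>' \<subseteq> insert ?v \<tau>"
    have "\<sigma>' \<notin> with_added"
    proof
      assume "\<sigma>' \<in> with_added"
      then obtain E where "\<sigma>' = {{},E}" "\<not> E \<subseteq> A" by (auto simp: with_added_def)
      then show False using \<sigma>'(2) stW Wq(1) by auto
    qed
    then obtain W' where W': "W' \<in> quads" "insert {} (tri W') \<subseteq> \<sigma>'"
      "\<sigma>' \<subseteq> insert {} (tri W' \<union> (\<lambda>w. {Max W', w}) ` W')" using b[OF \<sigma>'(1)] unfolding quad_pattern_def by blast
    have "tri W' \<subseteq> \<tau>" using W'(2) sub vtri[OF W'(1)] by blast
    then have "W' = W" using tri_same[of \<tau> W W'] \<tau> tri W W'(1) by blast
    then have "?v \<in> (\<lambda>w. {Max W, w}) ` W" using W'(3) \<sigma>'(2) vtri[OF W] by blast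
    then have "Max W \<in> ?v" by auto
    then show False using st(2) by auto
  qed
  have adj: "card (sym_diff ?v E) \<le> 3" if \<tau>: "\<tau> \<in> KK G" "\<sigma> \<subseteq> \<tau>" and E: "E \<in> \<tau>" "E \<noteq> {}" for \<tau> E
  proof -
    have \<tau>K: "\<tau> \<in> K" "{} \<in> \<tau>" "tri W \<subseteq> \<tau>" using KK_K[OF \<tau>(1)] \<tau>(2) tri by blast+
    note l = tri_link[OF \<tau>K(1,2) W \<tau>K(3) E]
    have fE: "finite E" using nbr(1)[OF \<tau>K(1,2) E] .
    have "s \<in> E \<or> t \<in> E"
    proof (rule ccontr)
      assume "\<not> ?thesis"
      then have "E \<subseteq> {Max W, r}" using l(1) st(1) by blast
      moreover have "card {Max W, r} = 2" using r by auto
      ultimately have "E = {Max W, r}"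
        using l(2) card_mono[of "{Max W, r}" E] by (intro card_subset_eq) auto
      then show False using no \<tau> E(1) by blast
    qed
    then have "card E \<le> 1 + 2 * (of_bool (s \<in> E) + of_bool (t \<in> E))" using l(3) by auto
    then show ?thesis using adj_pair[OF fE, of s t] st(2) by simp
  qed
  have "?v \<notin> \<sigma>"
  proof
    assume v\<sigma>: "?v \<in> \<sigma>"
    have "\<sigma> \<notin> with_added"
    proof
      assume "\<sigma> \<in> with_added"
      then obtain E where "\<sigma> = {{},E}" "\<not> E \<subseteq> A" by (auto simp: with_added_def)
      then show False using v\<sigma> stW Wq(1) by auto
    qed
    then obtain W' where W': "W' \<in> quads" "insert {} (tri W') \<subseteq> \<sigma>"
      "\<sigma> \<subseteq> insert {} (tri W' \<union> (\<lambda>w. {Max W', w}) ` W')" using b[of \<sigma>] \<sigma> unfolding quad_pattern_def by blast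
    have "tri W \<subseteq> tri W'"
    proof
      fix E assume E: "E \<in> tri W"
      have "E \<noteq> {Max W', w}" for w
      proof
        assume "E = {Max W', w}"
        then have "card E \<le> 2" by (simp add: card_insert_if)
        then show False using card_tri[OF W E] by simp
      qed
      moreover have "E \<noteq> {}" using card_tri[OF W E] by auto
      ultimately show "E \<in> tri W'" using W'(3) tri E by blast
    qed
    then have "\<Union>(tri W) \<subseteq> \<Union>(tri W')" by (rule Union_mono)
    then have "W \<subseteq> W'" using Union_tri[of W] Union_tri[of W'] Wq(2) quadsD(2)[OF W'(1)] by simp
    then have "W' = W" using Wq(2) quadsD(2,3)[OF W'(1)] by (metis card_subset_eq)
    then have "?v \<in> (\<lambda>w. {Max W, w}) ` W" using W'(3) v\<sigma> vtri[OF W] by blast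
    then have "Max W \<in> ?v" by auto
    then show False using st(2) by auto
  qed
  then show "\<exists>v\<in>V. card v \<le> 3 \<and> v \<notin> \<sigma> \<and> (\<forall>\<tau>\<in>KK G. \<sigma> \<subseteq> \<tau> \<longrightarrow>
      (\<forall>E\<in>\<tau>. E \<noteq> {} \<longrightarrow> card (sym_diff v E) \<le> 3) \<and>
      (\<forall>\<sigma>'\<in>G \<union> F. v \<in> \<sigma>' \<longrightarrow> \<not> \<sigma>' \<subseteq> insert v \<tau>))"
    using vV adj nopat KK_K by (intro bexI[of _ ?v] conjI ballI impI) (auto simp: card_insert_if)
qed

lemma tri_Pow: "W \<in> quads \<Longrightarrow> tri W \<subseteq> Pow {1..m}"
  using quadsD(1) A_sub by (fastforce simp: tri_def)

lemma pair_Pow: "W \<in> quads \<Longrightarrow> w \<in> W \<Longrightarrow> {Max W, w} \<subseteq> {1..m}"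
  using quadsD(1,5) A_sub by blast

lemma crit7s_shape: "\<sigma> \<in> crit7s \<Longrightarrow> quad_pattern \<sigma>"
  unfolding quad_pattern_def crit7s_def crit7_def by blast

lemma quads_two_shape: "\<sigma> \<in> quads_two \<Longrightarrow> quad_pattern \<sigma>"
  unfolding quad_pattern_def quads_two_def by blast

lemma quads_one_shape: "\<sigma> \<in> quads_one \<Longrightarrow> quad_pattern \<sigma>"
  unfolding quad_pattern_def quads_one_def by blast

lemma quads_none_shape: "\<sigma> \<in> quads_none \<Longrightarrow> quad_pattern \<sigma>"
  unfolding quad_pattern_def quads_none_def by blast

lemma shape_Pow:
  assumes "quad_pattern \<sigma>"
  shows "\<sigma> \<in> Pow (Pow {1..m})"
proof -
  obtain W where W: "W \<in> quads" "\<sigma> \<subseteq> insert {} (tri W \<union> (\<lambda>w. {Max W, w}) ` W)"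
    using assms unfolding quad_pattern_def by blast
  have "(\<lambda>w. {Max W, w}) ` W \<subseteq> Pow {1..m}" using pair_Pow[OF W(1)] by blast
  then have "insert {} (tri W \<union> (\<lambda>w. {Max W, w}) ` W) \<subseteq> Pow {1..m}" using tri_Pow[OF W(1)] by simp
  then show ?thesis using W(2) by (meson PowI subset_trans)
qed

text \<open>The apex needs an absent pair through \<open>Max W\<close>: with two of the three such
  pairs present, the third would complete the deleted \<open>crit7 W\<close>. With one or none
  present, a further pair is excluded by the preceding family in the same way.\<close>

lemma collapse_quads_two: "collapse (\<lambda>\<sigma>. {} \<in> \<sigma>) (KK (with_added \<union> crit7s)) (KK (with_added \<union> crit7s \<union> quads_two))"
proof (rule collapse_KK_quads)
  show "quads_two \<subseteq> Pow (Pow {1..m})" using quads_two_shape shape_Pow by blast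
  show "\<sigma> \<in> with_added \<or> quad_pattern \<sigma>"
    if "\<sigma> \<in> with_added \<union> crit7s \<union> quads_two" for \<sigma> using that crit7s_shape quads_two_shape by blast
  fix \<sigma> assume "\<sigma> \<in> quads_two"
  then obtain W s t where W: "W \<in> quads" "\<sigma> = insert {} (tri W \<union> {{Max W,s},{Max W,t}})"
    "s \<in> W - {Max W}" "t \<in> W - {Max W}" "s \<noteq> t" unfolding quads_two_def by blast
  obtain s' t' where st: "W = {s,s',t',Max W}" "distinct [s,s',t',Max W]" "W - {Max W, s} = {s',t'}"
    by (rule quads_split[OF W(1,3)])
  have "t \<in> {s',t'}" using W(4,5) st(3) by blast
  then obtain r where r: "W = {s,t,r,Max W}" "r \<in> W - {Max W}"
  proof (elim insertE emptyE)
    assume "t = s'"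
    moreover have "t' \<in> W - {Max W}" using st by auto
    ultimately show thesis using st(1) that[of t'] by simp
  next
    assume "t = t'"
    moreover have "s' \<in> W - {Max W}" using st by auto
    ultimately show thesis using st(1) that[of s'] by (simp add: insert_commute)
  qed
  have "{Max W, r} \<notin> \<tau>" if "\<tau> \<in> KK (with_added \<union> crit7s)" "\<sigma> \<subseteq> \<tau>" for \<tau>
  proof
    assume "{Max W, r} \<in> \<tau>"
    moreover have "W - {Max W} \<subseteq> {s,t,r}" using r(1) by blast
    ultimately have "crit7 W \<subseteq> \<tau>" using W(2) that(2) unfolding crit7_def by blast
    then show False using KK_not[OF that(1), of "crit7 W"] W(1) by (auto simp: crit7s_def)
  qed
  then show "\<exists>W\<in>quads. \<exists>r\<in>W - {Max W}. insert {} (tri W) \<subseteq> \<sigma> \<and>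
      (\<forall>\<tau>\<in>KK (with_added \<union> crit7s). \<sigma> \<subseteq> \<tau> \<longrightarrow> {Max W, r} \<notin> \<tau>)"
    using W(1,2) r(2) by blast
qed

lemma collapse_quads_one: "collapse (\<lambda>\<sigma>. {} \<in> \<sigma>) (KK (with_added \<union> crit7s \<union> quads_two)) (KK (with_added \<union> crit7s \<union> quads_two \<union> quads_one))"
proof (rule collapse_KK_quads)
  show "quads_one \<subseteq> Pow (Pow {1..m})" using quads_one_shape shape_Pow by blast
  show "\<sigma> \<in> with_added \<or> quad_pattern \<sigma>"
    if "\<sigma> \<in> with_added \<union> crit7s \<union> quads_two \<union> quads_one" for \<sigma> using that crit7s_shape quads_two_shape quads_one_shape by blast
  fix \<sigma> assume "\<sigma> \<in> quads_one"
  then obtain W t where W: "W \<in> quads" "\<sigma> = insert {} (tri W \<union> {{Max W,t}})" "t \<in> W - {Max W}"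
    unfolding quads_one_def by blast
  obtain r r' where rr: "W = {t,r,r',Max W}" "distinct [t,r,r',Max W]" by (rule quads_split[OF W(1,3)])
  have r: "r \<in> W - {Max W}" "r \<noteq> t" using rr by auto
  have "{Max W, r} \<notin> \<tau>" if "\<tau> \<in> KK (with_added \<union> crit7s \<union> quads_two)" "\<sigma> \<subseteq> \<tau>" for \<tau>
  proof
    assume "{Max W, r} \<in> \<tau>"
    then have "insert {} (tri W \<union> {{Max W,r},{Max W,t}}) \<subseteq> \<tau>" using W(2) that(2) by blast
    moreover have "insert {} (tri W \<union> {{Max W,r},{Max W,t}}) \<in> quads_two" using W(1,3) r unfolding quads_two_def by blast
    ultimately show False using KK_not[OF that(1)] by blast
  qed
  then show "\<exists>W\<in>quads. \<exists>r\<in>W - {Max W}. insert {} (tri W) \<subseteq> \<sigma> \<and>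
      (\<forall>\<tau>\<in>KK (with_added \<union> crit7s \<union> quads_two). \<sigma> \<subseteq> \<tau> \<longrightarrow> {Max W, r} \<notin> \<tau>)"
    using W(1,2) r(1) by blast
qed

lemma collapse_quads_none: "collapse (\<lambda>\<sigma>. {} \<in> \<sigma>) (KK (with_added \<union> crit7s \<union> quads_two \<union> quads_one)) (KK (with_added \<union> crit7s \<union> quads_two \<union> quads_one \<union> quads_none))"
proof (rule collapse_KK_quads)
  show "quads_none \<subseteq> Pow (Pow {1..m})" using quads_none_shape shape_Pow by blast
  show "\<sigma> \<in> with_added \<or> quad_pattern \<sigma>"
    if "\<sigma> \<in> with_added \<union> crit7s \<union> quads_two \<union> quads_one \<union> quads_none" for \<sigma> using that crit7s_shape quads_two_shape quads_one_shape quads_none_shape by blast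
  fix \<sigma> assume "\<sigma> \<in> quads_none"
  then obtain W where W: "W \<in> quads" "\<sigma> = insert {} (tri W)" unfolding quads_none_def by blast
  obtain r where r: "r \<in> W - {Max W}" using quads_other[OF W(1)] by blast
  have "{Max W, r} \<notin> \<tau>" if "\<tau> \<in> KK (with_added \<union> crit7s \<union> quads_two \<union> quads_one)" "\<sigma> \<subseteq> \<tau>" for \<tau>
  proof
    assume "{Max W, r} \<in> \<tau>"
    then have "insert {} (tri W \<union> {{Max W,r}}) \<subseteq> \<tau>" using W(2) that(2) by blast
    moreover have "insert {} (tri W \<union> {{Max W,r}}) \<in> quads_one" using W(1) r unfolding quads_one_def by blast
    ultimately show False using KK_not[OF that(1)] by blast
  qed
  then show "\<exists>W\<in>quads. \<exists>r\<in>W - {Max W}. insert {} (tri W) \<subseteq> \<sigma> \<and>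
      (\<forall>\<tau>\<in>KK (with_added \<union> crit7s \<union> quads_two \<union> quads_one). \<sigma> \<subseteq> \<tau> \<longrightarrow> {Max W, r} \<notin> \<tau>)"
    using W r by blast
qed

abbreviation "quad_patterns \<equiv> with_added \<union> crit7s \<union> quads_two \<union> quads_one \<union> quads_none"

lemma single_notin_quad_patterns:
  assumes "x \<in> A" "\<sigma> \<in> quad_patterns"
  shows "{x} \<notin> \<sigma>"
proof (cases "\<sigma> \<in> with_added")
  case True
  then show ?thesis using assms(1) by (auto simp: with_added_def)
next
  case False
  have tri1: "{x} \<notin> tri W" if "W \<in> quads" for W
    using card_tri[OF that, of "{x}"] by auto
  have pair: "{x} \<noteq> {Max W, w}" if "w \<in> W - {Max W}" for w W using that by auto
  from False assms(2) consider "\<sigma> \<in> crit7s" | "\<sigma> \<in> quads_two" | "\<sigma> \<in> quads_one" | "\<sigma> \<in> quads_none" by blast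
  then show ?thesis
  proof cases
    case 1
    then obtain W where W: "W \<in> quads" "\<sigma> = crit7 W" unfolding crit7s_def by blast
    show ?thesis
    proof
      assume "{x} \<in> \<sigma>"
      then show False using tri1[OF W(1)] pair[of _ W] unfolding W(2) crit7_def by (elim insertE UnE imageE) simp_all
    qed
  next
    case 2
    then obtain W s t where W: "W \<in> quads" "\<sigma> = insert {} (tri W \<union> {{Max W,s},{Max W,t}})"
      "s \<in> W - {Max W}" "t \<in> W - {Max W}" unfolding quads_two_def by blast
    then show ?thesis using tri1[OF W(1)] pair[OF W(3)] pair[OF W(4)] by simp
  next
    case 3
    then obtain W t where W: "W \<in> quads" "\<sigma> = insert {} (tri W \<union> {{Max W,t}})" "t \<in> W - {Max W}"
      unfolding quads_one_def by blast
    then show ?thesis using tri1[OF W(1)] pair[OF W(3)] by simp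
  next
    case 4
    then obtain W where W: "W \<in> quads" "\<sigma> = insert {} (tri W)" unfolding quads_none_def by blast
    then show ?thesis using tri1[OF W(1)] by simp
  qed
qed

lemma single_notin:
  assumes "x \<in> A" "\<sigma> \<in> quad_patterns \<union> triple_stars \<union> triple_pairs \<union> triple_singles \<union> {{{}}}"
  shows "{x} \<notin> \<sigma>"
proof (cases "\<sigma> \<in> quad_patterns")
  case True
  then show ?thesis using single_notin_quad_patterns assms(1) by blast
next
  case False
  have "{x} \<noteq> {a,b,c}" if "a \<noteq> b" for a b c using that by auto
  then show ?thesis
    using False assms(2) unfolding triple_stars_def triple_pairs_def triple_singles_def by auto
qed

text \<open>For three-element sets, distance at most 3 means at least two common elements.\<close>

lemma adj3:
  assumes "\<tau> \<in> K" "E \<in> \<tau>" "card E = 3" "{r,s,t} \<in> \<tau>" "distinct [r,s,t]" "r \<notin> E"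
  shows "s \<in> E" "t \<in> E"
proof -
  have fE: "finite E" using assms(3) card_ge_0_finite by force
  have "card (sym_diff {r,s,t} E) \<le> 3" using K_D(2)[OF assms(1,4,2)] .
  then have "(3::nat) \<le> 2 * (of_bool (s \<in> E) + of_bool (t \<in> E))"
    using adj_triple[OF fE, of r s t] assms(3,5,6) by simp
  then show "s \<in> E" "t \<in> E" by (cases "s \<in> E"; cases "t \<in> E"; simp)+
qed

text \<open>Apex \<open>{r}\<close>: a triple without \<open>r\<close> adjacent to the three given
  ones is \<open>{a,b,c}\<close>, which completes \<open>tri {r,a,b,c}\<close>, a pattern of
  \<open>quads_none\<close>.\<close>

lemma collapse_triple_stars: "collapse (\<lambda>\<sigma>. {} \<in> \<sigma>) (KK quad_patterns) (KK (quad_patterns \<union> triple_stars))"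
proof (rule collapse_KK_singleton)
  show "triple_stars \<subseteq> Pow (Pow {1..m})" unfolding triple_stars_def using A_sub by auto
  show "\<And>\<sigma>. \<sigma> \<in> triple_stars \<Longrightarrow> {} \<in> \<sigma>" by (auto simp: triple_stars_def)
  show "\<And>\<sigma> x. x \<in> A \<Longrightarrow> \<sigma> \<in> quad_patterns \<union> triple_stars \<Longrightarrow> {x} \<notin> \<sigma>" using single_notin by blast
  fix \<sigma> assume "\<sigma> \<in> triple_stars"
  then obtain r a b c where \<sigma>: "\<sigma> = {{},{r,a,b},{r,a,c},{r,b,c}}" and A: "{r,a,b,c} \<subseteq> A"
    and d: "distinct [r,a,b,c]" unfolding triple_stars_def by blast
  have "r \<in> E" if \<tau>: "\<tau> \<in> KK quad_patterns" "\<sigma> \<subseteq> \<tau>" "E \<in> \<tau>" "card E = 3" for \<tau> E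
  proof (rule ccontr)
    assume nr: "r \<notin> E"
    have \<tau>': "{r,a,b} \<in> \<tau>" "{r,a,c} \<in> \<tau>" "{r,b,c} \<in> \<tau>" "{} \<in> \<tau>" using \<tau>(2) \<sigma> by blast+
    note \<tau>K = KK_K[OF \<tau>(1)]
    have "a \<in> E" "b \<in> E" using adj3[OF \<tau>K \<tau>(3,4) \<tau>'(1) _ nr] d by auto
    moreover have "c \<in> E" using adj3[OF \<tau>K \<tau>(3,4) \<tau>'(2) _ nr] d by auto
    ultimately have "E = {a,b,c}" using card_three_eq[OF \<tau>(4), of a b c] d by simp
    then have "insert {} (tri {r,a,b,c}) \<subseteq> \<tau>" using tri_4[OF d] \<tau>' \<tau>(3) by simp
    moreover have "{r,a,b,c} \<in> quads" using A d by (simp add: quads_def)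
    then have "insert {} (tri {r,a,b,c}) \<in> quads_none" unfolding quads_none_def by blast
    ultimately show False using KK_not[OF \<tau>(1)] by blast
  qed
  then show "\<exists>x\<in>A. \<forall>\<tau>\<in>KK quad_patterns. \<sigma> \<subseteq> \<tau> \<longrightarrow> (\<forall>E\<in>\<tau>. card E = 3 \<longrightarrow> x \<in> E)"
    using A by blast
qed

text \<open>Apex \<open>{r}\<close>: a triple without \<open>r\<close> would be
  \<open>{s,t,x}\<close>, and then \<open>{s,r,t}\<close>, \<open>{s,r,x}\<close>,
  \<open>{s,t,x}\<close> form a deleted star at \<open>s\<close>.\<close>

lemma collapse_triple_pairs: "collapse (\<lambda>\<sigma>. {} \<in> \<sigma>) (KK (quad_patterns \<union> triple_stars)) (KK (quad_patterns \<union> triple_stars \<union> triple_pairs))"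
proof (rule collapse_KK_singleton)
  show "triple_pairs \<subseteq> Pow (Pow {1..m})" unfolding triple_pairs_def using A_sub by auto
  show "\<And>\<sigma>. \<sigma> \<in> triple_pairs \<Longrightarrow> {} \<in> \<sigma>" by (auto simp: triple_pairs_def)
  show "\<And>\<sigma> x. x \<in> A \<Longrightarrow> \<sigma> \<in> quad_patterns \<union> triple_stars \<union> triple_pairs \<Longrightarrow> {x} \<notin> \<sigma>" using single_notin by blast
  fix \<sigma> assume "\<sigma> \<in> triple_pairs"
  then obtain r s t x where \<sigma>: "\<sigma> = {{},{r,s,t},{r,s,x}}" and A: "{r,s,t,x} \<subseteq> A"
    and d: "distinct [r,s,t,x]" unfolding triple_pairs_def by blast
  have "r \<in> E" if \<tau>: "\<tau> \<in> KK (quad_patterns \<union> triple_stars)" "\<sigma> \<subseteq> \<tau>" "E \<in> \<tau>" "card E = 3" for \<tau> E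
  proof (rule ccontr)
    assume nr: "r \<notin> E"
    have \<tau>': "{r,s,t} \<in> \<tau>" "{r,s,x} \<in> \<tau>" "{} \<in> \<tau>" using \<tau>(2) \<sigma> by blast+
    note \<tau>K = KK_K[OF \<tau>(1)]
    have "s \<in> E" "t \<in> E" using adj3[OF \<tau>K \<tau>(3,4) \<tau>'(1) _ nr] d by auto
    moreover have "x \<in> E" using adj3[OF \<tau>K \<tau>(3,4) \<tau>'(2) _ nr] d by auto
    ultimately have "E = {s,t,x}" using card_three_eq[OF \<tau>(4), of s t x] d by simp
    then have "{{},{s,r,t},{s,r,x},{s,t,x}} \<subseteq> \<tau>" using \<tau>' \<tau>(3) by (simp add: insert_commute)
    moreover have "{s,r,t,x} \<subseteq> A \<and> distinct [s,r,t,x]" using A d by auto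
    then have "{{},{s,r,t},{s,r,x},{s,t,x}} \<in> triple_stars" unfolding triple_stars_def by blast
    ultimately show False using KK_not[OF \<tau>(1)] by blast
  qed
  then show "\<exists>x\<in>A. \<forall>\<tau>\<in>KK (quad_patterns \<union> triple_stars). \<sigma> \<subseteq> \<tau> \<longrightarrow> (\<forall>E\<in>\<tau>. card E = 3 \<longrightarrow> x \<in> E)"
    using A by blast
qed

text \<open>Apex \<open>{r}\<close>: a triple without \<open>r\<close> has the form
  \<open>{s,t,x}\<close>. Its third element lies in \<open>A\<close> because edges from
  \<open>{}\<close> to vertices with added elements are gone, so with \<open>{s,t,r}\<close> it
  forms a pattern of \<open>triple_pairs\<close>.\<close>

lemma collapse_triple_singles: "collapse (\<lambda>\<sigma>. {} \<in> \<sigma>) (KK (quad_patterns \<union> triple_stars \<union> triple_pairs)) (KK (quad_patterns \<union> triple_stars \<union> triple_pairs \<union> triple_singles))"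
proof (rule collapse_KK_singleton)
  show "triple_singles \<subseteq> Pow (Pow {1..m})" unfolding triple_singles_def using A_sub by auto
  show "\<And>\<sigma>. \<sigma> \<in> triple_singles \<Longrightarrow> {} \<in> \<sigma>" by (auto simp: triple_singles_def)
  show "\<And>\<sigma> x. x \<in> A \<Longrightarrow> \<sigma> \<in> quad_patterns \<union> triple_stars \<union> triple_pairs \<union> triple_singles \<Longrightarrow> {x} \<notin> \<sigma>" using single_notin by blast
  fix \<sigma> assume "\<sigma> \<in> triple_singles"
  then obtain r s t where \<sigma>: "\<sigma> = {{},{r,s,t}}" and A: "{r,s,t} \<subseteq> A"
    and d: "distinct [r,s,t]" unfolding triple_singles_def by blast
  have "r \<in> E" if \<tau>: "\<tau> \<in> KK (quad_patterns \<union> triple_stars \<union> triple_pairs)" "\<sigma> \<subseteq> \<tau>" "E \<in> \<tau>" "card E = 3" for \<tau> E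
  proof (rule ccontr)
    assume nr: "r \<notin> E"
    have \<tau>': "{r,s,t} \<in> \<tau>" "{} \<in> \<tau>" using \<tau>(2) \<sigma> by blast+
    have st: "s \<in> E" "t \<in> E" using adj3[OF KK_K[OF \<tau>(1)] \<tau>(3,4) \<tau>'(1) d nr] .
    have "card {s,t} = 2" using d by simp
    have "E \<noteq> {s,t}" using \<tau>(4) \<open>card {s,t} = 2\<close> by auto
    then obtain x where x: "x \<in> E" "x \<notin> {s,t}" using st by blast
    then have "E = {s,t,x}" using card_three_eq[OF \<tau>(4) st x(1)] d by auto
    have "E \<subseteq> A" using with_added_A[OF \<tau>(1) _ \<tau>'(2) \<tau>(3)] by blast
    then have "x \<in> A" using x(1) by blast
    moreover have "x \<noteq> r" using x(1) nr by blast
    ultimately have "{s,t,r,x} \<subseteq> A \<and> distinct [s,t,r,x]" using A d x(2) by auto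
    then have "{{},{s,t,r},{s,t,x}} \<in> triple_pairs" unfolding triple_pairs_def by blast
    moreover have "{{},{s,t,r},{s,t,x}} \<subseteq> \<tau>"
      using \<tau>' \<tau>(3) \<open>E = {s,t,x}\<close> by (simp add: insert_commute)
    ultimately show False using KK_not[OF \<tau>(1)] by blast
  qed
  then show "\<exists>x\<in>A. \<forall>\<tau>\<in>KK (quad_patterns \<union> triple_stars \<union> triple_pairs). \<sigma> \<subseteq> \<tau> \<longrightarrow> (\<forall>E\<in>\<tau>. card E = 3 \<longrightarrow> x \<in> E)"
    using A by blast
qed

text \<open>\<open>{{{}}}\<close> is the family whose only face is the vertex \<open>{{}}\<close>.
  No three-element neighbour of \<open>{}\<close> is left, so any \<open>{x}\<close> with
  \<open>x \<in> A\<close> is an apex; \<open>{h}\<close> is taken.\<close>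

lemma collapse_last_vertex: "collapse (\<lambda>\<sigma>. {} \<in> \<sigma>) (KK (quad_patterns \<union> triple_stars \<union> triple_pairs \<union> triple_singles)) (KK (quad_patterns \<union> triple_stars \<union> triple_pairs \<union> triple_singles \<union> {{{}}}))"
proof (rule collapse_KK_singleton)
  show "\<And>\<sigma> x. x \<in> A \<Longrightarrow> \<sigma> \<in> quad_patterns \<union> triple_stars \<union> triple_pairs \<union> triple_singles \<union> {{{}}} \<Longrightarrow> {x} \<notin> \<sigma>" using single_notin by blast
  fix \<sigma> :: "nat set set" assume "\<sigma> \<in> {{{}}}"
  have "card E \<noteq> 3" if \<tau>: "\<tau> \<in> KK (quad_patterns \<union> triple_stars \<union> triple_pairs \<union> triple_singles)" "\<sigma> \<subseteq> \<tau>" "E \<in> \<tau>" for \<tau> E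
  proof
    assume "card E = 3"
    then obtain r s t where E: "E = {r,s,t}" "distinct [r,s,t]" by (auto simp: card_3_iff)
    have e: "{} \<in> \<tau>" using \<open>\<sigma> \<in> {{{}}}\<close> \<tau>(2) by simp
    have "E \<subseteq> A" using with_added_A[OF \<tau>(1) _ e \<tau>(3)] by blast
    then have "{{},E} \<in> triple_singles" unfolding triple_singles_def using E by blast
    then show False using KK_not[OF \<tau>(1)] e \<tau>(3) by blast
  qed
  then show "\<exists>x\<in>A. \<forall>\<tau>\<in>KK (quad_patterns \<union> triple_stars \<union> triple_pairs \<union> triple_singles). \<sigma> \<subseteq> \<tau> \<longrightarrow> (\<forall>E\<in>\<tau>. card E = 3 \<longrightarrow> x \<in> E)"
    using h_A by blast
qed auto

section \<open>The complex without the last vertex and the critical 7-simplices\<close>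

definition K' :: "nat set set set" where
  "K' = {\<tau>\<in>K. {} \<notin> \<tau>}"

lemma simplicial_K': "simplicial K'"
  unfolding K'_def by (rule simplicial_subset[OF simplicial_K]) (use simplicialD(3)[OF simplicial_K] in blast)+

lemma KK_final: "KK (quad_patterns \<union> triple_stars \<union> triple_pairs \<union> triple_singles \<union> {{{}}}) = K'"
proof -
  have "{} \<in> \<sigma>" if "quad_pattern \<sigma>" for \<sigma> using that by (auto simp: quad_pattern_def)
  moreover have "{} \<in> \<sigma>" if "\<sigma> \<in> with_added \<union> triple_stars \<union> triple_pairs \<union> triple_singles" for \<sigma>
    using that by (auto simp: with_added_def triple_stars_def triple_pairs_def triple_singles_def)
  ultimately have "{} \<in> \<sigma>" if "\<sigma> \<in> quad_patterns \<union> triple_stars \<union> triple_pairs \<union> triple_singles \<union> {{{}}}" for \<sigma>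
    using that crit7s_shape[of \<sigma>] quads_two_shape[of \<sigma>] quads_one_shape[of \<sigma>] quads_none_shape[of \<sigma>] by blast
  then show ?thesis unfolding KK_def K'_def by blast
qed

lemma collapse_to_K': "collapse (\<lambda>\<sigma>. {} \<in> \<sigma>) (KK (with_added \<union> crit7s)) K'"
  using collapse_quads_two collapse_quads_one collapse_quads_none collapse_triple_stars collapse_triple_pairs collapse_triple_singles collapse_last_vertex collapse_trans unfolding KK_final by metis

text \<open>By \<open>tri_link\<close> any further vertex is a pair or a triple inside
  \<open>W\<close>. All triples of \<open>W\<close> belong to \<open>crit7 W\<close>, and a pair
  avoiding \<open>Max W\<close> is disjoint from some \<open>{Max W, r}\<close>, hence at distance
  4.\<close>

lemma crit7_link:
  assumes W: "W \<in> quads" and \<tau>: "\<tau> \<in> K" "crit7 W \<subseteq> \<tau>"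
  shows "\<tau> = crit7 W"
proof -
  note Wq = quadsD[OF W]
  have \<tau>': "{} \<in> \<tau>" "tri W \<subseteq> \<tau>" using \<tau>(2) by (auto simp: crit7_def)
  have "E \<in> crit7 W" if E: "E \<in> \<tau>" for E
  proof (cases "E = {}")
    case False
    note l = tri_link[OF \<tau>(1) \<tau>'(1) W \<tau>'(2) E False]
    have fE: "finite E" using l(1) Wq(3) finite_subset by blast
    consider "card E = 3" | "card E = 2" using l(2,3) by linarith
    then show ?thesis
    proof cases
      case 1
      have "card (W - E) = 1" using 1 Wq(2) l(1) fE by (simp add: card_Diff_subset)
      then obtain w where w: "W - E = {w}" by (auto simp: card_1_singleton_iff)
      then have "E = W - {w}" "w \<in> W" using l(1) by blast+
      then show ?thesis by (auto simp: crit7_def tri_def)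
    next
      case 2
      have "Max W \<in> E"
      proof (rule ccontr)
        assume nm: "Max W \<notin> E"
        have "\<not> W - {Max W} \<subseteq> E"
        proof
          assume "W - {Max W} \<subseteq> E"
          then have "card (W - {Max W}) \<le> 2" using 2 fE card_mono by metis
          then show False using Wq(2,3,5) by simp
        qed
        then obtain r where r: "r \<in> W - {Max W}" "r \<notin> E" by blast
        then have "{Max W, r} \<in> \<tau>" using \<tau>(2) by (auto simp: crit7_def)
        then have "card (sym_diff {Max W, r} E) \<le> 3" using K_D(2)[OF \<tau>(1) _ E] by blast
        then show False using adj_pair[OF fE, of "Max W" r] r nm 2 by auto
      qed
      moreover obtain w where "w \<in> E" "w \<noteq> Max W"
        using 2 by (auto simp: card_2_iff)
      ultimately have "E = {Max W, w}" "w \<in> W - {Max W}" using card_two_eq[OF 2] l(1) by auto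
      then show ?thesis by (auto simp: crit7_def)
    qed
  qed (simp add: crit7_def)
  then show ?thesis using \<tau>(2) by blast
qed

lemma crit7_subset: "W \<in> quads \<Longrightarrow> D \<in> crit7 W \<Longrightarrow> D \<subseteq> W"
  using quadsD(5) by (auto simp: crit7_def tri_def)

lemma Union_crit7: "W \<in> quads \<Longrightarrow> \<Union>(crit7 W) = W"
proof
  assume W: "W \<in> quads"
  have "W \<subseteq> \<Union>(tri W)" using Union_tri[of W] quadsD(2)[OF W] by simp
  then show "W \<subseteq> \<Union>(crit7 W)" by (auto simp: crit7_def)
qed (use crit7_subset in blast)

lemma crit7_member:
  assumes W: "W \<in> quads" and D: "D \<in> crit7 W"
  shows "card D \<in> {0,2,3}" "card D = 2 \<Longrightarrow> Max W \<in> D"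
proof -
  consider "D = {}" | "D \<in> tri W" | w where "w \<in> W - {Max W}" "D = {Max W, w}"
    using D unfolding crit7_def by blast
  then have "card D \<in> {0,2,3} \<and> (card D = 2 \<longrightarrow> Max W \<in> D)"
  proof cases
    case 2
    then show ?thesis using card_tri[OF W] by simp
  next
    case (3 w)
    then have "card D = 2" by auto
    then show ?thesis using 3 by simp
  qed simp
  then show "card D \<in> {0,2,3}" "card D = 2 \<Longrightarrow> Max W \<in> D" by blast+
qed

text \<open>Distance 4 would make \<open>D\<close> and \<open>E\<close> complementary in
  \<open>W\<close>. With sizes 0, 2 and 3 available, both would be pairs, but these share
  \<open>Max W\<close>.\<close>

lemma crit7_dist:
  assumes W: "W \<in> quads" and D: "D \<in> crit7 W" and E: "E \<in> crit7 W"
  shows "card (sym_diff D E) \<le> 3"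
proof (rule ccontr)
  assume gt: "\<not> ?thesis"
  note Wq = quadsD[OF W]
  have DW: "D \<subseteq> W" and EW: "E \<subseteq> W" using crit7_subset[OF W] D E by blast+
  then have sub: "sym_diff D E \<subseteq> W" by blast
  then have "card (sym_diff D E) = card W"
    using card_mono[OF Wq(3) sub] gt Wq(2) by linarith
  then have eq: "sym_diff D E = W" using sub Wq(3) by (intro card_subset_eq)
  then have disj: "D \<inter> E = {}" and un: "D \<union> E = W" using DW by blast+
  have "card D + card E = 4"
    using card_Un_disjoint[of D E] disj un DW EW Wq(2,3) finite_subset by metis
  then have "card D = 2" "card E = 2"
    using crit7_member(1)[OF W D] crit7_member(1)[OF W E] by auto
  then show False using crit7_member(2)[OF W D] crit7_member(2)[OF W E] disj by blast
qed

lemma card_crit7: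
  assumes W: "W \<in> quads"
  shows "card (crit7 W) = 8"
proof -
  note Wq = quadsD[OF W]
  let ?p = "\<lambda>w. {Max W, w}"
  have "inj_on (\<lambda>w. W - {w}) W" by (rule inj_onI) blast
  then have c1: "card (tri W) = 4" unfolding tri_def using Wq(2) by (simp add: card_image)
  have "inj_on ?p (W - {Max W})" by (rule inj_onI) (auto simp: doubleton_eq_iff)
  then have c2: "card (?p ` (W - {Max W})) = 3" using Wq(2,3,5) by (simp add: card_image)
  have two: "card (?p w) = 2" if "w \<in> W - {Max W}" for w using that by auto
  have "tri W \<inter> ?p ` (W - {Max W}) = {}"
  proof -
    have "?p w \<notin> tri W" if "w \<in> W - {Max W}" for w using two[OF that] card_tri[OF W] by fastforce
    then show ?thesis by blast
  qed
  then have "card (tri W \<union> ?p ` (W - {Max W})) = 7"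
    using c1 c2 Wq(3) by (subst card_Un_disjoint) (auto simp: tri_def)
  moreover have "{} \<notin> tri W \<union> ?p ` (W - {Max W})" using card_tri[OF W, of "{}"] by auto
  ultimately show ?thesis unfolding crit7_def using Wq(3) by (simp add: tri_def)
qed

text \<open>In terms of the set \<open>sym_diff A D\<close> itself, elements are deleted one at a
  time. After the first deletion it is smaller than \<open>A\<close>, so every set on the way
  precedes \<open>A\<close>; the path ends at the empty set, which is represented by
  \<open>A\<close>.\<close>

lemma K'_path:
  assumes "D \<in> V" "D \<noteq> {}"
  shows "(\<lambda>u v. {u,v} \<in> K')\<^sup>*\<^sup>* D A"
  using assms
proof (induction "card (sym_diff A D)" arbitrary: D rule: less_induct)
  case less
  let ?S = "sym_diff A D"
  have D: "D \<subseteq> {1..m}" using less.prems by (simp add: V_def)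
  then have finS: "finite ?S" using fin_A finite_subset by blast
  show ?case
  proof (cases "?S = {}")
    case True
    then have "D = A" by blast
    then show ?thesis by simp
  next
    case False
    then obtain s where s: "s \<in> ?S" by blast
    define D' where "D' = sym_diff D {s}"
    have S': "sym_diff A D' = ?S - {s}" using s unfolding D'_def by blast
    have lt: "card (?S - {s}) < card ?S" using s finS by (rule card_Diff1_less[rotated])
    have "set_prec ?S A" using less.prems by (simp add: V_iff)
    then have "card ?S \<le> card A" by (auto simp: set_prec_def)
    then have lt': "card (sym_diff A D') < card A" using lt unfolding S' by linarith
    have "s \<in> {1..m}" using s D A_sub by blast
    then have "D' \<subseteq> {1..m}" using D unfolding D'_def by blast
    then have V': "D' \<in> V" using lt' by (simp add: V_iff set_prec_def)
    have ne: "D' \<noteq> {}" using lt' by auto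
    have "sym_diff D D' = {s}" "sym_diff D' D = {s}" unfolding D'_def by auto
    then have "{D, D'} \<in> K'"
      using less.prems V' ne unfolding K'_def K_def by auto
    moreover have "(\<lambda>u v. {u,v} \<in> K')\<^sup>*\<^sup>* D' A"
      using less.hyps[of D'] lt V' ne unfolding S' by blast
    ultimately show ?thesis by (rule converse_rtranclp_into_rtranclp)
  qed
qed

lemma K'_connected:
  assumes "D \<in> V" "D \<noteq> {}" "E \<in> V" "E \<noteq> {}"
  shows "(\<lambda>u v. {u,v} \<in> K')\<^sup>*\<^sup>* D E"
proof -
  have sym: "(\<lambda>u v. {u,v} \<in> K')\<^sup>*\<^sup>* v u" if "(\<lambda>u v. {u,v} \<in> K')\<^sup>*\<^sup>* u v" for u v
    using that
  proof (induction rule: rtranclp_induct)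
    case (step v w)
    have "{w,v} \<in> K'" using step(2) by (simp add: insert_commute)
    then show ?case using step(3) by (rule converse_rtranclp_into_rtranclp)
  qed simp
  have "(\<lambda>u v. {u,v} \<in> K')\<^sup>*\<^sup>* A E" by (rule sym[OF K'_path[OF assms(3,4)]])
  then show ?thesis using K'_path[OF assms(1,2)] by simp
qed

lemma Union_K': "\<Union>K' = V - {{}}"
proof
  show "\<Union>K' \<subseteq> V - {{}}" by (auto simp: K'_def K_def)
  have "{D} \<in> K'" if "D \<in> V" "D \<noteq> {}" for D using that by (auto simp: K'_def K_def)
  then show "V - {{}} \<subseteq> \<Union>K'" by blast
qed

text \<open>The collapsible part \<open>B\<close> of the cross-polytope on \<open>P\<close> survives
  in \<open>KK G\<close>: a pattern of \<open>G\<close> contained in a simplex of \<open>B\<close>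
  would contain \<open>P\<close>, and no simplex of \<open>B\<close> does. The vertex
  \<open>U\<close>, complementary to \<open>{}\<close>, belongs to \<open>B\<close> and is a vertex
  of \<open>K'\<close>, whose connectedness gives the path to \<open>q\<close>.\<close>

lemma null_boundaryI:
  assumes U: "finite U" "4 \<le> card U" "U \<in> V" and P: "P \<subseteq> Pow U" "{} \<in> P"
    and dist: "\<And>D E. D \<in> P \<Longrightarrow> E \<in> P \<Longrightarrow> D \<noteq> E \<Longrightarrow>
       card (sym_diff D E) \<le> 3 \<and> card U \<le> 3 + card (sym_diff D E)"
    and V: "\<And>D. D \<in> P \<Longrightarrow> D \<in> V \<and> U - D \<in> V"
    and G: "\<And>\<sigma>. \<sigma> \<in> G \<Longrightarrow> {} \<in> \<sigma> \<and> (\<sigma> \<subseteq> P \<union> (\<lambda>D. U - D) ` P \<longrightarrow> P \<subseteq> \<sigma>)"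
    and q: "q \<in> \<Union>K'"
  shows "null_boundary (KK G) q P"
proof -
  have "\<exists>B. simplicial B \<and> collapsible B \<and> {U} \<in> B \<and> (\<forall>\<rho>. \<rho> \<subset> P \<and> \<rho> \<noteq> {} \<longrightarrow> \<rho> \<in> B) \<and>
    (\<forall>\<tau>\<in>B. \<tau> \<subseteq> P \<union> (\<lambda>D. U - D) ` P \<and> \<tau> \<noteq> {} \<and> \<not> P \<subseteq> \<tau> \<and> (\<forall>D\<in>\<tau>. \<forall>E\<in>\<tau>. card (sym_diff D E) \<le> 3))"
    by (rule octahedron_boundary[OF U(1,2) P], rule dist)
  then obtain B where B: "simplicial B" "collapsible B" "{U} \<in> B" "\<forall>\<rho>. \<rho> \<subset> P \<and> \<rho> \<noteq> {} \<longrightarrow> \<rho> \<in> B"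
    and B': "\<forall>\<tau>\<in>B. \<tau> \<subseteq> P \<union> (\<lambda>D. U - D) ` P \<and> \<tau> \<noteq> {} \<and> \<not> P \<subseteq> \<tau> \<and>
      (\<forall>D\<in>\<tau>. \<forall>E\<in>\<tau>. card (sym_diff D E) \<le> 3)"
    by (elim exE conjE)
  have "B \<subseteq> KK G"
  proof
    fix \<tau> assume \<tau>: "\<tau> \<in> B"
    note t = bspec[OF B' \<tau>]
    have tP: "\<tau> \<subseteq> P \<union> (\<lambda>D. U - D) ` P" using t by blast
    have "P \<union> (\<lambda>D. U - D) ` P \<subseteq> V" using V by blast
    then have "\<tau> \<subseteq> V" using tP by (rule subset_trans[rotated])
    then have "\<tau> \<in> K" using t unfolding K_def by simp
    moreover have "\<not> \<sigma> \<subseteq> \<tau>" if "\<sigma> \<in> G" for \<sigma>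
    proof
      assume "\<sigma> \<subseteq> \<tau>"
      then have "P \<subseteq> \<sigma>" using G[OF that] subset_trans[OF _ tP] by simp
      then show False using t \<open>\<sigma> \<subseteq> \<tau>\<close> subset_trans by blast
    qed
    ultimately show "\<tau> \<in> KK G" by (simp add: KK_def)
  qed
  moreover have "(\<lambda>u v. {u,v} \<in> KK G)\<^sup>*\<^sup>* U q"
  proof -
    have "U \<noteq> {}" using U by auto
    then have "(\<lambda>u v. {u,v} \<in> K')\<^sup>*\<^sup>* U q" using K'_connected[of U q] U(3) q unfolding Union_K' by blast
    moreover have "K' \<subseteq> KK G" using G unfolding K'_def KK_def by blast
    ultimately show ?thesis
      by (induction rule: rtranclp_induct) (auto intro: rtranclp.rtrancl_into_rtrancl)
  qed
  ultimately show ?thesis using B unfolding null_boundary_def by blast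
qed

text \<open>Here \<open>U = W\<close>, and since \<open>card W = 4\<close> the lower bound on
  distances only asks for distinct vertices. Among the subsets of \<open>W\<close> there is no added
  element, and \<open>crit7 W'\<close> has union \<open>W'\<close>, so the only pattern to be met
  there is \<open>crit7 W\<close> itself.\<close>

lemma crit7_null:
  assumes W: "W \<in> quads" and q: "q \<in> \<Union>K'"
  shows "null_boundary (KK (with_added \<union> crit7s)) q (crit7 W)"
proof (rule null_boundaryI)
  note Wq = quadsD[OF W]
  show "finite W" "4 \<le> card W" using Wq by simp_all
  show "W \<in> V" using V_subset_A Wq(1) by blast
  show sub: "crit7 W \<subseteq> Pow W" using crit7_subset[OF W] by blast
  show "{} \<in> crit7 W" by (simp add: crit7_def)
  show "card (sym_diff D E) \<le> 3 \<and> card W \<le> 3 + card (sym_diff D E)"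
    if "D \<in> crit7 W" "E \<in> crit7 W" "D \<noteq> E" for D E
  proof -
    have "sym_diff D E \<noteq> {}" using that(3) by blast
    moreover have "D \<subseteq> W" "E \<subseteq> W" using crit7_subset[OF W] that(1,2) by blast+
    then have "finite (sym_diff D E)" using Wq(3) finite_subset by blast
    ultimately have "1 \<le> card (sym_diff D E)" by (metis card_gt_0_iff One_nat_def Suc_leI)
    then show ?thesis using crit7_dist[OF W that(1,2)] Wq(2) by simp
  qed
  show "D \<in> V \<and> W - D \<in> V" if "D \<in> crit7 W" for D
    using V_subset_A[of D] V_subset_A[of "W - D"] crit7_subset[OF W that] Wq(1) by blast
  fix \<sigma> assume \<sigma>: "\<sigma> \<in> with_added \<union> crit7s"
  show "{} \<in> \<sigma> \<and> (\<sigma> \<subseteq> crit7 W \<union> (\<lambda>D. W - D) ` crit7 W \<longrightarrow> crit7 W \<subseteq> \<sigma>)"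
  proof (intro conjI impI)
    show "{} \<in> \<sigma>" using \<sigma> by (auto simp: with_added_def crit7s_def crit7_def)
    assume "\<sigma> \<subseteq> crit7 W \<union> (\<lambda>D. W - D) ` crit7 W"
    then have le: "\<sigma> \<subseteq> Pow W" using sub by blast
    from \<sigma> show "crit7 W \<subseteq> \<sigma>"
    proof
      assume "\<sigma> \<in> with_added"
      then obtain E where "E \<in> \<sigma>" "\<not> E \<subseteq> A" by (auto simp: with_added_def)
      then show ?thesis using le Wq(1) by blast
    next
      assume "\<sigma> \<in> crit7s"
      then obtain W' where W': "W' \<in> quads" "\<sigma> = crit7 W'" by (auto simp: crit7s_def)
      then have "W' \<subseteq> W" using le Union_crit7[OF W'(1)] by blast
      then have "W' = W" using Wq quadsD[OF W'(1)] by (intro card_subset_eq) auto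
      then show ?thesis using W'(2) by simp
    qed
  qed
qed (rule q)

section \<open>The critical 4-simplices and their cross-polytopes\<close>

lemma crit4_explicit:
  assumes b: "b \<in> {1..m} - A" "b < h" and S: "S \<in> triples" "S \<subseteq> {..<b}"
  obtains x y z where "distinct [h,b,x,y,z]" "S = {x,y,z}" "{x,y,z} \<subseteq> A"
    "crit4 b S = {{},{h,b},{x,y,b},{x,z,b},{y,z,b}}"
proof -
  obtain x y z where S3: "S = {x,y,z}" "x \<in> A" "y \<in> A" "z \<in> A" "x \<noteq> y" "x \<noteq> z" "y \<noteq> z"
    "btri b S = {{x,y,b},{x,z,b},{y,z,b}}" using S(1) by (elim triplesE) blast
  have "x < b" "y < b" "z < b" using S(2) S3(1) by auto
  then show thesis using that[of x y z] S3 b by (simp add: crit4_def)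
qed

text \<open>All distances are 2 or 3. The lower bound 2 keeps the complement in a five-element set
  within distance 3.\<close>

lemma crit4_dist:
  assumes b: "b \<in> {1..m} - A" "b < h" and S: "S \<in> triples" "S \<subseteq> {..<b}"
    and DE: "D \<in> crit4 b S" "E \<in> crit4 b S" "D \<noteq> E"
  shows "card (sym_diff D E) \<le> 3 \<and> 5 \<le> 3 + card (sym_diff D E)"
proof -
  have Sf: "finite S" "S \<subseteq> A" "card S = 3" using triples_fin[OF S(1)] S(1) by (auto simp: triples_def)
  have bS: "b \<notin> S" "b \<notin> A" using Sf(2) b by auto
  have hS: "h \<notin> S" "h \<noteq> b" using S(2) b by auto
  have two: "card (S - {s}) = 2" if "s \<in> S" for s using Sf that by simp
  have hb: "card (sym_diff {h,b} F) = 3" if "F \<in> btri b S" for F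
  proof -
    obtain s where s: "s \<in> S" "F = insert b (S - {s})" using \<open>F \<in> btri b S\<close> unfolding btri_def by blast
    have "sym_diff {h,b} F = insert h (S - {s})" using s(2) bS(1) hS by auto
    then show ?thesis using two[OF s(1)] hS(1) Sf(1) by simp
  qed
  have nonempty: "card F \<in> {2,3}" if "F = {h,b} \<or> F \<in> btri b S" for F
    using that hS(2) card_btri[OF S(1) bS(2)] by auto
  have tt: "card (sym_diff F F') = 2" if F: "F \<in> btri b S" "F' \<in> btri b S" "F \<noteq> F'" for F F'
  proof -
    obtain s s' where s: "s \<in> S" "F = insert b (S - {s})" "s' \<in> S" "F' = insert b (S - {s'})"
      using F(1,2) unfolding btri_def by blast
    then have "s \<noteq> s'" using F(3) by blast
    then have "sym_diff F F' = {s,s'}" using s bS(1) by auto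
    then show ?thesis using \<open>s \<noteq> s'\<close> by simp
  qed
  have "D = {} \<or> D = {h,b} \<or> D \<in> btri b S" "E = {} \<or> E = {h,b} \<or> E \<in> btri b S"
    using DE(1,2) by (simp_all add: crit4_def)
  then consider "D = {}" "E = {h,b} \<or> E \<in> btri b S" | "D = {h,b} \<or> D \<in> btri b S" "E = {}"
    | "D = {h,b}" "E \<in> btri b S" | "D \<in> btri b S" "E = {h,b}" | "D \<in> btri b S" "E \<in> btri b S"
    using DE(3) by metis
  then show ?thesis
  proof cases
    case 1
    then show ?thesis using nonempty[of E] by auto
  next
    case 2
    then show ?thesis using nonempty[of D] by auto
  next
    case 3
    then show ?thesis using hb by simp
  next
    case 4
    then show ?thesis using hb[of D] by (simp add: Un_commute)
  next
    case 5
    then show ?thesis using tt DE(3) by simp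
  qed
qed

lemma card_crit4:
  assumes b: "b \<in> {1..m} - A" "b < h" and S: "S \<in> triples" "S \<subseteq> {..<b}"
  shows "card (crit4 b S) = 5"
proof -
  have Sf: "finite S" "S \<subseteq> A" "card S = 3" using triples_fin[OF S(1)] S(1) by (auto simp: triples_def)
  have bS: "b \<notin> S" "b \<notin> A" using Sf(2) b by auto
  have "inj_on (\<lambda>s. insert b (S - {s})) S"
  proof (rule inj_onI)
    fix s s' assume s: "s \<in> S" "s' \<in> S" and eq: "insert b (S - {s}) = insert b (S - {s'})"
    have "s \<notin> insert b (S - {s})" using s(1) bS(1) by auto
    then have "s \<notin> insert b (S - {s'})" unfolding eq .
    then show "s = s'" using s(1) by blast
  qed
  then have "card (btri b S) = 3" unfolding btri_def using Sf(3) by (simp add: card_image)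
  moreover have "{h,b} \<notin> btri b S" "{} \<notin> btri b S"
    using card_btri[OF S(1) bS(2), of "{h,b}"] card_btri[OF S(1) bS(2), of "{}"] b by auto
  moreover have "finite (btri b S)" using Sf(1) by (simp add: btri_def)
  ultimately show ?thesis by (simp add: crit4_def)
qed

text \<open>Two elements of \<open>A\<close> traded for \<open>b\<close> give a smaller set, and
  \<open>{h,b}\<close> replaces \<open>h\<close> by the smaller \<open>b\<close>. Of the complements
  only the full set \<open>insert h (insert b S)\<close> contains \<open>b\<close>, and it trades
  four elements of \<open>A\<close> for one.\<close>

lemma crit4_V:
  assumes b: "b \<in> {1..m} - A" "b < h" and S: "S \<in> triples" "S \<subseteq> {..<b}" and D: "D \<in> crit4 b S"
  shows "D \<in> V \<and> insert h (insert b S) - D \<in> V"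
proof (rule crit4_explicit[OF b S])
  fix x y z assume d: "distinct [h,b,x,y,z]" and S3: "S = {x,y,z}" "{x,y,z} \<subseteq> A"
    and e: "crit4 b S = {{},{h,b},{x,y,b},{x,z,b},{y,z,b}}"
  have xyz: "x \<in> A" "y \<in> A" "z \<in> A" "b \<notin> A" using S3(2) b by auto
  have I: "insert b T \<in> V" if T: "T \<subseteq> A" "2 \<le> card T" for T
  proof (rule V_I)
    show "insert b T \<subseteq> {1..m}" using T(1) b(1) A_sub by blast
    have "insert b T - A = {b}" "insert b T \<inter> A = T" using T(1) xyz(4) by auto
    then show "card (insert b T - A) < card (insert b T \<inter> A)" using T(2) by simp
  qed
  have three: "{x,y,b} \<in> V" "{x,z,b} \<in> V" "{y,z,b} \<in> V"
    using I[of "{x,y}"] I[of "{x,z}"] I[of "{y,z}"] xyz d by (simp_all add: insert_commute)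
  have full: "{h,b,x,y,z} \<in> V"
  proof -
    have "{h,x,y,z} \<subseteq> A" using xyz h_A by simp
    moreover have "2 \<le> card {h,x,y,z}" using d by simp
    ultimately have "insert b {h,x,y,z} \<in> V" by (rule I)
    then show ?thesis by (simp add: insert_commute)
  qed
  have hb: "{h,b} \<in> V" using V_exchange[OF h_A b] .
  have diff: "{h,b,x,y,z} - {} = {h,b,x,y,z}" "{h,b,x,y,z} - {h,b} = {x,y,z}" "{h,b,x,y,z} - {x,y,b} = {h,z}"
    "{h,b,x,y,z} - {x,z,b} = {h,y}" "{h,b,x,y,z} - {y,z,b} = {h,x}"
    using d by auto
  have sub: "{x,y,z} \<in> V" "{h,z} \<in> V" "{h,y} \<in> V" "{h,x} \<in> V"
    using xyz h_A by (auto intro!: V_subset_A)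
  have U: "insert h (insert b S) = {h,b,x,y,z}" using S3(1) by simp
  show ?thesis using D unfolding e U
    by (elim insertE emptyE; simp only: diff three full hb sub empty_V simp_thms)
qed

text \<open>Among the vertices of the cross-polytope, \<open>{h,b}\<close> is the only doubleton
  with an added element, and the triples with an added element are those of \<open>btri b S\<close>.
  So a pattern found there has the same doubleton and the same \<open>S\<close>; since
  \<open>apex b S = h\<close>, it is not one of \<open>added_pairs\<close>.\<close>

lemma crit4_pattern:
  assumes b: "b \<in> {1..m} - A" "b < h" and S: "S \<in> triples" "S \<subseteq> {..<b}"
    and \<sigma>: "\<sigma> \<in> added_pairs \<union> crit4s"
    and le: "\<sigma> \<subseteq> crit4 b S \<union> (\<lambda>D. insert h (insert b S) - D) ` crit4 b S"
  shows "crit4 b S \<subseteq> \<sigma> \<and> \<sigma> \<notin> added_pairs"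
proof (rule crit4_explicit[OF b S])
  fix x y z assume d: "distinct [h,b,x,y,z]" and S3: "S = {x,y,z}" "{x,y,z} \<subseteq> A"
    and e: "crit4 b S = {{},{h,b},{x,y,b},{x,z,b},{y,z,b}}"
  let ?U = "insert h (insert b S)"
  have xyz: "x \<in> A" "y \<in> A" "z \<in> A" "b \<notin> A" using S3(2) b by auto
  have U: "?U = {h,b,x,y,z}" using S3(1) by simp
  obtain t' b' S' where \<sigma>': "\<sigma> = insert {} (insert {t',b'} (btri b' S'))" "b' \<in> {1..m} - A" "S' \<in> triples"
    "t' \<in> A" "\<sigma> \<in> added_pairs \<longrightarrow> t' \<notin> S' \<and> t' \<noteq> apex b' S'"
  proof (cases "\<sigma> \<in> added_pairs")
    case True
    then obtain t' b' S' where "\<sigma> = insert {} (insert {t',b'} (btri b' S'))" "b' \<in> {1..m} - A" "S' \<in> triples"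
      "t' \<in> A" "t' \<notin> S'" "t' \<noteq> apex b' S'" unfolding added_pairs_def by blast
    then show thesis using that[of t' b' S'] True by blast
  next
    case False
    then obtain b' S' where "\<sigma> = crit4 b' S'" "b' \<in> {1..m} - A" "S' \<in> triples"
      using \<sigma> unfolding crit4s_def by blast
    then show thesis using that[of h b' S'] False h_A by (simp add: crit4_def)
  qed
  have "crit4 b S \<union> (\<lambda>D. ?U - D) ` crit4 b S =
    {{},{h,b},{x,y,b},{x,z,b},{y,z,b},{h,b,x,y,z},{x,y,z},{h,z},{h,y},{h,x}}"
  proof -
    have "{h,b,x,y,z} - {} = {h,b,x,y,z}" "{h,b,x,y,z} - {h,b} = {x,y,z}" "{h,b,x,y,z} - {x,y,b} = {h,z}"
      "{h,b,x,y,z} - {x,z,b} = {h,y}" "{h,b,x,y,z} - {y,z,b} = {h,x}"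
      using d by auto
    then show ?thesis
      unfolding e U by (simp only: image_insert image_empty Un_insert_left Un_empty_left)
  qed
  note le' = le[unfolded this]
  have "{t',b'} \<in> {{},{h,b},{x,y,b},{x,z,b},{y,z,b},{h,b,x,y,z},{x,y,z},{h,z},{h,y},{h,x}}"
    by (rule subsetD[OF le']) (simp add: \<sigma>'(1))
  moreover have "card {t',b'} = 2" using \<sigma>'(2,4) by (metis DiffD2 card_2_iff)
  moreover have "x \<noteq> b" "y \<noteq> b" "z \<noteq> b" using xyz by auto
  ultimately have "{t',b'} = {h,b} \<or> {t',b'} \<subseteq> A"
    using d xyz h_A by (elim insertE emptyE) simp_all
  then have tb: "t' = h" "b' = b"
    using \<sigma>'(2,4) b xyz h_A by (auto simp: doubleton_eq_iff)
  have "btri b S' \<subseteq> btri b S"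
  proof
    fix E assume E: "E \<in> btri b S'"
    have "E \<in> {{},{h,b},{x,y,b},{x,z,b},{y,z,b},{h,b,x,y,z},{x,y,z},{h,z},{h,y},{h,x}}"
      by (rule subsetD[OF le']) (use E tb in \<open>simp add: \<sigma>'(1)\<close>)
    moreover have "card E = 3" "\<not> E \<subseteq> A" using card_btri[OF \<sigma>'(3) xyz(4) E] btri_notin_A[OF \<sigma>'(3) xyz(4) E] .
    ultimately have "E \<in> {{x,y,b},{x,z,b},{y,z,b}}"
      using d xyz h_A by (elim insertE emptyE) simp_all
    also have "\<dots> = btri b S" unfolding S3(1) using d by (intro btri_3[symmetric]) auto
    finally show "E \<in> btri b S" .
  qed
  then have "S' \<subseteq> S"
    using xyz(4) triples_fin(3)[OF S(1)] triples_fin(3)[OF \<sigma>'(3)] \<sigma>'(3)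
    by (intro btri_inj[of b]) (auto simp: triples_def)
  then have SS: "S' = S"
    using S(1) \<sigma>'(3) triples_fin(1)[OF S(1)] by (intro card_subset_eq) (auto simp: triples_def)
  have "Max S \<in> S" using triples_fin[OF S(1)] by simp
  then have "apex b S = h" using S(2) by (auto simp: apex_def)
  then have "\<sigma> \<notin> added_pairs" using \<sigma>'(5) tb SS by metis
  then show ?thesis using \<sigma>'(1) tb SS by (simp add: crit4_def)
qed

lemma crit4_null:
  assumes b: "b \<in> {1..m} - A" "b < h" and S: "S \<in> triples" "S \<subseteq> {..<b}" and q: "q \<in> \<Union>K'"
  shows "null_boundary (KK (added_pairs \<union> crit4s)) q (crit4 b S)"
proof (rule crit4_explicit[OF b S])
  fix x y z assume d: "distinct [h,b,x,y,z]" and S3: "S = {x,y,z}" "{x,y,z} \<subseteq> A"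
    and e: "crit4 b S = {{},{h,b},{x,y,b},{x,z,b},{y,z,b}}"
  let ?U = "insert h (insert b S)"
  have xyz: "x \<in> A" "y \<in> A" "z \<in> A" "b \<notin> A" using S3(2) b by auto
  have U: "?U = {h,b,x,y,z}" using S3(1) by simp
  show ?thesis
  proof (rule null_boundaryI)
    have c5: "card ?U = 5" using d unfolding U by simp
    show "finite ?U" "4 \<le> card ?U" using c5 unfolding U by simp_all
    show "?U \<in> V" using crit4_V[OF b S, of "{}"] by (simp add: crit4_def)
    show "{} \<in> crit4 b S" by (simp add: crit4_def)
    show "crit4 b S \<subseteq> Pow ?U" unfolding e U by auto
    show "card (sym_diff D E) \<le> 3 \<and> card ?U \<le> 3 + card (sym_diff D E)"
      if "D \<in> crit4 b S" "E \<in> crit4 b S" "D \<noteq> E" for D E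
      using crit4_dist[OF b S that] unfolding c5 .
    show "D \<in> V \<and> ?U - D \<in> V" if "D \<in> crit4 b S" for D using crit4_V[OF b S that] .
    fix \<sigma> assume \<sigma>: "\<sigma> \<in> added_pairs \<union> crit4s"
    have "{} \<in> \<sigma>" using \<sigma> by (auto simp: added_pairs_def crit4s_def crit4_def)
    then show "{} \<in> \<sigma> \<and> (\<sigma> \<subseteq> crit4 b S \<union> (\<lambda>D. ?U - D) ` crit4 b S \<longrightarrow> crit4 b S \<subseteq> \<sigma>)"
      using crit4_pattern[OF b S \<sigma>] by blast
  qed (rule q)
qed


section \<open>Counting the critical simplices\<close>

lemma finite_quads: "finite quads"
  by (rule finite_subset[of _ "Pow A"]) (use fin_A in \<open>auto simp: quads_def\<close>)

lemma finite_crit7s: "finite crit7s"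
  unfolding crit7s_def using finite_quads by simp

lemma card_crit7s: "card crit7s = card A choose 4"
proof -
  have "inj_on crit7 quads" by (rule inj_onI) (metis Union_crit7)
  then have "card crit7s = card quads" unfolding crit7s_def by (rule card_image)
  also have "\<dots> = card A choose 4" unfolding quads_def using fin_A by (rule n_subsets)
  finally show ?thesis .
qed

definition slots :: "nat set" where
  "slots = {b \<in> {1..m} - A. b < h}"

definition low :: "nat \<Rightarrow> nat set set" where
  "low b = {S. S \<subseteq> {a\<in>A. a < b} \<and> card S = 3}"

lemma crit4s_eq: "crit4s = (\<lambda>(b, S). crit4 b S) ` (SIGMA b:slots. low b)"
proof -
  have "S \<in> triples \<and> S \<subseteq> {..<b} \<longleftrightarrow> S \<in> low b" for b S
    by (auto simp: triples_def low_def)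
  then show ?thesis unfolding crit4s_def slots_def by (auto simp: image_iff Bex_def)
qed

lemma finite_low: "finite (low b)"
  by (rule finite_subset[of _ "Pow A"]) (use fin_A in \<open>auto simp: low_def\<close>)

lemma finite_crit4s: "finite crit4s"
  unfolding crit4s_eq using finite_low by (intro finite_imageI finite_SigmaI) (auto simp: slots_def)

lemma Union_crit4: "card S = 3 \<Longrightarrow> \<Union>(crit4 b S) = insert h (insert b S)"
proof
  assume S: "card S = 3"
  have "S \<subseteq> \<Union>(btri b S)"
  proof
    fix s assume s: "s \<in> S"
    have "S \<noteq> {s}" using S by auto
    then obtain s' where "s' \<in> S" "s' \<noteq> s" using s by blast
    then show "s \<in> \<Union>(btri b S)" using s by (auto simp: btri_def)
  qed
  then show "insert h (insert b S) \<subseteq> \<Union>(crit4 b S)" by (auto simp: crit4_def)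
qed (auto simp: crit4_def btri_def)

text \<open>The union of \<open>crit4 b S\<close> determines both parameters: \<open>b\<close> is
  its only element outside \<open>A\<close>, and \<open>S\<close> is what remains inside
  \<open>A\<close> after removing \<open>h\<close>.\<close>

lemma card_crit4s: "card crit4s = (\<Sum>b\<in>slots. card {a\<in>A. a < b} choose 3)"
proof -
  have "inj_on (\<lambda>(b, S). crit4 b S) (SIGMA b:slots. low b)"
  proof (rule inj_onI)
    fix p p' assume p: "p \<in> (SIGMA b:slots. low b)" "p' \<in> (SIGMA b:slots. low b)"
      and eq: "(case p of (b, S) \<Rightarrow> crit4 b S) = (case p' of (b, S) \<Rightarrow> crit4 b S)"
    obtain b S b' S' where bs: "p = (b, S)" "p' = (b', S')" by (metis surj_pair)
    have b: "b \<in> slots" "S \<in> low b" "b' \<in> slots" "S' \<in> low b'" using p bs by auto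
    have S: "card S = 3" "S \<subseteq> A" "h \<notin> S" "card S' = 3" "S' \<subseteq> A" "h \<notin> S'"
      using b by (auto simp: low_def slots_def)
    have nb: "b \<notin> A" "b' \<notin> A" using b by (auto simp: slots_def)
    have U: "insert h (insert b S) = insert h (insert b' S')"
      using eq Union_crit4[OF S(1), of b] Union_crit4[OF S(4), of b'] unfolding bs by simp
    then have "b \<in> insert h (insert b' S')" by blast
    then have "b = b'" using nb(1) S(5) h_A by blast
    moreover have "S = S'"
    proof -
      have "S = (insert h (insert b S)) \<inter> A - {h}" using nb(1) S(2,3) by blast
      also have "\<dots> = (insert h (insert b' S')) \<inter> A - {h}" unfolding U ..
      also have "\<dots> = S'" using nb(2) S(5,6) by blast
      finally show ?thesis .
    qed
    ultimately show "p = p'" using bs by simp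
  qed
  then have "card crit4s = card (SIGMA b:slots. low b)" unfolding crit4s_eq by (rule card_image)
  also have "\<dots> = (\<Sum>b\<in>slots. card (low b))"
    using finite_low by (intro card_SigmaI) (auto simp: slots_def)
  also have "\<dots> = (\<Sum>b\<in>slots. card {a\<in>A. a < b} choose 3)"
  proof (rule sum.cong)
    show "card (low b) = card {a\<in>A. a < b} choose 3" for b
      unfolding low_def by (intro n_subsets finite_subset[OF _ fin_A]) blast
  qed simp
  finally show ?thesis .
qed

section \<open>Splitting off the critical simplices and assembling the wedge\<close>

lemma crit4s_cases:
  assumes "\<sigma> \<in> crit4s"
  obtains b S where "\<sigma> = crit4 b S" "b \<in> {1..m} - A" "b < h" "S \<in> triples" "S \<subseteq> {..<b}"
  using assms unfolding crit4s_def by blast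

text \<open>By \<open>crit4_link\<close> these simplices are maximal, so deleting their open stars
  removes nothing else; by \<open>crit4_pattern\<close> they contain none of the deleted
  \<open>added_pairs\<close>.\<close>

lemma KK_added_pairs_split: "KK added_pairs = KK (added_pairs \<union> crit4s) \<union> crit4s"
proof -
  have "\<tau> \<in> crit4s" if "\<tau> \<in> KK added_pairs" "\<sigma> \<in> crit4s" "\<sigma> \<subseteq> \<tau>" for \<tau> \<sigma>
    using that(2) by (rule crit4s_cases) (use crit4_link that in blast)
  moreover have "\<sigma> \<in> KK added_pairs" if "\<sigma> \<in> crit4s" for \<sigma>
    using that
  proof (rule crit4s_cases)
    fix b S assume \<sigma>: "\<sigma> = crit4 b S" and b: "b \<in> {1..m} - A" "b < h" and S: "S \<in> triples" "S \<subseteq> {..<b}"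
    have "\<sigma> \<subseteq> V" using crit4_V[OF b S] \<sigma> by blast
    moreover have "card (sym_diff D E) \<le> 3" if "D \<in> \<sigma>" "E \<in> \<sigma>" for D E
      using crit4_dist[OF b S, of D E] that \<sigma> by (cases "D = E") auto
    moreover have "\<sigma> \<noteq> {}" using \<sigma> by (simp add: crit4_def)
    ultimately have "\<sigma> \<in> K" unfolding K_def by blast
    moreover have "\<not> \<rho> \<subseteq> \<sigma>" if "\<rho> \<in> added_pairs" for \<rho>
    proof
      assume "\<rho> \<subseteq> \<sigma>"
      then have "\<rho> \<subseteq> crit4 b S \<union> (\<lambda>D. insert h (insert b S) - D) ` crit4 b S" unfolding \<sigma> by blast
      then show False using crit4_pattern[OF b S, of \<rho>] that by blast
    qed
    ultimately show "\<sigma> \<in> KK added_pairs" by (simp add: KK_def)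
  qed
  ultimately show ?thesis unfolding KK_def by blast
qed

text \<open>Maximality is \<open>crit7_link\<close>; the vertices of \<open>crit7 W\<close> lie in
  \<open>A\<close>, so none of the deleted edges \<open>with_added\<close> is a face of it.\<close>

lemma KK_with_added_split: "KK with_added = KK (with_added \<union> crit7s) \<union> crit7s"
proof -
  have "\<tau> \<in> crit7s" if "\<tau> \<in> KK with_added" "\<sigma> \<in> crit7s" "\<sigma> \<subseteq> \<tau>" for \<tau> \<sigma>
    using that crit7_link KK_K unfolding crit7s_def by blast
  moreover have "\<sigma> \<in> KK with_added" if "\<sigma> \<in> crit7s" for \<sigma>
  proof -
    obtain W where W: "W \<in> quads" "\<sigma> = crit7 W" using \<open>\<sigma> \<in> crit7s\<close> unfolding crit7s_def by blast
    have sub: "D \<subseteq> A" if "D \<in> \<sigma>" for D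
      using crit7_subset[OF W(1), of D] quadsD(1)[OF W(1)] that W(2) by simp
    have "\<sigma> \<noteq> {}" using W(2) by (simp add: crit7_def)
    moreover have "\<sigma> \<subseteq> V" using sub V_subset_A by blast
    ultimately have "\<sigma> \<in> K" using crit7_dist[OF W(1)] unfolding K_def W(2) by simp
    moreover have "\<not> \<rho> \<subseteq> \<sigma>" if "\<rho> \<in> with_added" for \<rho>
      using that sub unfolding with_added_def by blast
    ultimately show ?thesis by (simp add: KK_def)
  qed
  ultimately show ?thesis unfolding KK_def by blast
qed

text \<open>All spheres hang at one vertex \<open>q\<close> of the support of \<open>f x\<close>.
  Every exchanged simplex and every collapsed face contains \<open>{}\<close>, whereas the simplices
  of the spheres do not, so the collapses can be run around the spheres by
  \<open>collapse_Un\<close>. What is left is \<open>K'\<close> with spheres at \<open>q\<close>,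
  the input of \<open>bouquet_homotopy_equivalent_wedge\<close>.\<close>

lemma wedge_decomposition:
  assumes f: "compact_emb X f (underlying K')" and x: "x \<in> topspace X"
  shows "realization K homotopy_equivalent_space
    wedge (wedge X x (sphere_wedge (card crit7s) 7) None) None (sphere_wedge (card crit4s) 4) None"
proof -
  let ?k = "card crit7s" and ?l = "card crit4s"
  have inf: "infinite (UNIV :: nat set set)" by (simp add: Finite_Set.finite_set)
  have "infinite (UNIV - \<Union>K)" using inf simplicial_finite_vertices[OF simplicial_K] by simp
  then obtain e :: "nat \<Rightarrow> nat set" where e: "inj e" "range e \<subseteq> UNIV - \<Union>K"
    using infinite_countable_subset by blast
  \<comment> \<open>Blocks of 8 indices give disjoint sets of fresh vertices. A 7-sphere needs 8 of
    them besides \<open>q\<close>, a 4-sphere 5; the 7-spheres get the numbers below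
    \<open>?k\<close>, as \<open>bouquet_homotopy_equivalent_wedge\<close> expects.\<close>
  define \<Delta> where "\<Delta> j = e ` {8 * j..<8 * j + (if j < ?k then 8 else 5)}" for j
  have \<Delta>: "finite (\<Delta> j)" "card (\<Delta> j) = (if j < ?k then 8 else 5)" "\<Delta> j \<inter> \<Union>K = {}" for j
    using e by (auto simp: \<Delta>_def card_image inj_on_subset[OF e(1)])
  have \<Delta>disj: "\<Delta> i \<inter> \<Delta> j = {}" if "i \<noteq> j" for i j
  proof -
    have "{8 * i..<8 * i + (if i < ?k then 8 else 5)} \<inter> {8 * j..<8 * j + (if j < ?k then 8 else 5)} = {}"
      using that by auto
    then show ?thesis unfolding \<Delta>_def using e(1) by (metis image_Int image_empty)
  qed
  have UK: "\<Union>K = V"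
  proof
    show "\<Union>K \<subseteq> V" by (auto simp: K_def)
    have "{D} \<in> K" if "D \<in> V" for D using that by (auto simp: K_def)
    then show "V \<subseteq> \<Union>K" by blast
  qed
  have fx: "f x \<in> underlying K'" using f x by (auto simp: compact_emb_def)
  note sp = support_in_complex[OF simplicial_K' fx]
  obtain q where q: "q \<in> support (f x)" using sp(3) by blast
  have qK': "q \<in> \<Union>K'" using q sp(1) by blast
  then have qV: "q \<in> V" "q \<noteq> {}" unfolding Union_K' by blast+
  have KK_sub: "KK G \<subseteq> K" for G by (auto simp: KK_def)
  have K'_sub: "K' \<subseteq> KK G" if "\<And>\<sigma>. \<sigma> \<in> G \<Longrightarrow> {} \<in> \<sigma>" for G using that unfolding K'_def KK_def by blast
  obtain h8 where h8: "bij_betw h8 crit7s {..<?k}"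
    using finite_crit7s by (metis atLeast0LessThan ex_bij_betw_finite_nat)
  obtain h4' where h4': "bij_betw h4' crit4s {..<?l}"
    using finite_crit4s by (metis atLeast0LessThan ex_bij_betw_finite_nat)
  define h4 where "h4 \<sigma> = ?k + h4' \<sigma>" for \<sigma>
  let ?R4 = "\<Union>\<sigma>\<in>crit4s. sphere_at q (\<Delta> (h4 \<sigma>))"
  let ?R8 = "\<Union>\<sigma>\<in>crit7s. sphere_at q (\<Delta> (h8 \<sigma>))"
  have sR4: "simplicial ?R4" using finite_crit4s \<Delta>(1) by (intro simplicial_UN simplicial_sphere_at) auto
  have noR4: "{} \<notin> \<tau>" if \<tau>: "\<tau> \<in> ?R4" for \<tau>
  proof
    assume e: "{} \<in> \<tau>"
    obtain \<sigma> where "\<tau> \<in> sphere_at q (\<Delta> (h4 \<sigma>))" using \<tau> by blast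
    then have "\<tau> \<subseteq> insert q (\<Delta> (h4 \<sigma>))" by (auto simp: sphere_at_def)
    then obtain j where "{} \<in> insert q (\<Delta> j)" using e by blast
    then have "{} \<in> \<Delta> j" using qV by auto
    then show False using \<Delta>(3)[of j] empty_V UK by blast
  qed
  have "realization K homotopy_equivalent_space realization (KK added_pairs)"
    using collapse_homotopy_equivalent[OF collapse_added_pairs simplicial_K] by simp
  also have "realization (KK added_pairs) homotopy_equivalent_space realization (KK (added_pairs \<union> crit4s) \<union> ?R4)"
    unfolding KK_added_pairs_split
  proof (rule attach_simplices[OF finite_crit4s inf simplicial_KK])
    show "q \<in> \<Union>(KK (added_pairs \<union> crit4s))"
      using qK' K'_sub[of "added_pairs \<union> crit4s"] by (auto simp: added_pairs_def crit4s_def crit4_def)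
    fix \<sigma> assume \<sigma>: "\<sigma> \<in> crit4s"
    then obtain b S where bS: "\<sigma> = crit4 b S" "b \<in> {1..m} - A" "b < h" "S \<in> triples" "S \<subseteq> {..<b}"
      by (rule crit4s_cases)
    have c: "card \<sigma> = 5" using card_crit4[OF bS(2-5)] bS(1) by simp
    then show "\<sigma> \<notin> KK (added_pairs \<union> crit4s) \<and> finite \<sigma> \<and> 2 \<le> card \<sigma> \<and> null_boundary (KK (added_pairs \<union> crit4s)) q \<sigma>"
      using \<sigma> crit4_null[OF bS(2-5) qK'] bS(1) card_ge_0_finite[of \<sigma>] by (auto simp: KK_def)
    have "\<not> h4 \<sigma> < ?k" by (simp add: h4_def)
    then show "finite (\<Delta> (h4 \<sigma>)) \<and> card (\<Delta> (h4 \<sigma>)) = card \<sigma> \<and> \<Delta> (h4 \<sigma>) \<inter> \<Union>(KK (added_pairs \<union> crit4s)) = {}"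
      using \<Delta>[of "h4 \<sigma>"] c KK_sub by auto
  next
    fix \<sigma> \<tau> assume "\<sigma> \<in> crit4s" "\<tau> \<in> crit4s" "\<sigma> \<noteq> \<tau>"
    then have "h4 \<sigma> \<noteq> h4 \<tau>" using h4' by (auto simp: h4_def bij_betw_def dest: inj_onD)
    then show "\<Delta> (h4 \<sigma>) \<inter> \<Delta> (h4 \<tau>) = {}" by (rule \<Delta>disj)
  qed
  also have "\<dots> homotopy_equivalent_space realization (KK with_added \<union> ?R4)"
    using noR4 by (intro collapse_homotopy_equivalent[of "\<lambda>\<sigma>. {} \<in> \<sigma>"] collapse_Un collapse_to_with_added
      simplicial_Un simplicial_KK sR4) auto
  also have "KK with_added \<union> ?R4 = (KK (with_added \<union> crit7s) \<union> ?R4) \<union> crit7s"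
    unfolding KK_with_added_split by blast
  also have "realization ((KK (with_added \<union> crit7s) \<union> ?R4) \<union> crit7s) homotopy_equivalent_space
      realization ((KK (with_added \<union> crit7s) \<union> ?R4) \<union> ?R8)"
  proof (rule attach_simplices[OF finite_crit7s inf])
    show "simplicial (KK (with_added \<union> crit7s) \<union> ?R4)" by (intro simplicial_Un simplicial_KK sR4)
    show "q \<in> \<Union>(KK (with_added \<union> crit7s) \<union> ?R4)"
      using qK' K'_sub[of "with_added \<union> crit7s"] by (auto simp: with_added_def crit7s_def crit7_def)
    have UR: "\<Union>(KK (with_added \<union> crit7s) \<union> ?R4) \<subseteq> \<Union>K \<union> (\<Union>\<sigma>\<in>crit4s. \<Delta> (h4 \<sigma>))"
      using KK_sub[of "with_added \<union> crit7s"] qV(1) UK by (auto simp: sphere_at_def)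
    fix \<sigma> assume \<sigma>: "\<sigma> \<in> crit7s"
    then obtain W where W: "W \<in> quads" "\<sigma> = crit7 W" unfolding crit7s_def by blast
    have c: "card \<sigma> = 8" using card_crit7[OF W(1)] W(2) by simp
    have "{} \<in> \<sigma>" using W(2) by (simp add: crit7_def)
    then have "\<sigma> \<notin> ?R4" using noR4 by blast
    moreover have "\<sigma> \<notin> KK (with_added \<union> crit7s)" using \<sigma> by (auto simp: KK_def)
    moreover have "null_boundary (KK (with_added \<union> crit7s) \<union> ?R4) q \<sigma>"
      using null_boundary_mono[OF crit7_null[OF W(1) qK']] W(2) by blast
    ultimately show "\<sigma> \<notin> KK (with_added \<union> crit7s) \<union> ?R4 \<and> finite \<sigma> \<and> 2 \<le> card \<sigma> \<and>
        null_boundary (KK (with_added \<union> crit7s) \<union> ?R4) q \<sigma>"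
      using c card_ge_0_finite[of \<sigma>] by auto
    have lt: "h8 \<sigma> < ?k" using h8 \<sigma> by (auto simp: bij_betw_def)
    then have "h8 \<sigma> \<noteq> h4 \<rho>" for \<rho> by (simp add: h4_def)
    then have "\<Delta> (h8 \<sigma>) \<inter> \<Delta> (h4 \<rho>) = {}" for \<rho> by (rule \<Delta>disj)
    then have "\<Delta> (h8 \<sigma>) \<inter> \<Union>(KK (with_added \<union> crit7s) \<union> ?R4) = {}" using UR \<Delta>(3)[of "h8 \<sigma>"] by blast
    then show "finite (\<Delta> (h8 \<sigma>)) \<and> card (\<Delta> (h8 \<sigma>)) = card \<sigma> \<and>
        \<Delta> (h8 \<sigma>) \<inter> \<Union>(KK (with_added \<union> crit7s) \<union> ?R4) = {}"
      using \<Delta>[of "h8 \<sigma>"] c lt by simp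
  next
    fix \<sigma> \<tau> assume "\<sigma> \<in> crit7s" "\<tau> \<in> crit7s" "\<sigma> \<noteq> \<tau>"
    then have "h8 \<sigma> \<noteq> h8 \<tau>" using h8 by (auto simp: bij_betw_def dest: inj_onD)
    then show "\<Delta> (h8 \<sigma>) \<inter> \<Delta> (h8 \<tau>) = {}" by (rule \<Delta>disj)
  qed
  also have "(KK (with_added \<union> crit7s) \<union> ?R4) \<union> ?R8 = KK (with_added \<union> crit7s) \<union> (\<Union>j<?k+?l. sphere_at q (\<Delta> j))"
  proof -
    have "?R8 = (\<Union>j\<in>h8 ` crit7s. sphere_at q (\<Delta> j))" by simp
    also have "h8 ` crit7s = {..<?k}" using h8 by (simp add: bij_betw_def)
    finally have R8: "?R8 = (\<Union>j<?k. sphere_at q (\<Delta> j))" .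
    have "?R4 = (\<Union>j\<in>(+) ?k ` (h4' ` crit4s). sphere_at q (\<Delta> j))" by (simp add: h4_def)
    also have "h4' ` crit4s = {..<?l}" using h4' by (simp add: bij_betw_def)
    finally have R4: "?R4 = (\<Union>j\<in>(+) ?k ` {..<?l}. sphere_at q (\<Delta> j))" .
    have "{..<?k+?l} = {..<?k} \<union> (+) ?k ` {..<?l}"
      by (auto simp: image_iff Bex_def) presburger
    then show ?thesis unfolding R4 R8 by (simp only: UN_Un) blast
  qed
  also have "realization (KK (with_added \<union> crit7s) \<union> (\<Union>j<?k+?l. sphere_at q (\<Delta> j))) homotopy_equivalent_space
      realization (K' \<union> (\<Union>j<?k+?l. sphere_at q (\<Delta> j)))"
  proof (rule collapse_homotopy_equivalent[of "\<lambda>\<sigma>. {} \<in> \<sigma>"])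
    show "collapse (\<lambda>\<sigma>. {} \<in> \<sigma>) (KK (with_added \<union> crit7s) \<union> (\<Union>j<?k+?l. sphere_at q (\<Delta> j)))
        (K' \<union> (\<Union>j<?k+?l. sphere_at q (\<Delta> j)))"
    proof (rule collapse_Un[OF collapse_to_K'])
      fix \<sigma> \<tau> assume "({}::nat set) \<in> \<sigma>" "\<tau> \<in> (\<Union>j<?k+?l. sphere_at q (\<Delta> j))"
      then obtain j where "\<tau> \<subseteq> insert q (\<Delta> j)" by (auto simp: sphere_at_def)
      then have "{} \<notin> \<tau>" using qV(2) \<Delta>(3)[of j] empty_V unfolding UK by blast
      then show "\<not> \<sigma> \<subseteq> \<tau>" using \<open>{} \<in> \<sigma>\<close> by blast
    qed
    show "simplicial (KK (with_added \<union> crit7s) \<union> (\<Union>j<?k+?l. sphere_at q (\<Delta> j)))"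
      using \<Delta>(1) by (intro simplicial_Un simplicial_KK simplicial_UN simplicial_sphere_at) auto
  qed simp
  also have "\<dots> homotopy_equivalent_space
    wedge (wedge X x (sphere_wedge ?k 7) None) None (sphere_wedge ?l 4) None"
  proof (rule bouquet_homotopy_equivalent_wedge[OF inf simplicial_K' f x q])
    have "\<Union>K' \<subseteq> \<Union>K" by (auto simp: K'_def)
    then show "finite (\<Delta> j) \<and> card (\<Delta> j) = (if j < ?k then Suc 7 else Suc 4) \<and> \<Delta> j \<inter> \<Union>K' = {}" for j
      using \<Delta>[of j] by auto
  qed (rule \<Delta>disj)
  finally show ?thesis .
qed

section \<open>Returning from differences to the subsets themselves\<close>

lemma relabel_sym_diff:
  shows "(`) (sym_diff A) ` vietoris_rips (fam_preceq m A) sym_dist 3 = K"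
    and "(`) (sym_diff A) ` vietoris_rips (fam_prec m A) sym_dist 3 = K'"
proof -
  let ?\<phi> = "sym_diff A"
  have inv: "?\<phi> (?\<phi> D) = D" for D by blast
  then have inv': "?\<phi> ` ?\<phi> ` \<tau> = \<tau>" for \<tau> by (simp add: image_image)
  have \<phi>V: "?\<phi> D \<in> V \<longleftrightarrow> D \<in> fam_preceq m A" for D
  proof -
    have "D \<subseteq> {1..m}" if "D \<in> fam_preceq m A" using that A_sub by (auto simp: fam_preceq_def fam_prec_def)
    then have "?\<phi> D \<subseteq> {1..m}" if "D \<in> fam_preceq m A" using that A_sub by blast
    then show ?thesis unfolding V_def mem_Collect_eq inv by blast
  qed
  have "A \<notin> fam_prec m A" using set_prec_asym[of A A] by (auto simp: fam_prec_def)
  then have prec: "D \<in> fam_prec m A \<longleftrightarrow> D \<in> fam_preceq m A \<and> D \<noteq> A" for D by (auto simp: fam_preceq_def)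
  have dist: "sym_dist D E \<le> 3 \<longleftrightarrow> card (sym_diff (?\<phi> D) (?\<phi> E)) \<le> 3" for D E
  proof -
    have "sym_diff (?\<phi> D) (?\<phi> E) = sym_diff D E" by blast
    then show ?thesis by (simp add: sym_dist_def)
  qed
  have fin: "finite \<tau>" if "?\<phi> ` \<tau> \<subseteq> V" for \<tau>
  proof -
    have "finite (?\<phi> ` ?\<phi> ` \<tau>)" using that fin_V finite_subset by blast
    then show ?thesis by (simp only: inv')
  qed
  have mem: "\<tau> \<in> vietoris_rips (fam_preceq m A) sym_dist 3 \<longleftrightarrow> ?\<phi> ` \<tau> \<in> K" for \<tau>
    unfolding vietoris_rips_def K_def mem_Collect_eq dist using fin[of \<tau>] \<phi>V by (auto simp: image_subset_iff)
  have A\<phi>: "D = A \<longleftrightarrow> ?\<phi> D = {}" for D by blast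
  have mem': "\<tau> \<in> vietoris_rips (fam_prec m A) sym_dist 3 \<longleftrightarrow> ?\<phi> ` \<tau> \<in> K'" for \<tau>
  proof -
    have "\<tau> \<in> vietoris_rips (fam_prec m A) sym_dist 3 \<longleftrightarrow>
      \<tau> \<in> vietoris_rips (fam_preceq m A) sym_dist 3 \<and> A \<notin> \<tau>"
      unfolding vietoris_rips_def using prec by auto
    also have "A \<notin> \<tau> \<longleftrightarrow> {} \<notin> ?\<phi> ` \<tau>"
    proof
      assume "A \<notin> \<tau>"
      then show "{} \<notin> ?\<phi> ` \<tau>"
      proof (rule contrapos_nn)
        assume "{} \<in> ?\<phi> ` \<tau>"
        then obtain D where D: "{} = ?\<phi> D" "D \<in> \<tau>" by (rule imageE)
        have "D = A" by (rule A\<phi>[THEN iffD2, OF D(1)[symmetric]])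
        then show "A \<in> \<tau>" using D(2) by simp
      qed
    next
      assume e: "{} \<notin> ?\<phi> ` \<tau>"
      have z: "?\<phi> A = {}" by simp
      show "A \<notin> \<tau>"
      proof
        assume "A \<in> \<tau>"
        then have "?\<phi> A \<in> ?\<phi> ` \<tau>" by (rule imageI)
        then have "{} \<in> ?\<phi> ` \<tau>" unfolding z .
        with e show False by (rule notE)
      qed
    qed
    finally show ?thesis unfolding mem K'_def by simp
  qed
  have main: "(`) ?\<phi> ` R = L" if "\<And>\<tau>. \<tau> \<in> R \<longleftrightarrow> ?\<phi> ` \<tau> \<in> L" for R L
  proof (intro set_eqI iffI)
    fix \<tau> assume "\<tau> \<in> (`) ?\<phi> ` R"
    then obtain \<rho> where \<rho>: "\<tau> = ?\<phi> ` \<rho>" "\<rho> \<in> R" by (rule imageE)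
    show "\<tau> \<in> L" unfolding \<rho>(1) by (rule that[THEN iffD1, OF \<rho>(2)])
  next
    fix \<tau> assume "\<tau> \<in> L"
    then have "?\<phi> ` \<tau> \<in> R" by (intro that[THEN iffD2]) (simp only: inv')
    then have "?\<phi> ` ?\<phi> ` \<tau> \<in> (`) ?\<phi> ` R" by (rule imageI)
    then show "\<tau> \<in> (`) ?\<phi> ` R" by (simp only: inv')
  qed
  show "(`) ?\<phi> ` vietoris_rips (fam_preceq m A) sym_dist 3 = K" using mem by (rule main)
  show "(`) ?\<phi> ` vietoris_rips (fam_prec m A) sym_dist 3 = K'" using mem' by (rule main)
qed

end

text \<open>An element \<open>b\<close> outside \<open>A\<close> lies in the \<open>k\<close>-th gap exactly if \<open>k - 1\<close> elements of \<open>A\<close> are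
  smaller; gaps with \<open>k < 4\<close> contribute 0.\<close>

lemma sum_slots_eq:
  fixes i :: "nat \<Rightarrow> nat"
  assumes n: "1 \<le> n" and i: "strict_mono_on {1..n} i" and A: "A = i ` {1..n}" "A \<subseteq> {1..m}"
  shows "(\<Sum>b\<in>{b \<in> {1..m} - A. b < Max A}. card {a\<in>A. a < b} choose 3) =
    (\<Sum>k = 4..n. (i k - i (k - 1) - 1) * ((k - 1) choose 3))"
proof -
  let ?B = "{b \<in> {1..m} - A. b < Max A}"
  let ?gap = "\<lambda>k. {i (k - 1)<..<i k}"
  have lt: "i j < i k \<longleftrightarrow> j < k" if "j \<in> {1..n}" "k \<in> {1..n}" for j k
    using strict_mono_on_less[OF i that] .
  have le: "i j \<le> i k \<longleftrightarrow> j \<le> k" if "j \<in> {1..n}" "k \<in> {1..n}" for j k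
    using strict_mono_on_less_eq[OF i that] .
  have inj: "inj_on i {1..n}" using i by (rule strict_mono_on_imp_inj_on)
  have max: "Max A = i n"
    unfolding A(1) by (rule Max_eqI) (use n le in auto)
  have gap: "b \<in> ?B" "card {a\<in>A. a < b} = k - 1" if "k \<in> {4..n}" "b \<in> ?gap k" for b k
  proof -
    have k: "k - 1 \<in> {1..n}" "k \<in> {1..n}" using that(1) by auto
    have b: "i (k - 1) < b" "b < i k" using that(2) by auto
    have iff: "i j < b \<longleftrightarrow> j \<le> k - 1" "i j \<noteq> b" if j: "j \<in> {1..n}" for j
    proof -
      consider "j \<le> k - 1" | "k \<le> j" by linarith
      then have "(i j < b \<longleftrightarrow> j \<le> k - 1) \<and> i j \<noteq> b"
      proof cases
        case 1
        then have "i j \<le> i (k - 1)" using le[OF j k(1)] by simp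
        then show ?thesis using b 1 by linarith
      next
        case 2
        then have "i k \<le> i j" using le[OF k(2) j] by simp
        moreover have "\<not> j \<le> k - 1" using 2 k(1) by auto
        ultimately show ?thesis using b by linarith
      qed
      then show "i j < b \<longleftrightarrow> j \<le> k - 1" "i j \<noteq> b" by blast+
    qed
    have "b \<notin> A" using iff(2) unfolding A(1) by blast
    moreover have "i k \<le> i n" using le[OF k(2)] n k(2) by auto
    moreover have "i n \<in> A" unfolding A(1) using n by simp
    then have "i n \<in> {1..m}" using A(2) by blast
    ultimately show "b \<in> ?B" using b unfolding max by auto
    have "{a\<in>A. a < b} = i ` {1..k - 1}"
      unfolding A(1) using iff(1) k by auto
    then show "card {a\<in>A. a < b} = k - 1"
      using inj_on_subset[OF inj, of "{1..k - 1}"] k by (simp add: card_image)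
  qed
  \<comment> \<open>The gap containing \<open>b\<close> is found from the last index
    \<open>Max J\<close> with \<open>i j < b\<close>: three smaller elements force
    \<open>Max J\<close> to be at least 3, and \<open>b < Max A\<close> keeps it below
    \<open>n\<close>.\<close>
  have cover: "\<exists>k\<in>{4..n}. b \<in> ?gap k" if b: "b \<in> ?B" "3 \<le> card {a\<in>A. a < b}" for b
  proof -
    define J where "J = {j\<in>{1..n}. i j < b}"
    have "{a\<in>A. a < b} = i ` J" unfolding A(1) J_def by blast
    moreover have "J \<subseteq> {1..n}" unfolding J_def by blast
    then have "card (i ` J) = card J" by (intro card_image inj_on_subset[OF inj])
    ultimately have "card {a\<in>A. a < b} = card J" by simp
    then have c: "3 \<le> card J" using b(2) by simp
    have fJ: "finite J" by (simp add: J_def)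
    then have "J \<noteq> {}" using c by auto
    then have MJ: "Max J \<in> J" using fJ by simp
    have "J \<subseteq> {1..Max J}" using fJ by (auto simp: J_def)
    then have "card J \<le> card {1..Max J}" by (intro card_mono) auto
    then have "3 \<le> Max J" using c by simp
    moreover have "Max J \<noteq> n" using MJ b(1) unfolding max J_def by auto
    moreover have "Max J \<in> {1..n}" using MJ by (simp add: J_def)
    ultimately have k: "Suc (Max J) \<in> {4..n}" by auto
    have "Suc (Max J) \<notin> J" using Max_ge[OF fJ] by fastforce
    then have "b \<le> i (Suc (Max J))" using k by (auto simp: J_def)
    moreover have "i (Suc (Max J)) \<noteq> b" using b(1) k unfolding A(1) by auto
    ultimately have "b \<in> ?gap (Suc (Max J))" using MJ by (auto simp: J_def)
    then show ?thesis using k by blast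
  qed
  have sub: "(\<Union>k\<in>{4..n}. ?gap k) \<subseteq> ?B" using gap(1) by blast
  have zero: "card {a\<in>A. a < b} choose 3 = 0" if "b \<in> ?B - (\<Union>k\<in>{4..n}. ?gap k)" for b
    using cover[of b] that by (intro binomial_eq_0) (meson DiffD1 DiffD2 UN_I not_le)
  have "(\<Sum>b\<in>?B. card {a\<in>A. a < b} choose 3) = (\<Sum>b\<in>(\<Union>k\<in>{4..n}. ?gap k). card {a\<in>A. a < b} choose 3)"
    by (rule sum.mono_neutral_right[OF _ sub]) (use zero in auto)
  also have "\<dots> = (\<Sum>k = 4..n. \<Sum>b\<in>?gap k. card {a\<in>A. a < b} choose 3)"
  proof (rule sum.UNION_disjoint)
    show "\<forall>k\<in>{4..n}. \<forall>l\<in>{4..n}. k \<noteq> l \<longrightarrow> ?gap k \<inter> ?gap l = {}"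
    proof (intro ballI impI)
      fix k l assume kl: "k \<in> {4..n}" "l \<in> {4..n}" "k \<noteq> l"
      show "?gap k \<inter> ?gap l = {}"
      proof (rule ccontr)
        assume "?gap k \<inter> ?gap l \<noteq> {}"
        then obtain b where "b \<in> ?gap k" "b \<in> ?gap l" by blast
        then have "k - 1 = l - 1" using gap(2)[OF kl(1)] gap(2)[OF kl(2)] by metis
        then show False using kl by auto
      qed
    qed
  qed auto
  also have "\<dots> = (\<Sum>k = 4..n. \<Sum>b\<in>?gap k. (k - 1) choose 3)"
    by (rule sum.cong[OF refl], rule sum.cong[OF refl], simp only: gap(2))
  also have "\<dots> = (\<Sum>k = 4..n. (i k - i (k - 1) - 1) * ((k - 1) choose 3))"
    by simp
  finally show ?thesis .
qed

theorem theorem5p1: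
  fixes m n :: nat and A :: "nat set" and i :: "nat \<Rightarrow> nat" and p :: "nat set \<Rightarrow> real"
  assumes "m \<ge> 1" and "n \<ge> 4"
    and "strict_mono_on {1..n} i" and "A = i ` {1..n}" and "A \<subseteq> {1..m}"
    and "p \<in> topspace (realization (vietoris_rips (fam_prec m A) sym_dist 3))"
  shows "realization (vietoris_rips (fam_preceq m A) sym_dist 3) homotopy_equivalent_space
     wedge
       (wedge (realization (vietoris_rips (fam_prec m A) sym_dist 3)) p
              (sphere_wedge (n choose 4) 7) None)
       None
       (sphere_wedge (\<Sum>k = 4..n. (i k - i (k - 1) - 1) * ((k - 1) choose 3)) 4) None"
proof -
  let ?L = "vietoris_rips (fam_preceq m A) sym_dist 3"
  let ?L' = "vietoris_rips (fam_prec m A) sym_dist 3"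
  let ?\<phi> = "sym_diff A"
  have card: "card A = n"
    unfolding assms(4) using strict_mono_on_imp_inj_on[OF assms(3)] by (simp add: card_image)
  interpret segment m A
    using assms(2,5) card by unfold_locales simp_all
  have inv: "?\<phi> (?\<phi> D) = D" for D by blast
  then have inv': "(`) ?\<phi> ` (`) ?\<phi> ` R = R" for R by (simp add: image_image)
  have sL: "simplicial ?L"
    using simplicial_relabel[OF simplicial_K, of ?\<phi>] unfolding relabel_sym_diff(1)[symmetric] inv' .
  have sL': "simplicial ?L'"
    using simplicial_relabel[OF simplicial_K', of ?\<phi>] unfolding relabel_sym_diff(2)[symmetric] inv' .
  have "realization ?L homeomorphic_space realization K"
    using compact_emb_homeomorphic[OF compact_emb_relabel[OF sL, of ?\<phi>, OF inv]]
    unfolding relabel_sym_diff(1) realization_eq[OF simplicial_K] .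
  then have "realization ?L homotopy_equivalent_space realization K"
    by (rule homeomorphic_imp_homotopy_equivalent_space)
  \<comment> \<open>The wedge keeps the original complex as its summand; the relabelling enters only
    as the embedding of its realization onto \<open>underlying K'\<close>, so \<open>p\<close> need
    not be transported.\<close>
  also have "\<dots> homotopy_equivalent_space
     wedge (wedge (realization ?L') p (sphere_wedge (card crit7s) 7) None) None (sphere_wedge (card crit4s) 4) None"
    using compact_emb_relabel[OF sL', of ?\<phi>, OF inv] assms(6)
    unfolding relabel_sym_diff(2) by (rule wedge_decomposition)
  also have "card crit7s = n choose 4" unfolding card_crit7s card ..
  also have "card crit4s = (\<Sum>k = 4..n. (i k - i (k - 1) - 1) * ((k - 1) choose 3))"
    unfolding card_crit4s slots_def h_def
    by (rule sum_slots_eq) (use assms in simp_all)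
  finally show ?thesis .
qed

end
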